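(* There are two distinct optimally dense admissible horoball arrangements $\mathcal{B}_{336}^1$ and $\mathcal{B}_{336}^2$ (described in the context) for the tetrahedral Coxeter tiling $(3,3,6)$, with the same density: $\delta(\mathcal{B}_{336}^i)\approx 0.85327609$ for $i=1,2$. Here optimally dense means that the arrangement has the maximal density $\delta$ among all admissible horoball arrangements in the cell $P_{336}$.
   Context: $\mathbb{H}^3$ is hyperbolic 3-space of curvature $-1$. The Coxeter tiling $(3,3,6)$ is the regular face-to-face tiling of $\mathbb{H}^3$ by congruent regular ideal tetrahedra $P_{336}$ (all 4 vertices on $\partial\mathbb{H}^3$, dihedral angle $2\pi/6$). An admissible horoball arrangement $\mathcal{B}_{336}$ in $P_{336}$ consists of one horoball $B_i$ centered at each vertex $E_i$ ($i=0,1,2,3$) such that (i) the horoballs have pairwise disjoint interiors (tangency is allowed), and (ii) the interior of $B_i$ does not meet the face of $P_{336}$ opposite to $E_i$. Its density is $$\delta(\mathcal{B}_{336})=\frac{\sum_{i} \mathrm{Vol}(B_i\cap P_{336})}{\mathrm{Vol}(P_{336})}.$$ Two horoballs centered at vertices of the cell are of the same type if a symmetry of the cell carries one to the other. The "midpoint" of an edge is the foot of the perpendicular from the center of the cell to that edge. The arrangements: $\mathcal{B}_{336}^1$: all four horoballs are of the same type and are pairwise tangent at the midpoints of the edges. $\mathcal{B}_{336}^2$: one (large) horoball is tangent to the face of $P_{336}$ opposite to its center; the other three horoballs are of the same type, each tangent to the large horoball, and not tangent to one another. *)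

theory Defs
  imports "HOL-Analysis.Analysis"
begin

text \<open>
  Hyperbolic 3-space of curvature \<open>-1\<close> in the projective (Cayley--Klein) model: the open unit
  ball, with the unit sphere as ideal boundary. Geodesics, planes and convex hulls are the
  Euclidean ones intersected with the ball.
\<close>

type_synonym point = "real ^ 3"

definition H3 :: "point set" where
  "H3 = ball 0 1"

text \<open>
  The Riemannian metric tensor of the model at \<open>x\<close>, the distance it induces, and its volume
  measure; \<open>(1 - (norm x)\<^sup>2) powr -2\<close> is the square root of the determinant of the tensor in
  dimension 3.
\<close>

definition hmetric :: "point \<Rightarrow> point \<Rightarrow> point \<Rightarrow> real" where
  "hmetric x u v =
     (u \<bullet> v) / (1 - (norm x)\<^sup>2) + (x \<bullet> u) * (x \<bullet> v) / (1 - (norm x)\<^sup>2)\<^sup>2"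

definition hdist :: "point \<Rightarrow> point \<Rightarrow> real" where
  "hdist x y = arcosh ((1 - x \<bullet> y) / sqrt ((1 - (norm x)\<^sup>2) * (1 - (norm y)\<^sup>2)))"

definition hmeasure :: "point measure" where
  "hmeasure = density lborel (\<lambda>x. indicator H3 x * ennreal (1 / (1 - (norm x)\<^sup>2)\<^sup>2))"

definition hvol :: "point set \<Rightarrow> real" where
  "hvol A = measure hmeasure A"

definition hisometry :: "(point \<Rightarrow> point) \<Rightarrow> bool" where
  "hisometry f \<longleftrightarrow> bij_betw f H3 H3 \<and> (\<forall>x\<in>H3. \<forall>y\<in>H3. hdist (f x) (f y) = hdist x y)"

text \<open>
  The closed horoball centred at the ideal point \<open>e\<close>: with
  \<open>b x = ln ((1 - x \<bullet> e) / sqrt (1 - (norm x)\<^sup>2))\<close>, the Busemann function of \<open>e\<close> that vanishes at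
  the origin, it is the sublevel set \<open>exp (2 * b x) \<le> s\<close>. The ideal point \<open>e\<close> itself is not included.
\<close>

definition horoball :: "point \<Rightarrow> real \<Rightarrow> point set" where
  "horoball e s = {x \<in> H3. (1 - x \<bullet> e)\<^sup>2 \<le> s * (1 - (norm x)\<^sup>2)}"

text \<open>
  Polyhedra are given by their finite sets of ideal vertices; the hull of a vertex set is the part
  of its convex hull that lies in hyperbolic space.
\<close>

definition hhull :: "point set \<Rightarrow> point set" where
  "hhull W = H3 \<inter> convex hull W"

definition ideal_tetrahedron :: "point set \<Rightarrow> bool" where
  "ideal_tetrahedron V \<longleftrightarrow> card V = 4 \<and> V \<subseteq> sphere 0 1 \<and> \<not> affine_dependent V"

definition opposite_face :: "point set \<Rightarrow> point \<Rightarrow> point set" where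
  "opposite_face V v = hhull (V - {v})"

definition hangle :: "point \<Rightarrow> point \<Rightarrow> point \<Rightarrow> real" where
  "hangle p u v = arccos (hmetric p u v / (sqrt (hmetric p u u) * sqrt (hmetric p v v)))"

text \<open>The component of \<open>w\<close> orthogonal to \<open>e\<close> in the tangent space at \<open>p\<close>.\<close>

definition perp_part :: "point \<Rightarrow> point \<Rightarrow> point \<Rightarrow> point" where
  "perp_part p e w = w - (hmetric p w e / hmetric p e e) *\<^sub>R e"

text \<open>
  The dihedral angle at a point \<open>p\<close> of the edge \<open>a b\<close>, between the faces \<open>a b c\<close> and \<open>a b d\<close>: the
  angle between the vectors at \<open>p\<close> that are orthogonal to the edge and point into these faces.
\<close>

definition dihedral_angle :: "point \<Rightarrow> point \<Rightarrow> point \<Rightarrow> point \<Rightarrow> point \<Rightarrow> real" where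
  "dihedral_angle p a b c d =
     hangle p (perp_part p (b - a) (c - p)) (perp_part p (b - a) (d - p))"

text \<open>Regularity: every permutation of the vertices is induced by a symmetry.\<close>

definition regular_tetrahedron :: "point set \<Rightarrow> bool" where
  "regular_tetrahedron V \<longleftrightarrow>
     (\<forall>\<pi>. bij_betw \<pi> V V \<longrightarrow>
        (\<exists>f. hisometry f \<and> (\<forall>W\<subseteq>V. f ` hhull W = hhull (\<pi> ` W))))"

definition cell_336 :: "point set \<Rightarrow> bool" where
  "cell_336 V \<longleftrightarrow>
     ideal_tetrahedron V \<and> regular_tetrahedron V \<and>
     (\<forall>a b c d. V = {a, b, c, d} \<longrightarrow>
        (\<forall>p\<in>open_segment a b. dihedral_angle p a b c d = 2 * pi / 6))"

text \<open>
  The tiling \<open>(3,3,6)\<close>, as the set of the vertex sets of its cells. The three clauses after the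
  first say that the cells cover hyperbolic space, that they meet face to face (so that distinct
  cells have disjoint interiors), and that the symmetries of the tiling act transitively on its
  flags; a flag amounts to a cell with an ordering of its vertices.
\<close>

definition coxeter_tiling_336 :: "point set set \<Rightarrow> bool" where
  "coxeter_tiling_336 T \<longleftrightarrow>
     (\<forall>V\<in>T. cell_336 V) \<and>
     (\<Union>V\<in>T. hhull V) = H3 \<and>
     (\<forall>V\<in>T. \<forall>W\<in>T. hhull V \<inter> hhull W = hhull (V \<inter> W)) \<and>
     (\<forall>V\<in>T. \<forall>W\<in>T. \<forall>\<pi>. bij_betw \<pi> V W \<longrightarrow>
        (\<exists>f. hisometry f \<and> (\<forall>U\<subseteq>V. f ` hhull U = hhull (\<pi> ` U)) \<and>
             (\<lambda>U. f ` hhull U) ` T = hhull ` T))"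

definition cell_symmetry :: "point set \<Rightarrow> (point \<Rightarrow> point) \<Rightarrow> bool" where
  "cell_symmetry V f \<longleftrightarrow> hisometry f \<and> f ` hhull V = hhull V"

text \<open>The centre of a cell is the centre of its inscribed ball.\<close>

definition is_center :: "point set \<Rightarrow> point \<Rightarrow> bool" where
  "is_center V c \<longleftrightarrow>
     c \<in> hhull V \<and>
     (\<forall>v\<in>V. \<forall>w\<in>V. (INF y\<in>opposite_face V v. hdist c y) = (INF y\<in>opposite_face V w. hdist c y))"

definition is_perp_foot :: "point \<Rightarrow> point \<Rightarrow> point \<Rightarrow> point \<Rightarrow> bool" where
  "is_perp_foot c a b m \<longleftrightarrow> m \<in> open_segment a b \<and> hmetric m (c - m) (b - a) = 0"

definition is_edge_midpoint :: "point set \<Rightarrow> point \<Rightarrow> point \<Rightarrow> point \<Rightarrow> bool" where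
  "is_edge_midpoint V a b m \<longleftrightarrow> (\<exists>c. is_center V c \<and> is_perp_foot c a b m)"

text \<open>
  A horoball and another horoball or a face are tangent iff they have exactly one common point.
\<close>

definition tangent_at :: "point set \<Rightarrow> point set \<Rightarrow> point \<Rightarrow> bool" where
  "tangent_at A B p \<longleftrightarrow> A \<inter> B = {p}"

definition tangent :: "point set \<Rightarrow> point set \<Rightarrow> bool" where
  "tangent A B \<longleftrightarrow> (\<exists>p. tangent_at A B p)"

definition same_type :: "point set \<Rightarrow> point set \<Rightarrow> point set \<Rightarrow> bool" where
  "same_type V A B \<longleftrightarrow> (\<exists>f. cell_symmetry V f \<and> f ` A = B)"

text \<open>
  An arrangement assigns to each vertex \<open>v\<close> of the cell a horoball \<open>B v\<close>; the values of \<open>B\<close> outside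
  the vertex set are irrelevant.
\<close>

definition admissible :: "point set \<Rightarrow> (point \<Rightarrow> point set) \<Rightarrow> bool" where
  "admissible V B \<longleftrightarrow>
     (\<forall>v\<in>V. \<exists>s>0. B v = horoball v s) \<and>
     (\<forall>v\<in>V. \<forall>w\<in>V. v \<noteq> w \<longrightarrow> interior (B v) \<inter> interior (B w) = {}) \<and>
     (\<forall>v\<in>V. interior (B v) \<inter> opposite_face V v = {})"

definition arr_density :: "point set \<Rightarrow> (point \<Rightarrow> point set) \<Rightarrow> real" where
  "arr_density V B = (\<Sum>v\<in>V. hvol (B v \<inter> hhull V)) / hvol (hhull V)"

definition optimally_dense :: "point set \<Rightarrow> (point \<Rightarrow> point set) \<Rightarrow> bool" where
  "optimally_dense V B \<longleftrightarrow>
     admissible V B \<and> (\<forall>B'. admissible V B' \<longrightarrow> arr_density V B' \<le> arr_density V B)"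

definition arrangement_336_1 :: "point set \<Rightarrow> (point \<Rightarrow> point set) \<Rightarrow> bool" where
  "arrangement_336_1 V B \<longleftrightarrow>
     admissible V B \<and>
     (\<forall>v\<in>V. \<forall>w\<in>V. same_type V (B v) (B w)) \<and>
     (\<forall>v\<in>V. \<forall>w\<in>V. v \<noteq> w \<longrightarrow>
        (\<exists>m. is_edge_midpoint V v w m \<and> tangent_at (B v) (B w) m))"

definition arrangement_336_2 :: "point set \<Rightarrow> (point \<Rightarrow> point set) \<Rightarrow> bool" where
  "arrangement_336_2 V B \<longleftrightarrow>
     admissible V B \<and>
     (\<exists>v\<in>V.
        tangent (B v) (opposite_face V v) \<and>
        (\<forall>w\<in>V - {v}. tangent (B v) (B w)) \<and>
        (\<forall>w\<in>V - {v}. \<forall>w'\<in>V - {v}. same_type V (B w) (B w')) \<and>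
        (\<forall>w\<in>V - {v}. \<forall>w'\<in>V - {v}. w \<noteq> w' \<longrightarrow> \<not> tangent (B w) (B w')))"

text \<open>Two arrangements count as the same if a symmetry of the cell carries one to the other.\<close>

definition equivalent_arr ::
  "point set \<Rightarrow> (point \<Rightarrow> point set) \<Rightarrow> (point \<Rightarrow> point set) \<Rightarrow> bool" where
  "equivalent_arr V B B' \<longleftrightarrow>
     (\<exists>f. cell_symmetry V f \<and> (\<lambda>v. f ` B v) ` V = B' ` V)"

end

theory Submission
  imports Defs "HOL-Real_Asymp.Real_Asymp"
begin

text \<open>
  In the Lorentzian picture a point \<open>x\<close> of the ball is the vector \<open>(1, x)\<close>, and the condition that
  all dihedral angles are \<open>pi / 3\<close> means that the null vectors \<open>(1, v)\<close> of the vertices can be rescaled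
  to \<open>(1, v) / l v\<close> with all pairwise products \<open>-1\<close>. The horoball at \<open>v\<close> is then measured by a number
  \<open>\<rho> v > 0\<close>, and an arrangement is admissible iff \<open>\<rho> v * \<rho> w \<le> 1\<close> for \<open>v \<noteq> w\<close> and \<open>\<rho> v \<le> 3\<close>. The
  part of such a horoball in the cell has volume \<open>sqrt 3 / 8 * \<rho> v\<close>, so the density is maximal iff
  \<open>\<Sum>v\<in>V. \<rho> v\<close> is; the maximum \<open>4\<close> is attained at \<open>(1, 1, 1, 1)\<close> and at \<open>(3, 1 / 3, 1 / 3, 1 / 3)\<close>.

  The volumes are computed in the basis of the rescaled null vectors, where neither the quadratic form
  nor the determinant depends on the cell. The volume of the cell is \<open>sqrt 3 / 2\<close> times
  \<open>\<integral>t\<in>{0..1}. - ln t / (1 - t + t\<^sup>2) = (\<Sum>k. 1 / (6k+1)\<^sup>2 + 1 / (6k+2)\<^sup>2 - 1 / (6k+4)\<^sup>2 - 1 / (6k+5)\<^sup>2)\<close>,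
  whose inverse is the optimal density.
\<close>

section \<open>Changes of variables\<close>

text \<open>The cell may sit anywhere in the ball, so no coordinates of its vertices are available.
  The scales \<open>l v\<close> carry all dependence on the position and cancel from every final
  quantity. Their existence is a rank-one question: six Gram entries must factor through four
  numbers, and the dihedral angles supply the two equations that this requires.

  The constants are those of the upper half-space picture with one vertex at infinity over an
  equilateral triangle of side 1. A horosphere at height h has area sqrt 3 / (4 * h ^ 2) in the cell
  and bounds half of that as volume; \<rho> is 1 / h ^ 2, which explains the linearity. At h = 1 it
  touches the horoballs of diameter 1 at the other vertices. The opposite face lies on a hemisphere
  of radius 1 / sqrt 3, the circumradius of the triangle, whence \<rho> \<le> 3.

  Symmetries are needed only for exchanging two vertices. The reflections that do this are
  projective but not affine maps of the ball, so every statement about hulls has to control the sign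
  of a homogenising factor.\<close>

lemma nn_integral_linear_det:
  fixes f :: "real^3 \<Rightarrow> real^3"
  assumes lin: "linear f" and det: "det (matrix f) \<noteq> 0"
    and [measurable]: "F \<in> borel_measurable borel"
  shows "(\<integral>\<^sup>+x. F x \<partial>lborel) = ennreal \<bar>det (matrix f)\<bar> * (\<integral>\<^sup>+x. F (f x) \<partial>lborel)"
proof -
  have [measurable]: "f \<in> borel_measurable borel"
    using lin by (intro borel_measurable_continuous_onI linear_continuous_on) (simp add: linear_linear)
  have "inj f"
    using det lin by (simp add: det_nz_iff_inj)
  then obtain g where g: "linear g" "\<And>x. g (f x) = x" "\<And>x. f (g x) = x"
    using linear_injective_isomorphism[OF lin] by auto
  \<comment> \<open>Lebesgue measure is characterised by its values on boxes; the preimage of a box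
    is its image under the inverse \<open>g\<close>, whose measure
    \<open>measure_linear_image\<close> compares with that of the box.\<close>
  have "lborel = density (distr lborel borel f) (\<lambda>_. ennreal \<bar>det (matrix f)\<bar>)"
  proof (rule lborel_eqI)
    fix l u :: "real^3"
    assume lu: "\<And>b. b \<in> Basis \<Longrightarrow> l \<bullet> b \<le> u \<bullet> b"
    have S: "f -` box l u = g ` box l u"
      using g by (auto simp: image_iff) metis
    have meas: "g ` box l u \<in> lmeasurable"
      by (intro measurable_linear_image g) simp
    have "f ` (g ` box l u) = box l u"
      using g by (auto simp: image_iff)
    then have "measure lebesgue (box l u) = \<bar>det (matrix f)\<bar> * measure lebesgue (g ` box l u)"
      using measure_linear_image[OF lin meas] by simp
    then have "ennreal \<bar>det (matrix f)\<bar> * emeasure lebesgue (g ` box l u) = emeasure lebesgue (box l u)"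
      using meas by (simp add: emeasure_eq_measure2 fmeasurableD ennreal_mult[symmetric])
    moreover have "f -` box l u \<in> sets borel"
      using measurable_sets[of f borel borel "box l u"] by simp
    ultimately show "emeasure (density (distr lborel borel f) (\<lambda>_. ennreal \<bar>det (matrix f)\<bar>)) (box l u)
        = ennreal (prod ((\<bullet>) (u - l)) Basis)"
      using lu by (simp add: emeasure_density_const emeasure_distr S)
  qed simp
  then have "(\<integral>\<^sup>+x. F x \<partial>lborel) = (\<integral>\<^sup>+x. F x \<partial>density (distr lborel borel f) (\<lambda>_. ennreal \<bar>det (matrix f)\<bar>))"
    by simp
  also have "\<dots> = ennreal \<bar>det (matrix f)\<bar> * (\<integral>\<^sup>+x. F (f x) \<partial>lborel)"
    by (simp add: nn_integral_density nn_integral_distr nn_integral_cmult)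
  finally show ?thesis .
qed

lemma emeasure_lborel_Times:
  fixes A :: "'a::euclidean_space set" and B :: "'b::euclidean_space set"
  assumes "A \<in> sets borel" "B \<in> sets borel"
  shows "emeasure lborel (A \<times> B) = emeasure lborel A * emeasure lborel B"
  using assms by (subst lborel_prod[symmetric]) (simp add: lborel.emeasure_pair_measure_Times)

text \<open>\<open>real^3\<close> is not a product type, so Fubini is reached through the coordinate
  map \<open>h\<close> from triples, under which boxes pull back to products of intervals.\<close>

lemma nn_integral_vec3:
  fixes F :: "real^3 \<Rightarrow> ennreal"
  assumes [measurable]: "F \<in> borel_measurable borel"
  shows "(\<integral>\<^sup>+x. F x \<partial>lborel) = (\<integral>\<^sup>+a. \<integral>\<^sup>+b. \<integral>\<^sup>+c. F (vector [a, b, c]) \<partial>lborel \<partial>lborel \<partial>lborel)"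
proof -
  define h :: "real \<times> real \<times> real \<Rightarrow> real^3" where "h = (\<lambda>(a, b, c). vector [a, b, c])"
  have h_eq: "h = (\<lambda>p. fst p *\<^sub>R axis 1 1 + fst (snd p) *\<^sub>R axis 2 1 + snd (snd p) *\<^sub>R axis 3 1)"
    by (auto simp: h_def vec_eq_iff forall_3 axis_def)
  have [measurable]: "h \<in> borel_measurable borel"
    unfolding h_eq by (intro borel_measurable_continuous_onI continuous_intros)
  have "lborel = distr lborel borel h"
  proof (rule lborel_eqI)
    fix l u :: "real^3"
    assume lu: "\<And>b. b \<in> Basis \<Longrightarrow> l \<bullet> b \<le> u \<bullet> b"
    have lu': "l $ i \<le> u $ i" for i
      using lu[of "axis i 1"] by (simp add: inner_axis axis_eq_axis Basis_vec_def)
    have S: "h -` box l u = {l$1<..<u$1} \<times> {l$2<..<u$2} \<times> {l$3<..<u$3}"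
      by (auto simp: h_def mem_box_cart forall_3)
    have "emeasure lborel (h -` box l u) =
        emeasure lborel {l$1<..<u$1} * (emeasure lborel {l$2<..<u$2} * emeasure lborel {l$3<..<u$3})"
      unfolding S by (simp add: emeasure_lborel_Times borel_Times del: emeasure_lborel_Ioo)
    also have "\<dots> = ennreal ((u$1 - l$1) * ((u$2 - l$2) * (u$3 - l$3)))"
      using lu' by (simp add: ennreal_mult)
    also have "(u$1 - l$1) * ((u$2 - l$2) * (u$3 - l$3)) = prod ((\<bullet>) (u - l)) Basis"
    proof -
      have B: "Basis = (\<lambda>i. axis i 1 :: real^3) ` UNIV"
        by (auto simp: Basis_vec_def)
      have "inj (\<lambda>i. axis i 1 :: real^3)"
        by (auto simp: inj_on_def axis_eq_axis)
      then have "prod ((\<bullet>) (u - l)) Basis = (\<Prod>i\<in>UNIV. u$i - l$i)"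
        unfolding B by (simp add: prod.reindex inner_axis)
      also have "\<dots> = (u$1 - l$1) * ((u$2 - l$2) * (u$3 - l$3))"
        unfolding UNIV_3 by simp
      finally show ?thesis
        by simp
    qed
    finally show "emeasure (distr lborel borel h) (box l u) = ennreal (prod ((\<bullet>) (u - l)) Basis)"
      by (simp add: emeasure_distr)
  qed simp
  then have "(\<integral>\<^sup>+x. F x \<partial>lborel) = (\<integral>\<^sup>+x. F x \<partial>distr lborel borel h)"
    by simp
  also have "\<dots> = (\<integral>\<^sup>+p. F (h p) \<partial>lborel)"
    by (simp add: nn_integral_distr)
  also have "\<dots> = (\<integral>\<^sup>+a. \<integral>\<^sup>+q. F (h (a, q)) \<partial>lborel \<partial>lborel)"
    by (subst lborel_prod[symmetric], subst lborel.nn_integral_fst[symmetric]) (simp_all add: lborel_prod)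
  also have "\<dots> = (\<integral>\<^sup>+a. \<integral>\<^sup>+b. \<integral>\<^sup>+c. F (h (a, b, c)) \<partial>lborel \<partial>lborel \<partial>lborel)"
    by (intro nn_integral_cong, subst lborel_prod[symmetric], subst lborel.nn_integral_fst[symmetric])
      (simp_all add: lborel_prod)
  finally show ?thesis by (simp add: h_def)
qed

text \<open>The substitution a = \<rho> t, b = \<rho> (1 - t), c = \<rho> z, where \<rho> = a + b.
  Rays from the apex become lines of constant t and z, along which the hyperbolic density integrates
  in closed form. It is composed of one-variable affine substitutions and exchanges of order; the
  scalings of a and of c contribute one factor \<open>\<bar>\<rho>\<bar>\<close> each.\<close>

lemma nn_integral_cone_coordinates:
  fixes F :: "real \<Rightarrow> real \<Rightarrow> real \<Rightarrow> ennreal"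
  assumes F[measurable]: "(\<lambda>(a, b, c). F a b c) \<in> borel_measurable borel"
  shows "(\<integral>\<^sup>+a. \<integral>\<^sup>+b. \<integral>\<^sup>+c. F a b c \<partial>lborel \<partial>lborel \<partial>lborel) =
    (\<integral>\<^sup>+t. \<integral>\<^sup>+z. \<integral>\<^sup>+\<rho>. ennreal (\<rho>\<^sup>2) * F (\<rho> * t) (\<rho> * (1 - t)) (\<rho> * z) \<partial>lborel \<partial>lborel \<partial>lborel)"
proof -
  have F'[measurable (raw)]: "(\<lambda>x. F (f x) (g x) (h x)) \<in> borel_measurable M"
    if [measurable]: "f \<in> borel_measurable M" "g \<in> borel_measurable M" "h \<in> borel_measurable M" for f g h and M :: "'b measure"
  proof -
    have "(\<lambda>x. (f x, g x, h x)) \<in> M \<rightarrow>\<^sub>M borel \<Otimes>\<^sub>M borel \<Otimes>\<^sub>M borel" by measurable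
    then have "(\<lambda>x. (f x, g x, h x)) \<in> M \<rightarrow>\<^sub>M borel" by (simp add: borel_prod)
    from measurable_compose[OF this F] show ?thesis by simp
  qed
  have "(\<integral>\<^sup>+a. \<integral>\<^sup>+b. \<integral>\<^sup>+c. F a b c \<partial>lborel \<partial>lborel \<partial>lborel)
      = (\<integral>\<^sup>+a. \<integral>\<^sup>+\<rho>. \<integral>\<^sup>+c. F a (\<rho> - a) c \<partial>lborel \<partial>lborel \<partial>lborel)"
  proof (rule nn_integral_cong)
    fix a
    show "(\<integral>\<^sup>+b. \<integral>\<^sup>+c. F a b c \<partial>lborel \<partial>lborel) = (\<integral>\<^sup>+\<rho>. \<integral>\<^sup>+c. F a (\<rho> - a) c \<partial>lborel \<partial>lborel)"
      by (subst nn_integral_real_affine[where c=1 and t="-a"]) simp_all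
  qed
  also have "\<dots> = (\<integral>\<^sup>+\<rho>. \<integral>\<^sup>+a. \<integral>\<^sup>+c. F a (\<rho> - a) c \<partial>lborel \<partial>lborel \<partial>lborel)"
    by (rule lborel_pair.Fubini') measurable
  also have "\<dots> = (\<integral>\<^sup>+\<rho>. \<integral>\<^sup>+t. \<integral>\<^sup>+z. ennreal (\<rho>\<^sup>2) * F (\<rho> * t) (\<rho> * (1 - t)) (\<rho> * z) \<partial>lborel \<partial>lborel \<partial>lborel)"
  proof (rule nn_integral_cong_AE)
    have "(\<integral>\<^sup>+a. \<integral>\<^sup>+c. F a (\<rho> - a) c \<partial>lborel \<partial>lborel) =
          (\<integral>\<^sup>+t. \<integral>\<^sup>+z. ennreal (\<rho>\<^sup>2) * F (\<rho> * t) (\<rho> * (1 - t)) (\<rho> * z) \<partial>lborel \<partial>lborel)" if "\<rho> \<noteq> 0" for \<rho>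
    proof -
      have "(\<integral>\<^sup>+a. \<integral>\<^sup>+c. F a (\<rho> - a) c \<partial>lborel \<partial>lborel) =
          ennreal \<bar>\<rho>\<bar> * (\<integral>\<^sup>+t. \<integral>\<^sup>+c. F (\<rho> * t) (\<rho> - \<rho> * t) c \<partial>lborel \<partial>lborel)"
        using that by (subst nn_integral_real_affine[where c=\<rho> and t=0]) simp_all
      also have "\<dots> = ennreal \<bar>\<rho>\<bar> * (\<integral>\<^sup>+t. ennreal \<bar>\<rho>\<bar> * (\<integral>\<^sup>+z. F (\<rho> * t) (\<rho> - \<rho> * t) (\<rho> * z) \<partial>lborel) \<partial>lborel)"
        using that by (subst nn_integral_real_affine[where c=\<rho> and t=0]) simp_all
      also have "\<dots> = ennreal \<bar>\<rho>\<bar> * (ennreal \<bar>\<rho>\<bar> * (\<integral>\<^sup>+t. \<integral>\<^sup>+z. F (\<rho> * t) (\<rho> - \<rho> * t) (\<rho> * z) \<partial>lborel \<partial>lborel))"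
        by (subst nn_integral_cmult) simp_all
      also have "\<dots> = ennreal (\<rho>\<^sup>2) * (\<integral>\<^sup>+t. \<integral>\<^sup>+z. F (\<rho> * t) (\<rho> - \<rho> * t) (\<rho> * z) \<partial>lborel \<partial>lborel)"
        by (simp add: mult.assoc[symmetric] ennreal_mult[symmetric] power2_eq_square)
      finally show ?thesis
        by (simp add: nn_integral_cmult right_diff_distrib)
    qed
    \<comment> \<open>The scalings degenerate only at \<rho> = 0, a null set.\<close>
    then show "AE \<rho> in lborel. (\<integral>\<^sup>+a. \<integral>\<^sup>+c. F a (\<rho> - a) c \<partial>lborel \<partial>lborel) =
          (\<integral>\<^sup>+t. \<integral>\<^sup>+z. ennreal (\<rho>\<^sup>2) * F (\<rho> * t) (\<rho> * (1 - t)) (\<rho> * z) \<partial>lborel \<partial>lborel)"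
      using AE_lborel_singleton[of 0] by (auto elim!: eventually_mono)
  qed
  also have "\<dots> = (\<integral>\<^sup>+t. \<integral>\<^sup>+\<rho>. \<integral>\<^sup>+z. ennreal (\<rho>\<^sup>2) * F (\<rho> * t) (\<rho> * (1 - t)) (\<rho> * z) \<partial>lborel \<partial>lborel \<partial>lborel)"
    by (rule lborel_pair.Fubini') measurable
  also have "\<dots> = (\<integral>\<^sup>+t. \<integral>\<^sup>+z. \<integral>\<^sup>+\<rho>. ennreal (\<rho>\<^sup>2) * F (\<rho> * t) (\<rho> * (1 - t)) (\<rho> * z) \<partial>lborel \<partial>lborel \<partial>lborel)"
    by (intro nn_integral_cong lborel_pair.Fubini') measurable
  finally show ?thesis .
qed

section \<open>The series for the volume\<close>

text \<open>The sum of these terms is \<open>2 / sqrt 3\<close> times the volume of the regular ideal tetrahedron.\<close>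

definition gieseking_term :: "nat \<Rightarrow> real" where
  "gieseking_term k = 1 / (6 * real k + 1)\<^sup>2 + 1 / (6 * real k + 2)\<^sup>2
     - 1 / (6 * real k + 4)\<^sup>2 - 1 / (6 * real k + 5)\<^sup>2"

text \<open>The telescoping bounds are the first terms of the Euler--Maclaurin expansion of the tail, in
  \<open>u = 6 * k\<close>; \<open>110\<close> rounds up the next coefficient.\<close>

lemma gieseking_term_ge_telescope:
  fixes u :: real
  assumes "u > 0"
  defines "g \<equiv> \<lambda>u. 1 / u ^ 2 - 6 / u ^ 4 :: real"
  shows "g u - g (u + 6) \<le> 1 / (u + 1)\<^sup>2 + 1 / (u + 2)\<^sup>2 - 1 / (u + 4)\<^sup>2 - 1 / (u + 5)\<^sup>2"
proof -
  \<comment> \<open>Clearing denominators leaves a polynomial with positive coefficients only, so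
    its sign for \<open>u > 0\<close> is visible.\<close>
  let ?N = "12441600 * u ^ 0 + 56816640 * u ^ 1 + 110139264 * u ^ 2 + 117613440 * u ^ 3 + 76050720 * u ^ 4 + 30876864 * u ^ 5 + 7893648 * u ^ 6 + 1231248 * u ^ 7 + 106920 * u ^ 8 + 3960 * u ^ 9"
  let ?D = "(u + 1)\<^sup>2 * (u + 2)\<^sup>2 * (u + 4)\<^sup>2 * (u + 5)\<^sup>2 * u ^ 4 * (u + 6) ^ 4"
  have nz: "u \<noteq> 0" "u + 1 \<noteq> 0" "u + 2 \<noteq> 0" "u + 4 \<noteq> 0" "u + 5 \<noteq> 0" "u + 6 \<noteq> 0"
    using assms(1) by auto
  have "1 / (u + 1)\<^sup>2 + 1 / (u + 2)\<^sup>2 - 1 / (u + 4)\<^sup>2 - 1 / (u + 5)\<^sup>2 - (g u - g (u + 6)) = ?N / ?D"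
    unfolding g_def using nz by (simp add: divide_simps) algebra
  moreover have "?N / ?D \<ge> 0"
    using assms(1) by (intro divide_nonneg_nonneg add_nonneg_nonneg mult_nonneg_nonneg) auto
  ultimately show ?thesis by linarith
qed

lemma gieseking_term_le_telescope:
  fixes u :: real
  assumes "u > 0"
  defines "g \<equiv> \<lambda>u. 1 / u ^ 2 - 6 / u ^ 4 + 110 / u ^ 6 :: real"
  shows "1 / (u + 1)\<^sup>2 + 1 / (u + 2)\<^sup>2 - 1 / (u + 4)\<^sup>2 - 1 / (u + 5)\<^sup>2 \<le> g u - g (u + 6)"
proof -
  let ?N = "8211456000 * u ^ 0 + 40236134400 * u ^ 1 + 86340349440 * u ^ 2 + 107408471040 * u ^ 3 + 86290983936 * u ^ 4 + 47093444352 * u ^ 5 + 17834717376 * u ^ 6 + 4690953216 * u ^ 7 + 840658824 * u ^ 8 + 97885272 * u ^ 9 + 6674976 * u ^ 10 + 202272 * u ^ 11"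
  let ?D = "(u + 1)\<^sup>2 * (u + 2)\<^sup>2 * (u + 4)\<^sup>2 * (u + 5)\<^sup>2 * u ^ 6 * (u + 6) ^ 6"
  have nz: "u \<noteq> 0" "u + 1 \<noteq> 0" "u + 2 \<noteq> 0" "u + 4 \<noteq> 0" "u + 5 \<noteq> 0" "u + 6 \<noteq> 0"
    using assms(1) by auto
  have "g u - g (u + 6) - (1 / (u + 1)\<^sup>2 + 1 / (u + 2)\<^sup>2 - 1 / (u + 4)\<^sup>2 - 1 / (u + 5)\<^sup>2) = ?N / ?D"
    unfolding g_def using nz by (simp add: divide_simps) algebra
  moreover have "?N / ?D \<ge> 0"
    using assms(1) by (intro divide_nonneg_nonneg add_nonneg_nonneg mult_nonneg_nonneg) auto
  ultimately show ?thesis by linarith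
qed

lemma gieseking_term_nonneg: "gieseking_term k \<ge> 0"
proof -
  have "1 / (6 * real k + 4)\<^sup>2 \<le> 1 / (6 * real k + 1)\<^sup>2" "1 / (6 * real k + 5)\<^sup>2 \<le> 1 / (6 * real k + 2)\<^sup>2"
    by (intro divide_left_mono power_mono; simp)+
  then show ?thesis by (simp add: gieseking_term_def)
qed

text \<open>After ten explicit terms the tail starts at u = 60, where the two telescoping bounds
  differ by 110 / 60 ^ 6 < 3 / 10 ^ 9. The decimals lie just inside the reciprocals of 0.853276095
  and 0.853276085, the accuracy that the density needs.\<close>

lemma gieseking_bounds:
  "summable gieseking_term" (is ?summable)
  "1.1719536103 \<le> suminf gieseking_term" (is ?lower)
  "suminf gieseking_term \<le> 1.1719536238" (is ?upper)
proof -
  define l where "l = (\<lambda>k. 1 / (6 * real k + 60) ^ 2 - 6 / (6 * real k + 60) ^ 4)"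
  define h where "h = (\<lambda>k. 1 / (6 * real k + 60) ^ 2 - 6 / (6 * real k + 60) ^ 4 + 110 / (6 * real k + 60) ^ 6)"
  let ?t = "\<lambda>k. gieseking_term (k + 10)"
  have t_eq: "?t k = 1 / (6 * real k + 60 + 1)\<^sup>2 + 1 / (6 * real k + 60 + 2)\<^sup>2
       - 1 / (6 * real k + 60 + 4)\<^sup>2 - 1 / (6 * real k + 60 + 5)\<^sup>2" for k
    by (simp add: gieseking_term_def algebra_simps)
  have lt: "l k - l (Suc k) \<le> ?t k" for k
    using gieseking_term_ge_telescope[of "6 * real k + 60"] unfolding t_eq l_def by (simp add: algebra_simps)
  have th: "?t k \<le> h k - h (Suc k)" for k
    using gieseking_term_le_telescope[of "6 * real k + 60"] unfolding t_eq h_def by (simp add: algebra_simps)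
  have "l \<longlonglongrightarrow> 0" "h \<longlonglongrightarrow> 0"
    unfolding l_def h_def by real_asymp+
  note sl = telescope_sums'[OF this(1)] and sh = telescope_sums'[OF this(2)]
  have st: "summable ?t"
    using th gieseking_term_nonneg by (intro summable_comparison_test'[OF sums_summable[OF sh], of 0]) auto
  then show ?summable
    by (simp add: summable_iff_shift)
  then have eq: "suminf gieseking_term = suminf ?t + (\<Sum>k<10. gieseking_term k)"
    by (rule suminf_split_initial_segment)
  have "l 0 \<le> suminf ?t"
    using suminf_le[OF lt sums_summable[OF sl] st] sums_unique[OF sl] by simp
  moreover have "suminf ?t \<le> h 0"
    using suminf_le[OF th st sums_summable[OF sh]] sums_unique[OF sh] by simp
  moreover have "1.1719536103 \<le> l 0 + (\<Sum>k<10. gieseking_term k)" "h 0 + (\<Sum>k<10. gieseking_term k) \<le> 1.1719536238"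
    by (simp_all add: l_def h_def gieseking_term_def eval_nat_numeral lessThan_Suc)
  ultimately show ?lower ?upper
    using eq by linarith+
qed

section \<open>One-variable integrals leading to the series\<close>

lemma nn_integral_inverse_square_affine:
  fixes A B M :: real
  assumes A: "A > 0" and M: "M \<ge> 0" and AB: "A + B * M > 0"
  shows "(\<integral>\<^sup>+x. ennreal (1 / (A + B * x)\<^sup>2) * indicator {0..M} x \<partial>lborel) = ennreal (M / (A * (A + B * M)))"
proof -
  have pos: "A + B * x > 0" if "x \<in> {0..M}" for x
  proof (cases "B \<ge> 0")
    case True then show ?thesis using A that by (simp add: add_pos_nonneg)
  next
    case False
    then have "B * M \<le> B * x" using that by (intro mult_left_mono_neg) auto
    then show ?thesis using AB by linarith
  qed
  \<comment> \<open>This antiderivative vanishes at 0 and does not divide by \<open>B\<close>, so no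
    case distinction on \<open>B\<close> arises; in the application the sign of \<open>B\<close>
    varies with the ray.\<close>
  have "((\<lambda>x. x / (A * (A + B * x))) has_real_derivative 1 / (A + B * x)\<^sup>2) (at x)" if "x \<in> {0..M}" for x
  proof -
    have nz: "A \<noteq> 0" "A + B * x \<noteq> 0"
      using pos[OF that] A by auto
    then have "((\<lambda>x. x / (A * (A + B * x))) has_real_derivative
        (1 * (A * (A + B * x)) - x * (A * B)) / (A * (A + B * x) * (A * (A + B * x)))) (at x)"
      by (intro DERIV_divide) (auto intro!: derivative_eq_intros)
    also have "1 * (A * (A + B * x)) - x * (A * B) = A * A"
      by (simp add: algebra_simps)
    also have "A * A / (A * (A + B * x) * (A * (A + B * x))) = 1 / (A + B * x)\<^sup>2"
      using nz by (simp add: power2_eq_square)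
    finally show ?thesis .
  qed
  then show ?thesis
    using M by (subst nn_integral_FTC_Icc[where F="\<lambda>x. x / (A * (A + B * x))"]) auto
qed

lemma nn_integral_inverse_cube:
  "(\<integral>\<^sup>+x. ennreal (1 / (1 + x) ^ 3) * indicator {0..} x \<partial>lborel) = ennreal (1 / 2)"
proof -
  have "((\<lambda>x. - 1 / (2 * (1 + x)\<^sup>2)) has_real_derivative 1 / (1 + x) ^ 3) (at x)" if "0 \<le> x" for x :: real
  proof -
    have "((\<lambda>x. - 1 / (2 * (1 + x)\<^sup>2)) has_real_derivative
        (0 * (2 * (1 + x)\<^sup>2) - - 1 * (2 * (2 * (1 + x)))) / (2 * (1 + x)\<^sup>2 * (2 * (1 + x)\<^sup>2))) (at x)"
      using that by (intro DERIV_divide) (auto intro!: derivative_eq_intros)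
    also have "(0 * (2 * (1 + x)\<^sup>2) - - 1 * (2 * (2 * (1 + x)))) / (2 * (1 + x)\<^sup>2 * (2 * (1 + x)\<^sup>2)) = 1 / (1 + x) ^ 3"
      using that by (simp add: divide_simps) algebra
    finally show ?thesis .
  qed
  moreover have "((\<lambda>x::real. - 1 / (2 * (1 + x)\<^sup>2)) \<longlongrightarrow> 0) at_top"
    by real_asymp
  ultimately show ?thesis
    by (subst nn_integral_FTC_atLeast[where F="\<lambda>x. - 1 / (2 * (1 + x)\<^sup>2)" and T=0]) auto
qed

lemma nn_integral_inverse_product:
  fixes c :: real
  assumes c: "0 < c" "c < 1"
  shows "(\<integral>\<^sup>+x. ennreal (1 / ((1 + x) * (c + x))) * indicator {0..} x \<partial>lborel) = ennreal (- ln c / (1 - c))"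
proof -
  let ?F = "\<lambda>x. (ln (c + x) - ln (1 + x)) / (1 - c)"
  have "(?F has_real_derivative 1 / ((1 + x) * (c + x))) (at x)" if "0 \<le> x" for x
    using that c by (auto intro!: derivative_eq_intros simp: divide_simps)
  moreover have "(?F \<longlongrightarrow> 0 / (1 - c)) at_top"
  proof (intro tendsto_divide tendsto_const)
    show "((\<lambda>x. ln (c + x) - ln (1 + x)) \<longlongrightarrow> 0) at_top" by real_asymp
  qed (use c in auto)
  ultimately show ?thesis
    using c by (subst nn_integral_FTC_atLeast[where F="?F" and T=0]) auto
qed

text \<open>For \<open>n = 0\<close> the integrand is unbounded at 0, hence the fundamental theorem
  is used in the form with one-sided limits at the ends of an open interval.\<close>

lemma nn_integral_ln_power:
  "(\<integral>\<^sup>+x. ennreal (- ln x * x ^ n) * indicator {0<..<1} x \<partial>lborel) = ennreal (1 / (real n + 1)\<^sup>2)"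
proof -
  let ?f = "\<lambda>x::real. - ln x * x ^ n" and ?F = "\<lambda>x::real. x ^ Suc n / (real n + 1)\<^sup>2 - ln x * x ^ Suc n / (real n + 1)"
  have D: "(?F has_real_derivative ?f x) (at x)" if "0 < x" for x
  proof -
    have "(?F has_real_derivative (real (Suc n) * x ^ n) / (real n + 1)\<^sup>2
        - (1 / x * x ^ Suc n + (real (Suc n) * x ^ n) * ln x) / (real n + 1)) (at x)"
      using that by (intro DERIV_diff DERIV_cdivide DERIV_mult DERIV_ln_divide)
        (auto intro!: derivative_eq_intros simp del: power_Suc)
    moreover have "(real (Suc n) * x ^ n) / (real n + 1)\<^sup>2 = x ^ n / (real n + 1)"
      by (simp add: power2_eq_square divide_simps)
    moreover have "(1 / x * x ^ Suc n + (real (Suc n) * x ^ n) * ln x) / (real n + 1) = x ^ n / (real n + 1) + x ^ n * ln x"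
      using that by (simp add: divide_simps)
    ultimately show ?thesis
      by (simp add: mult.commute)
  qed
  \<comment> \<open>For \<open>n = 0\<close> the factor \<open>x ^ n\<close> tends to 1, so the
    limit 0 has to come from \<open>ln x * x\<close> alone.\<close>
  have "((\<lambda>x. ln x * x) \<longlongrightarrow> (0::real)) (at_right 0)"
    by real_asymp
  moreover have "((\<lambda>x. x ^ n) \<longlongrightarrow> 0 ^ n) (at_right (0::real))"
    by (intro tendsto_intros)
  ultimately have "((\<lambda>x. ln x * x * x ^ n) \<longlongrightarrow> 0 * 0 ^ n) (at_right (0::real))"
    by (rule tendsto_mult)
  then have l: "((\<lambda>x. ln x * x ^ Suc n) \<longlongrightarrow> 0) (at_right (0::real))"
    by (simp add: mult.assoc)
  have "(?F \<longlongrightarrow> 0 ^ Suc n / (real n + 1)\<^sup>2 - 0 / (real n + 1)) (at_right 0)"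
    by (intro tendsto_diff tendsto_divide l tendsto_const tendsto_power tendsto_ident_at) auto
  then have A: "((?F \<circ> real_of_ereal) \<longlongrightarrow> 0) (at_right (ereal 0))"
    by (simp add: ereal_tendsto_simps del: zero_ereal_def)
  have "(?F \<longlongrightarrow> ?F 1) (at_left 1)"
    using D[of 1] by (intro tendsto_within_subset[OF isContD[OF DERIV_isCont]]) auto
  then have B: "((?F \<circ> real_of_ereal) \<longlongrightarrow> ?F 1) (at_left (ereal 1))"
    by (simp add: ereal_tendsto_simps del: one_ereal_def)
  have nn: "AE x in lborel. ereal 0 < ereal x \<longrightarrow> ereal x < ereal 1 \<longrightarrow> 0 \<le> ?f x"
    by (auto simp: mult_nonpos_nonneg)
  have cont: "isCont ?f x" if "ereal 0 < ereal x" for x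
    using that by (auto intro!: continuous_intros)
  note FTC = interval_integral_FTC_nonneg[OF _ D cont nn A B]
  have int: "integrable lborel (\<lambda>x. indicator {0<..<1} x * ?f x)"
    using FTC(1) by (simp add: set_integrable_def)
  have "(\<integral>\<^sup>+x. ennreal (?f x) * indicator {0<..<1} x \<partial>lborel) = (\<integral>\<^sup>+x. ennreal (indicator {0<..<1} x * ?f x) \<partial>lborel)"
    by (intro nn_integral_cong) (auto split: split_indicator)
  also have "\<dots> = ennreal (\<integral>x. indicator {0<..<1} x * ?f x \<partial>lborel)"
    by (rule nn_integral_eq_integral[OF int]) (auto split: split_indicator simp: mult_nonpos_nonneg)
  also have "(\<integral>x. indicator {0<..<1} x * ?f x \<partial>lborel) = ?F 1"
    using FTC(2) by (simp add: interval_lebesgue_integral_def set_lebesgue_integral_def)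
  finally show ?thesis by simp
qed

lemma nn_integral_gieseking:
  "(\<integral>\<^sup>+t. ennreal (- ln t / (1 - t + t\<^sup>2)) * indicator {0<..<1} t \<partial>lborel) = ennreal (suminf gieseking_term)"
proof -
  \<comment> \<open>\<open>1 / (1 - t + t\<^sup>2) = (1 + t) * (1 - t ^ 3) / (1 - t ^ 6)\<close> gives a series of nonnegative terms.\<close>
  let ?p = "\<lambda>k t. - ln t * (1 + t) * (1 - t ^ 3) * (t ^ 6) ^ k :: real"
  have pos: "?p k t \<ge> 0" if "t \<in> {0<..<1}" for k t
    using that by (intro mult_nonneg_nonneg) (auto intro: power_le_one)
  have "(\<integral>\<^sup>+t. ennreal (- ln t / (1 - t + t\<^sup>2)) * indicator {0<..<1} t \<partial>lborel)
      = (\<integral>\<^sup>+t. (\<Sum>k. ennreal (?p k t) * indicator {0<..<1} t) \<partial>lborel)"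
  proof (rule nn_integral_cong)
    fix t :: real
    show "ennreal (- ln t / (1 - t + t\<^sup>2)) * indicator {0<..<1} t = (\<Sum>k. ennreal (?p k t) * indicator {0<..<1} t)"
    proof (cases "t \<in> {0<..<1}")
      case True
      then have t6: "t ^ 6 < 1"
        using power_Suc_less_one[of t 5] by simp
      then have "(\<lambda>k. (t ^ 6) ^ k) sums (1 / (1 - t ^ 6))"
        using True by (intro geometric_sums) auto
      then have "(\<lambda>k. ?p k t) sums (- ln t * (1 + t) * (1 - t ^ 3) * (1 / (1 - t ^ 6)))"
        by (rule sums_mult)
      moreover have "(1 + t) * (1 - t ^ 3) * (1 - t + t\<^sup>2) = 1 - t ^ 6"
        by algebra
      then have "(1 + t) * (1 - t ^ 3) * (1 / (1 - t ^ 6)) = 1 / (1 - t + t\<^sup>2)"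
        using t6 by (auto simp: divide_simps)
      then have "- ln t * (1 + t) * (1 - t ^ 3) * (1 / (1 - t ^ 6)) = - ln t / (1 - t + t\<^sup>2)"
        by (metis mult.assoc times_divide_eq_right mult.right_neutral)
      ultimately have s: "(\<lambda>k. ?p k t) sums (- ln t / (1 - t + t\<^sup>2))"
        by simp
      have "(\<Sum>k. ennreal (?p k t)) = ennreal (- ln t / (1 - t + t\<^sup>2))"
        using suminf_ennreal2[OF pos[OF True] sums_summable[OF s]] sums_unique[OF s] by simp
      then show ?thesis using True by simp
    qed simp
  qed
  also have "\<dots> = (\<Sum>k. \<integral>\<^sup>+t. ennreal (?p k t) * indicator {0<..<1} t \<partial>lborel)"
    by (rule nn_integral_suminf) measurable
  also have "\<dots> = (\<Sum>k. ennreal (gieseking_term k))"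
  proof (rule suminf_cong)
    fix k
    \<comment> \<open>Nonnegative integrals cannot be subtracted freely: the two negative terms are
      moved to the other side and finite summands are cancelled. The exponents 6k, 6k+1, 6k+3, 6k+4
      give the denominators 6k+1, 6k+2, 6k+4, 6k+5, because \<open>nn_integral_ln_power\<close>
      turns exponent n into (n+1) squared.\<close>
    have cancel: "x = y" if "x + ennreal c = y + ennreal c" for x y c
      using that by simp
    let ?q = "\<lambda>n. \<integral>\<^sup>+x. ennreal (- ln x * x ^ n) * indicator {0<..<1} x \<partial>lborel"
    have "(\<integral>\<^sup>+t. ennreal (?p k t) * indicator {0<..<1} t \<partial>lborel) + (?q (6 * k + 3) + ?q (6 * k + 4)) =
       ?q (6 * k) + ?q (6 * k + 1)"
    proof -
      have aux: "ennreal a + (ennreal b + ennreal c) = ennreal d + ennreal e"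
        if "0 \<le> a" "0 \<le> b" "0 \<le> c" "0 \<le> d" "0 \<le> e" "a + (b + c) = d + e" for a b c d e
        using that by (simp flip: ennreal_plus)
      have "ennreal (?p k t) * indicator {0<..<1} t + (ennreal (- ln t * t ^ (6 * k + 3)) * indicator {0<..<1} t
         + ennreal (- ln t * t ^ (6 * k + 4)) * indicator {0<..<1} t) =
         ennreal (- ln t * t ^ (6 * k)) * indicator {0<..<1} t + ennreal (- ln t * t ^ (6 * k + 1)) * indicator {0<..<1} t" for t
      proof (cases "t \<in> {0<..<1}")
        case True
        then have n: "- ln t * t ^ m \<ge> 0" for m by (intro mult_nonneg_nonneg) auto
        have e: "?p k t + (- ln t * t ^ (6 * k + 3) + - ln t * t ^ (6 * k + 4)) = - ln t * t ^ (6 * k) + - ln t * t ^ (6 * k + 1)"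
          unfolding power_add power_mult by algebra
        then show ?thesis
          using True aux[OF pos[OF True] n n n n e] by simp
      qed simp
      then have "(\<integral>\<^sup>+t. ennreal (?p k t) * indicator {0<..<1} t + (ennreal (- ln t * t ^ (6 * k + 3)) * indicator {0<..<1} t
           + ennreal (- ln t * t ^ (6 * k + 4)) * indicator {0<..<1} t) \<partial>lborel) =
         (\<integral>\<^sup>+t. ennreal (- ln t * t ^ (6 * k)) * indicator {0<..<1} t + ennreal (- ln t * t ^ (6 * k + 1)) * indicator {0<..<1} t \<partial>lborel)"
        by (intro nn_integral_cong)
      then show ?thesis
        by (subst (asm) nn_integral_add, measurable, subst (asm) nn_integral_add, measurable, subst (asm) nn_integral_add, measurable)
    qed
    then have "(\<integral>\<^sup>+t. ennreal (?p k t) * indicator {0<..<1} t \<partial>lborel) + ennreal (1 / (6 * real k + 4)\<^sup>2 + 1 / (6 * real k + 5)\<^sup>2)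
       = ennreal (gieseking_term k) + ennreal (1 / (6 * real k + 4)\<^sup>2 + 1 / (6 * real k + 5)\<^sup>2)"
      unfolding nn_integral_ln_power using gieseking_term_nonneg[of k]
      by (simp add: ennreal_plus[symmetric] gieseking_term_def add_ac del: ennreal_plus)
    then show "(\<integral>\<^sup>+t. ennreal (?p k t) * indicator {0<..<1} t \<partial>lborel) = ennreal (gieseking_term k)"
      using cancel by blast
  qed
  also have "\<dots> = ennreal (suminf gieseking_term)"
    by (rule suminf_ennreal2[OF gieseking_term_nonneg gieseking_bounds(1)])
  finally show ?thesis .
qed

section \<open>Dihedral angles and Gram matrices\<close>

lemma gap_pos:
  fixes v w :: point
  assumes "norm v = 1" "norm w = 1" "v \<noteq> w"
  shows "0 < 1 - v \<bullet> w"
proof -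
  have "0 < (norm (v - w))\<^sup>2" using assms by simp
  moreover have "2 * (v \<bullet> w) = 2 - (norm (v - w))\<^sup>2"
    using dot_norm_neg[of v w] assms by simp
  ultimately show ?thesis by linarith
qed

text \<open>\<open>hmetric p\<close> is the Euclidean inner product pulled back along the linear map
  \<open>E\<close>, so this is Cauchy-Schwarz. It is needed because \<open>arccos z = pi / 3\<close>
  determines \<open>z\<close> only when \<open>z\<close> is known to lie between -1 and 1.\<close>

lemma abs_hmetric_le:
  assumes "norm p < 1"
  shows "\<bar>hmetric p u v\<bar> \<le> sqrt (hmetric p u u) * sqrt (hmetric p v v)"
proof -
  define k where "k = 1 - (norm p)\<^sup>2"
  have k: "k > 0" using assms by (simp add: k_def power_less_one_iff abs_square_less_1)
  define E where "E = (\<lambda>u. ((1 / sqrt k) *\<^sub>R u, (p \<bullet> u) / k))"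
  have "hmetric p u v = (u \<bullet> v) / k + (p \<bullet> u) * (p \<bullet> v) / k\<^sup>2" for u v
    by (simp add: hmetric_def k_def)
  then have E: "hmetric p u v = E u \<bullet> E v" for u v
    using k by (simp add: E_def power2_eq_square)
  show ?thesis unfolding E using Cauchy_Schwarz_ineq2[of "E u" "E v"] by (simp add: norm_eq_sqrt_inner)
qed

text \<open>In Lorentzian terms the parts of \<open>(1, c)\<close> and \<open>(1, d)\<close>
  orthogonal to the plane of \<open>(1, a)\<close> and \<open>(1, b)\<close> enclose the dihedral
  angle. With G = g a b, X = g a c * g b d and Y = g a d * g b c its cosine is (X + Y - G * g c d) /
  (2 * sqrt (X * Y)), here equal to 1 / 2. The Euclidean midpoint is a convenient point of the edge
  because it is orthogonal to b - a.\<close>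

lemma dihedral_angle_gram:
  assumes n: "norm a = 1" "norm b = 1" "norm c = 1" "norm d = 1"
    and ne: "a \<noteq> b" "a \<noteq> c" "a \<noteq> d" "b \<noteq> c" "b \<noteq> d"
    and ang: "dihedral_angle (midpoint a b) a b c d = 2 * pi / 6"
  defines "g \<equiv> \<lambda>v w. 1 - v \<bullet> w"
  shows "g a c * g b d + g a d * g b c - g a b * g c d = sqrt (g a c * g b d) * sqrt (g a d * g b c)"
proof -
  define p where "p = midpoint a b"
  define G where "G = g a b"
  define e where "e = b - a"
  have sq: "a \<bullet> a = 1" "b \<bullet> b = 1" "c \<bullet> c = 1" "d \<bullet> d = 1"
    using n by (simp_all add: dot_square_norm)
  have pos: "g a b > 0" "g a c > 0" "g a d > 0" "g b c > 0" "g b d > 0"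
    unfolding g_def using n ne by (blast intro: gap_pos)+
  have p: "p = (1 / 2) *\<^sub>R (a + b)" by (simp add: p_def midpoint_def)
  have k: "1 - (norm p)\<^sup>2 = G / 2"
    unfolding power2_norm_eq_inner p G_def g_def using sq by (simp add: inner_add_left inner_add_right inner_commute field_simps)
  have pe: "p \<bullet> e = 0" unfolding p e_def using sq by (simp add: inner_add_left inner_add_right inner_diff_left inner_diff_right inner_commute)
  have G: "G > 0" using pos by (simp add: G_def)
  have ee: "e \<bullet> e = 2 * G" unfolding e_def G_def g_def using sq by (simp add: inner_diff_left inner_diff_right inner_commute)
  have pp: "p \<bullet> p = 1 - G / 2" using k by (simp add: power2_norm_eq_inner)
  define u where "u = (\<lambda>c. perp_part p e (c - p))"
  have u: "u c = c - p - ((g a c - g b c) / (2 * G)) *\<^sub>R e" for c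
  proof -
    have "(c - p) \<bullet> e = g a c - g b c"
      using pe by (simp add: inner_diff_left) (simp add: e_def g_def inner_diff_right inner_commute)
    then show ?thesis
      unfolding u_def perp_part_def hmetric_def k pe ee using G by (simp add: field_simps)
  qed
  have pc: "p \<bullet> c = 1 - (g a c + g b c) / 2" for c
    unfolding p g_def by (simp add: inner_add_left field_simps)
  have ec: "e \<bullet> c = g a c - g b c" for c
    unfolding e_def g_def by (simp add: inner_diff_left)
  have pu: "p \<bullet> u c = G / 2 - (g a c + g b c) / 2" for c
  proof -
    have "p \<bullet> u c = p \<bullet> c - p \<bullet> p - (g a c - g b c) / (2 * G) * (p \<bullet> e)"
      unfolding u by (simp add: inner_diff_right)
    then show ?thesis
      unfolding pe pp pc[of c] by simp
  qed
  have uu: "u c \<bullet> u d = (g a c + g b c + g a d + g b d) / 2 - g c d - G / 2 - (g a c - g b c) * (g a d - g b d) / (2 * G)" for c d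
  proof -
    define r where "r = (\<lambda>c. (g a c - g b c) / (2 * G))"
    have u': "u c = c - p - r c *\<^sub>R e" for c
      by (simp add: u r_def)
    have "u c \<bullet> u d = c \<bullet> d - p \<bullet> c - p \<bullet> d + p \<bullet> p - r c * (e \<bullet> d) - r d * (e \<bullet> c) + r c * r d * (e \<bullet> e)"
      unfolding u' using pe
      by (simp add: inner_diff_left inner_diff_right inner_commute algebra_simps)
    also have "\<dots> = (g a c + g b c + g a d + g b d) / 2 - g c d - G / 2 - (g a c - g b c) * (g a d - g b d) / (2 * G)"
    proof -
      have cd: "c \<bullet> d = 1 - g c d" by (simp add: g_def)
      show ?thesis unfolding pc[of c] pc[of d] r_def ec[of c] ec[of d] pp ee cd using G by (simp add: field_simps)
    qed
    finally show ?thesis .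
  qed
  have H: "hmetric p (u c) (u d) = (g a c * g b d + g a d * g b c - G * g c d) * 2 / G\<^sup>2" for c d
    unfolding hmetric_def k pu uu using G by (simp add: field_simps power2_eq_square)
  have g0: "g c c = 0" "g d d = 0" using sq by (simp_all add: g_def)
  define X where "X = g a c * g b d"
  define Y where "Y = g a d * g b c"
  have XY: "X > 0" "Y > 0" using pos by (simp_all add: X_def Y_def)
  define W where "W = X + Y - G * g c d"
  define z where "z = hmetric p (u c) (u d) / (sqrt (hmetric p (u c) (u c)) * sqrt (hmetric p (u d) (u d)))"
  have "norm p < 1"
  proof -
    have "(norm p)\<^sup>2 < 1" using k G by simp
    then show ?thesis by (simp add: abs_square_less_1)
  qed
  then have "\<bar>z\<bar> \<le> 1"
    using abs_hmetric_le[of p "u c" "u d"] unfolding z_def abs_divide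
    by (intro divide_le_eq_1[THEN iffD2]) (auto simp: abs_mult hmetric_def)
  moreover have "arccos z = pi / 3"
    using ang unfolding dihedral_angle_def hangle_def z_def u_def p_def e_def by simp
  ultimately have "z = 1 / 2"
    using cos_arccos_abs[of z] cos_60 by metis
  moreover have "sqrt (hmetric p (u c) (u c)) * sqrt (hmetric p (u d) (u d)) = sqrt (X * Y) * 4 / G\<^sup>2"
  proof -
    have "sqrt (hmetric p (u c) (u c)) * sqrt (hmetric p (u d) (u d)) = sqrt ((X * Y) * (4 / G\<^sup>2)\<^sup>2)"
      unfolding H real_sqrt_mult[symmetric] g0 X_def Y_def by (simp add: field_simps power2_eq_square)
    then show ?thesis using G by (simp add: real_sqrt_mult)
  qed
  moreover have "hmetric p (u c) (u d) = W * 2 / G\<^sup>2"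
    unfolding H W_def X_def Y_def by simp
  ultimately have "W = sqrt (X * Y)"
    using G XY unfolding z_def by (simp add: field_simps)
  then show ?thesis
    unfolding W_def X_def Y_def G_def by (simp add: real_sqrt_mult)
qed

text \<open>With \<open>A\<close>, \<open>B\<close>, \<open>C\<close> the square roots of the products of opposite Gram entries, a dihedral angle
  \<open>pi / 3\<close> is the law of cosines for an angle \<open>pi / 3\<close> in a Euclidean triangle with sides \<open>A\<close>, \<open>B\<close>,
  \<open>C\<close>.\<close>

lemma equilateral:
  fixes A B C :: real
  assumes pos: "A > 0" "B > 0" "C > 0"
    and "B\<^sup>2 + C\<^sup>2 - A\<^sup>2 = B * C" "A\<^sup>2 + C\<^sup>2 - B\<^sup>2 = A * C" "A\<^sup>2 + B\<^sup>2 - C\<^sup>2 = A * B"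
  shows "A = B \<and> B = C"
proof -
  have "C * (2 * C) = C * (A + B)" "B * (2 * B) = B * (A + C)"
    using assms(4-6) by (simp_all add: power2_eq_square algebra_simps)
  then have "2 * C = A + B" "2 * B = A + C"
    using pos by (metis mult_cancel_left less_irrefl)+
  then show ?thesis by auto
qed

text \<open>\<open>gram\<close> says that the rescaled null vectors \<open>(1, v) / l v\<close> have pairwise Lorentz products \<open>-1\<close>.\<close>

locale normalized_tetrahedron =
  fixes V :: "point set" and l :: "point \<Rightarrow> real"
  assumes card_V: "card V = 4"
    and norm_V: "v \<in> V \<Longrightarrow> norm v = 1"
    and l_pos: "v \<in> V \<Longrightarrow> l v > 0"
    and gram: "v \<in> V \<Longrightarrow> w \<in> V \<Longrightarrow> v \<noteq> w \<Longrightarrow> 1 - v \<bullet> w = l v * l w"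

text \<open>A symmetric matrix of six off-diagonal entries factors as \<open>l v * l w\<close>
  exactly when the three products of opposite entries agree. These products are the squares of
  \<open>A\<close>, \<open>B\<close>, \<open>C\<close>, and relabelling the vertices puts each pair
  of opposite edges into the role of the distinguished one.\<close>

lemma cell_336_normalized:
  assumes "cell_336 V"
  shows "\<exists>l. normalized_tetrahedron V l"
proof -
  have V: "card V = 4" "\<And>v. v \<in> V \<Longrightarrow> norm v = 1"
    using assms by (auto simp: cell_336_def ideal_tetrahedron_def)
  have ang: "dihedral_angle p a b c d = 2 * pi / 6" if "V = {a, b, c, d}" "p \<in> open_segment a b" for a b c d p
    using assms that unfolding cell_336_def by blast
  obtain a b c d where abcd: "V = {a, b, c, d}" "distinct [a, b, c, d]"
  proof -
    obtain a W where W: "V = insert a W" "a \<notin> W" "card W = 3"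
      using card_eq_SucD[of V 3] V(1) by auto
    then obtain b c d where "W = {b, c, d}" "b \<noteq> c" "c \<noteq> d" "b \<noteq> d"
      unfolding card_3_iff by auto
    then show thesis using W by (intro that[of a b c d]) auto
  qed
  note n = V(2)[unfolded abcd(1), simplified]
  define g :: "point \<Rightarrow> point \<Rightarrow> real" where "g = (\<lambda>v w. 1 - v \<bullet> w)"
  have sym: "g v w = g w v" for v w by (simp add: g_def inner_commute)
  have pos: "g v w > 0" if "v \<in> V" "w \<in> V" "v \<noteq> w" for v w
    unfolding g_def using V(2) that by (intro gap_pos) auto
  note pos' = pos[unfolded abcd(1), simplified]
  have dih: "g a c * g b d + g a d * g b c - g a b * g c d = sqrt (g a c * g b d) * sqrt (g a d * g b c)"
    if "V = {a, b, c, d}" "distinct [a, b, c, d]" for a b c d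
    unfolding g_def using that V(2)
    by (intro dihedral_angle_gram ang) (auto simp: midpoint_in_open_segment)
  define A where "A = sqrt (g a b * g c d)"
  define B where "B = sqrt (g a c * g b d)"
  define C where "C = sqrt (g a d * g b c)"
  have g: "g a b > 0" "g a c > 0" "g a d > 0" "g b c > 0" "g b d > 0" "g c d > 0"
    using abcd by (auto intro!: pos)
  then have ABC: "A > 0" "B > 0" "C > 0" by (simp_all add: A_def B_def C_def)
  have sq: "A\<^sup>2 = g a b * g c d" "B\<^sup>2 = g a c * g b d" "C\<^sup>2 = g a d * g b c"
    using g by (simp_all add: A_def B_def C_def)
  have "B\<^sup>2 + C\<^sup>2 - A\<^sup>2 = B * C"
    using dih[of a b c d] abcd unfolding sq by (simp add: B_def C_def)
  moreover have "A\<^sup>2 + C\<^sup>2 - B\<^sup>2 = A * C"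
    using dih[of a c b d] abcd unfolding sq by (auto simp: A_def C_def sym insert_commute mult_ac)
  moreover have "A\<^sup>2 + B\<^sup>2 - C\<^sup>2 = A * B"
    using dih[of a d b c] abcd unfolding sq by (auto simp: A_def B_def sym insert_commute mult_ac)
  ultimately have "A = B" "B = C" using equilateral[OF ABC] by auto
  then have eq: "g a c * g b d = g a b * g c d" "g a d * g b c = g a b * g c d"
    using sq by metis+
  \<comment> \<open>Forced: dividing \<open>l a * l b\<close> times \<open>l a * l c\<close> by
    \<open>l b * l c\<close> leaves the square of \<open>l a\<close>.\<close>
  define x where "x = sqrt (g a b * g a c / g b c)"
  have x: "x > 0" "x * x = g a b * g a c / g b c"
    using g by (simp_all add: x_def)
  define l where "l v = (if v = a then x else g a v / x)" for v
  have l: "l a = x" "l b = g a b / x" "l c = g a c / x" "l d = g a d / x"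
    using abcd by (auto simp: l_def)
  have rel: "g a b = l a * l b" "g a c = l a * l c" "g a d = l a * l d"
    using x by (simp_all add: l)
  have "l b * l c = g a b * g a c / (x * x)" "l b * l d = g a b * g a d / (x * x)" "l c * l d = g a c * g a d / (x * x)"
    by (simp_all add: l)
  then have "l b * l c = g b c" "l b * l d = g a d * g b c / g a c" "l c * l d = g a d * g b c / g a b"
    unfolding x(2) using g by (auto simp: field_simps)
  moreover have "g a d * g b c / g a c = g b d" "g a d * g b c / g a b = g c d"
    using g eq by (auto simp: field_simps)
  ultimately have rel': "g b c = l b * l c" "g b d = l b * l d" "g c d = l c * l d"
    by auto
  show ?thesis
  proof (intro exI[of _ l] normalized_tetrahedron.intro)
    show "l v > 0" if "v \<in> V" for v
      using that abcd(1) l x g by auto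
    show "1 - v \<bullet> w = l v * l w" if "v \<in> V" "w \<in> V" "v \<noteq> w" for v w
    proof -
      have "g v w = l v * l w"
        using that rel rel' unfolding abcd(1) by (auto simp: sym mult.commute)
      then show ?thesis by (simp add: g_def)
    qed
  qed (use V in auto)
qed

section \<open>Two ideal points: horoballs and reflections\<close>

lemma H3_iff: "x \<in> H3 \<longleftrightarrow> x \<bullet> x < 1"
  by (simp add: H3_def dist_norm norm_eq_sqrt_inner)

lemma horoball_iff: "x \<in> horoball v s \<longleftrightarrow> x \<bullet> x < 1 \<and> (1 - x \<bullet> v)\<^sup>2 \<le> s * (1 - x \<bullet> x)"
  by (simp add: horoball_def H3_iff power2_norm_eq_inner)

lemma strict_horoball_interior:
  assumes "(1 - x \<bullet> v)\<^sup>2 < s * (1 - x \<bullet> x)" "s > 0"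
  shows "x \<in> interior (horoball v s)"
proof (rule interiorI)
  show "open {x. (1 - x \<bullet> v)\<^sup>2 < s * (1 - x \<bullet> x)}"
    by (intro open_Collect_less continuous_intros)
  show "{x. (1 - x \<bullet> v)\<^sup>2 < s * (1 - x \<bullet> x)} \<subseteq> horoball v s"
  proof clarify
    fix x assume *: "(1 - x \<bullet> v)\<^sup>2 < s * (1 - x \<bullet> x)"
    then have "0 < s * (1 - x \<bullet> x)" using zero_le_power2[of "1 - x \<bullet> v"] by linarith
    with * assms(2) show "x \<in> horoball v s" by (simp add: horoball_iff zero_less_mult_iff)
  qed
qed (use assms in simp)

text \<open>The defining function of a horoball is strictly convex and vanishes at the centre \<open>v\<close>, hence it
  is positive beyond a zero \<open>x\<close> on the ray from \<open>v\<close>.\<close>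

lemma interior_horoball_strict:
  assumes x: "x \<in> interior (horoball v s)" and v: "norm v = 1" and s: "s > 0"
  shows "(1 - x \<bullet> v)\<^sup>2 < s * (1 - x \<bullet> x)"
proof (rule ccontr)
  assume "\<not> ?thesis"
  moreover have xh: "x \<bullet> x < 1" "(1 - x \<bullet> v)\<^sup>2 \<le> s * (1 - x \<bullet> x)"
    using subsetD[OF interior_subset x] by (simp_all add: horoball_iff)
  ultimately have eq: "(1 - x \<bullet> v)\<^sup>2 = s * (1 - x \<bullet> x)" by simp
  have vv: "v \<bullet> v = 1" using v by (simp add: dot_square_norm)
  have ne: "x \<noteq> v" using xh(1) vv by auto
  obtain e where e: "e > 0" "ball x e \<subseteq> horoball v s"
    using x by (auto simp: mem_interior)
  define d where "d = x - v"
  have dd: "d \<bullet> d > 0" using ne by (simp add: d_def)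
  define \<epsilon> where "\<epsilon> = e / (2 * norm d)"
  have eps: "\<epsilon> > 0" using e ne by (simp add: \<epsilon>_def d_def)
  have "dist x (x + \<epsilon> *\<^sub>R d) < e"
    using e ne eps by (simp add: dist_norm \<epsilon>_def d_def)
  then have "x + \<epsilon> *\<^sub>R d \<in> horoball v s" using e by auto
  then have "(1 - (x + \<epsilon> *\<^sub>R d) \<bullet> v)\<^sup>2 \<le> s * (1 - (x + \<epsilon> *\<^sub>R d) \<bullet> (x + \<epsilon> *\<^sub>R d))"
    by (simp add: horoball_iff)
  moreover have "(1 - (x + \<epsilon> *\<^sub>R d) \<bullet> v)\<^sup>2 - s * (1 - (x + \<epsilon> *\<^sub>R d) \<bullet> (x + \<epsilon> *\<^sub>R d))
      = \<epsilon> * (1 + \<epsilon>) * ((d \<bullet> v)\<^sup>2 + s * (d \<bullet> d))"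
  proof -
    have x': "x = v + d" by (simp add: d_def)
    have a: "1 - (x + \<epsilon> *\<^sub>R d) \<bullet> v = - (1 + \<epsilon>) * (d \<bullet> v)"
      unfolding x' using vv by (simp add: inner_add_left algebra_simps)
    have b: "1 - (x + \<epsilon> *\<^sub>R d) \<bullet> (x + \<epsilon> *\<^sub>R d) = - 2 * (1 + \<epsilon>) * (d \<bullet> v) - (1 + \<epsilon>)\<^sup>2 * (d \<bullet> d)"
      unfolding x' using vv by (simp add: inner_add_left inner_add_right inner_commute algebra_simps power2_eq_square)
    \<comment> \<open>The equation of the horosphere at x = v + d; substituting it for the linear
      term leaves a multiple of \<epsilon>, which is positive.\<close>
    have c: "s * (2 * (d \<bullet> v)) = - ((d \<bullet> v)\<^sup>2) - s * (d \<bullet> d)"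
      using eq unfolding x' using vv by (simp add: inner_add_left inner_add_right inner_commute algebra_simps power2_eq_square)
    have "(- (1 + \<epsilon>) * (d \<bullet> v))\<^sup>2 - s * (- 2 * (1 + \<epsilon>) * (d \<bullet> v) - (1 + \<epsilon>)\<^sup>2 * (d \<bullet> d)) =
        (1 + \<epsilon>)\<^sup>2 * (d \<bullet> v)\<^sup>2 + (1 + \<epsilon>) * (s * (2 * (d \<bullet> v))) + s * (1 + \<epsilon>)\<^sup>2 * (d \<bullet> d)"
      by (simp add: algebra_simps power2_eq_square)
    also have "\<dots> = \<epsilon> * (1 + \<epsilon>) * ((d \<bullet> v)\<^sup>2 + s * (d \<bullet> d))"
      unfolding c by (simp add: algebra_simps power2_eq_square)
    finally show ?thesis unfolding a b .
  qed
  moreover have "\<epsilon> * (1 + \<epsilon>) * ((d \<bullet> v)\<^sup>2 + s * (d \<bullet> d)) > 0"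
    using eps s dd by (intro mult_pos_pos add_nonneg_pos) auto
  ultimately show False by linarith
qed

text \<open>The two points determine only the product \<open>a * b\<close>. How it is split fixes
  the normalisation of the horoballs at either point and the mirror of the reflection that exchanges
  them.\<close>

locale null_pair =
  fixes v w :: point and a b :: real
  assumes v: "norm v = 1" and w: "norm w = 1" and a: "a > 0" and b: "b > 0"
    and vw: "1 - v \<bullet> w = a * b"
begin

lemma inner_vw: "v \<bullet> v = 1" "w \<bullet> w = 1" "v \<bullet> w = 1 - a * b" "w \<bullet> v = 1 - a * b"
  using v w vw by (simp_all add: dot_square_norm inner_commute)

text \<open>In Lorentzian terms: the component of \<open>(1, x)\<close> orthogonal to the hyperbolic plane spanned by
  \<open>(1, v)\<close> and \<open>(1, w)\<close> is spacelike, and vanishes exactly on the geodesic \<open>v w\<close>.\<close>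

lemma two_horospheres:
  shows "a * b * (1 - x \<bullet> x) \<le> 2 * (1 - x \<bullet> v) * (1 - x \<bullet> w)"
    and "a * b * (1 - x \<bullet> x) = 2 * (1 - x \<bullet> v) * (1 - x \<bullet> w) \<Longrightarrow>
      x = ((1 - x \<bullet> w) / (a * b)) *\<^sub>R v + ((1 - x \<bullet> v) / (a * b)) *\<^sub>R w \<and>
      (1 - x \<bullet> w) / (a * b) + (1 - x \<bullet> v) / (a * b) = 1"
proof -
  have g: "a * b > 0" using a b by simp
  define r where "r = (1 - x \<bullet> w) / (a * b)"
  define p where "p = (1 - x \<bullet> v) / (a * b)"
  have xv: "x \<bullet> v = 1 - p * (a * b)" "x \<bullet> w = 1 - r * (a * b)"
    using a b by (simp_all add: p_def r_def)
  define z where "z = x - r *\<^sub>R v - p *\<^sub>R w"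
  define z0 where "z0 = 1 - r - p"
  have zv: "z \<bullet> v = z0" "z \<bullet> w = z0"
    unfolding z_def z0_def by (simp_all add: inner_diff_left inner_vw xv algebra_simps)
  have "z \<bullet> z = x \<bullet> z - r * (v \<bullet> z) - p * (w \<bullet> z)"
    by (subst (1) z_def) (simp add: inner_diff_left)
  also have "x \<bullet> z = x \<bullet> x - r * (x \<bullet> v) - p * (x \<bullet> w)"
    by (simp add: z_def inner_diff_right)
  finally have zz: "z \<bullet> z - z0\<^sup>2 = 2 * (r * p) * (a * b) - (1 - x \<bullet> x)"
    unfolding inner_commute[of v z] inner_commute[of w z] zv xv z0_def
    by (simp add: algebra_simps power2_eq_square)
  \<comment> \<open>A vector orthogonal to the null vector \<open>(1, v)\<close> is never timelike:
    its Lorentz square is the Euclidean square of \<open>z - z0 *\<^sub>R v\<close>. Using both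
    \<open>v\<close> and \<open>w\<close> forces \<open>z0 = 0\<close> in the equality case.\<close>
  have d: "(z - z0 *\<^sub>R v) \<bullet> (z - z0 *\<^sub>R v) = z \<bullet> z - z0\<^sup>2" "(z - z0 *\<^sub>R w) \<bullet> (z - z0 *\<^sub>R w) = z \<bullet> z - z0\<^sup>2"
    by (simp_all add: inner_diff_left inner_diff_right zv zv[unfolded inner_commute[of z]] inner_vw power2_eq_square)
  have e: "2 * (1 - x \<bullet> v) * (1 - x \<bullet> w) - a * b * (1 - x \<bullet> x) = a * b * (z \<bullet> z - z0\<^sup>2)"
    unfolding zz xv by (simp add: algebra_simps)
  have "0 \<le> a * b * (z \<bullet> z - z0\<^sup>2)"
    using g inner_ge_zero[of "z - z0 *\<^sub>R v"] d by simp
  then show "a * b * (1 - x \<bullet> x) \<le> 2 * (1 - x \<bullet> v) * (1 - x \<bullet> w)"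
    using e by linarith
  assume "a * b * (1 - x \<bullet> x) = 2 * (1 - x \<bullet> v) * (1 - x \<bullet> w)"
  then have "a * b * (z \<bullet> z - z0\<^sup>2) = 0" using e by linarith
  then have "z \<bullet> z - z0\<^sup>2 = 0" using a b by simp
  then have "z - z0 *\<^sub>R v = 0" "z - z0 *\<^sub>R w = 0"
    using d inner_eq_zero_iff by metis+
  then have z: "z = z0 *\<^sub>R v" "z0 *\<^sub>R v = z0 *\<^sub>R w" by auto
  have "v \<noteq> w" using g inner_vw by auto
  then have "z0 = 0" using z by simp
  then show "x = ((1 - x \<bullet> w) / (a * b)) *\<^sub>R v + ((1 - x \<bullet> v) / (a * b)) *\<^sub>R w \<and>
      (1 - x \<bullet> w) / (a * b) + (1 - x \<bullet> v) / (a * b) = 1"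
    using z(1) unfolding z_def z0_def p_def[symmetric] r_def[symmetric] by (simp add: algebra_simps)
qed

text \<open>The vector \<open>(1, v) / a\<close> + \<tau> \<open>(1, w) / b\<close>, scaled back to
  first coordinate 1. The point with parameter \<tau> is where the horosphere of parameter \<tau> at
  v and that of parameter 1 / \<tau> at w touch, so on the edge two horoballs become two intervals
  of \<tau>.\<close>

definition edge_point :: "real \<Rightarrow> point" where
  "edge_point \<tau> = (b / (b + a * \<tau>)) *\<^sub>R v + (a * \<tau> / (b + a * \<tau>)) *\<^sub>R w"

lemma edge_point_inner:
  assumes "\<tau> > 0"
  shows "1 - edge_point \<tau> \<bullet> v = a * \<tau> * (a * b) / (b + a * \<tau>)"
    and "1 - edge_point \<tau> \<bullet> w = b * (a * b) / (b + a * \<tau>)"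
    and "1 - edge_point \<tau> \<bullet> edge_point \<tau> = 2 * \<tau> * (a * b)\<^sup>2 / (b + a * \<tau>)\<^sup>2"
    and "edge_point \<tau> \<in> H3"
proof -
  have pos: "b + a * \<tau> > 0" using a b assms by (simp add: add_pos_pos)
  define D where "D = b + a * \<tau>"
  have D: "D > 0" "b = D - a * \<tau>" using pos by (simp_all add: D_def)
  define \<alpha> where "\<alpha> = b / D"
  define \<beta> where "\<beta> = a * \<tau> / D"
  have ab: "\<alpha> = 1 - \<beta>" using D by (simp add: \<alpha>_def \<beta>_def diff_divide_distrib)
  have m: "edge_point \<tau> = \<alpha> *\<^sub>R v + \<beta> *\<^sub>R w"
    by (simp add: edge_point_def \<alpha>_def \<beta>_def D_def)
  have 1: "1 - edge_point \<tau> \<bullet> v = \<beta> * (a * b)"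
    unfolding m ab by (simp add: inner_add_left inner_vw algebra_simps)
  have 2: "1 - edge_point \<tau> \<bullet> w = \<alpha> * (a * b)"
    unfolding m ab by (simp add: inner_add_left inner_vw algebra_simps)
  have "1 - edge_point \<tau> \<bullet> edge_point \<tau> = \<alpha> * (1 - edge_point \<tau> \<bullet> v) + \<beta> * (1 - edge_point \<tau> \<bullet> w)"
    by (subst (2) m) (simp add: inner_add_right ab algebra_simps)
  also have "\<dots> = 2 * \<alpha> * \<beta> * (a * b)" unfolding 1 2 by (simp add: algebra_simps)
  finally have 3: "1 - edge_point \<tau> \<bullet> edge_point \<tau> = 2 * \<alpha> * \<beta> * (a * b)" .
  show "1 - edge_point \<tau> \<bullet> v = a * \<tau> * (a * b) / (b + a * \<tau>)"
    "1 - edge_point \<tau> \<bullet> w = b * (a * b) / (b + a * \<tau>)"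
    unfolding 1 2 \<alpha>_def \<beta>_def D_def by simp_all
  show 4: "1 - edge_point \<tau> \<bullet> edge_point \<tau> = 2 * \<tau> * (a * b)\<^sup>2 / (b + a * \<tau>)\<^sup>2"
    unfolding 3 \<alpha>_def \<beta>_def D_def by (simp add: power2_eq_square)
  have "1 - edge_point \<tau> \<bullet> edge_point \<tau> > 0"
    unfolding 4 using a b assms pos by (intro divide_pos_pos mult_pos_pos) auto
  then show "edge_point \<tau> \<in> H3" by (simp add: H3_iff)
qed

lemma edge_point_horoball:
  assumes "\<tau> > 0"
  defines "m \<equiv> edge_point \<tau>"
  shows "(1 - m \<bullet> v)\<^sup>2 \<le> a\<^sup>2 * \<rho> / 2 * (1 - m \<bullet> m) \<longleftrightarrow> \<tau> \<le> \<rho>"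
    and "(1 - m \<bullet> v)\<^sup>2 < a\<^sup>2 * \<rho> / 2 * (1 - m \<bullet> m) \<longleftrightarrow> \<tau> < \<rho>"
    and "(1 - m \<bullet> w)\<^sup>2 \<le> b\<^sup>2 * \<rho> / 2 * (1 - m \<bullet> m) \<longleftrightarrow> 1 \<le> \<rho> * \<tau>"
    and "(1 - m \<bullet> w)\<^sup>2 < b\<^sup>2 * \<rho> / 2 * (1 - m \<bullet> m) \<longleftrightarrow> 1 < \<rho> * \<tau>"
proof -
  have D: "b + a * \<tau> > 0" using a b assms by (simp add: add_pos_pos)
  define C where "C = a\<^sup>2 * (a * b)\<^sup>2 * \<tau> / (b + a * \<tau>)\<^sup>2"
  define C' where "C' = b\<^sup>2 * (a * b)\<^sup>2 / (b + a * \<tau>)\<^sup>2"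
  have C: "C > 0" "C' > 0" unfolding C_def C'_def using a b assms D by (auto intro!: divide_pos_pos mult_pos_pos)
  have 1: "(1 - m \<bullet> v)\<^sup>2 = C * \<tau>"
    unfolding m_def edge_point_inner(1)[OF assms(1)] C_def by (simp add: power2_eq_square mult_ac)
  have 2: "a\<^sup>2 * \<rho> / 2 * (1 - m \<bullet> m) = C * \<rho>"
    unfolding m_def edge_point_inner(3)[OF assms(1)] C_def by (simp add: mult_ac)
  have 3: "(1 - m \<bullet> w)\<^sup>2 = C' * 1"
    unfolding m_def edge_point_inner(2)[OF assms(1)] C'_def by (simp add: power2_eq_square mult_ac)
  have 4: "b\<^sup>2 * \<rho> / 2 * (1 - m \<bullet> m) = C' * (\<rho> * \<tau>)"
    unfolding m_def edge_point_inner(3)[OF assms(1)] C'_def by (simp add: mult_ac)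
  show "(1 - m \<bullet> v)\<^sup>2 \<le> a\<^sup>2 * \<rho> / 2 * (1 - m \<bullet> m) \<longleftrightarrow> \<tau> \<le> \<rho>"
    "(1 - m \<bullet> v)\<^sup>2 < a\<^sup>2 * \<rho> / 2 * (1 - m \<bullet> m) \<longleftrightarrow> \<tau> < \<rho>"
    unfolding 1 2 using C by simp_all
  show "(1 - m \<bullet> w)\<^sup>2 \<le> b\<^sup>2 * \<rho> / 2 * (1 - m \<bullet> m) \<longleftrightarrow> 1 \<le> \<rho> * \<tau>"
    "(1 - m \<bullet> w)\<^sup>2 < b\<^sup>2 * \<rho> / 2 * (1 - m \<bullet> m) \<longleftrightarrow> 1 < \<rho> * \<tau>"
    unfolding 3 4 using C mult_le_cancel_left_pos[of C' 1] mult_less_cancel_left_pos[of C' 1] by auto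
qed

text \<open>The product of the two horoball inequalities, compared with
  \<open>two_horospheres\<close>, gives 1 \<le> \<rho> * \<rho>'. Hence all estimates are
  equalities: x lies on the edge, and the horoball inequalities fix the ratio of its
  coordinates.\<close>

lemma horoballs_meet:
  assumes x: "x \<in> horoball v (a\<^sup>2 * \<rho> / 2)" "x \<in> horoball w (b\<^sup>2 * \<rho>' / 2)"
    and pos: "\<rho> > 0" "\<rho>' > 0" and le: "\<rho> * \<rho>' \<le> 1"
  shows "\<rho> * \<rho>' = 1 \<and> x = edge_point \<rho>"
proof -
  define p where "p = 1 - x \<bullet> v"
  define r where "r = 1 - x \<bullet> w"
  define q where "q = 1 - x \<bullet> x"
  have g: "a * b > 0" using a b by simp
  have q: "q > 0" using x by (simp add: horoball_iff q_def)
  have h: "p\<^sup>2 \<le> a\<^sup>2 * \<rho> / 2 * q" "r\<^sup>2 \<le> b\<^sup>2 * \<rho>' / 2 * q"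
    using x by (simp_all add: horoball_iff p_def r_def q_def)
  have "norm x < 1" using x by (simp add: horoball_def H3_def)
  then have "x \<bullet> v < 1" "x \<bullet> w < 1"
    using norm_cauchy_schwarz[of x v] norm_cauchy_schwarz[of x w] v w by auto
  then have pr: "p > 0" "r > 0" by (simp_all add: p_def r_def)
  have pair: "a * b * q \<le> 2 * p * r"
    using two_horospheres(1)[of x] by (simp add: p_def q_def r_def)
  have "(a * b * q)\<^sup>2 \<le> (2 * p * r)\<^sup>2"
    using pair g q by (intro power_mono) auto
  moreover have sq4: "(2 * p * r)\<^sup>2 = 4 * (p\<^sup>2 * r\<^sup>2)" by (simp add: power_mult_distrib)
  ultimately have lo: "(a * b * q)\<^sup>2 \<le> 4 * (p\<^sup>2 * r\<^sup>2)" by simp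
  have up: "p\<^sup>2 * r\<^sup>2 \<le> (a\<^sup>2 * \<rho> / 2 * q) * (b\<^sup>2 * \<rho>' / 2 * q)"
    using h q a b pos by (intro mult_mono) auto
  have up': "4 * ((a\<^sup>2 * \<rho> / 2 * q) * (b\<^sup>2 * \<rho>' / 2 * q)) = (a * b * q)\<^sup>2 * (\<rho> * \<rho>')"
    by (simp add: power2_eq_square)
  have gq: "(a * b * q)\<^sup>2 > 0" using a b q by simp
  have "(a * b * q)\<^sup>2 * 1 \<le> (a * b * q)\<^sup>2 * (\<rho> * \<rho>')"
    using lo up up' by linarith
  then have one: "\<rho> * \<rho>' = 1" using gq le by (simp add: mult_le_cancel_left_pos)
  have "4 * (p\<^sup>2 * r\<^sup>2) = (a * b * q)\<^sup>2"
    using lo up up' unfolding one by linarith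
  then have "(2 * p * r)\<^sup>2 = (a * b * q)\<^sup>2" unfolding sq4 .
  then have "2 * p * r = a * b * q"
    by (rule power2_eq_imp_eq) (use pr g q in auto)
  then have eq: "a * b * q = 2 * p * r" by simp
  from two_horospheres(2)[of x] have xeq: "x = (r / (a * b)) *\<^sub>R v + (p / (a * b)) *\<^sub>R w" "r / (a * b) + p / (a * b) = 1"
    using eq by (auto simp: p_def q_def r_def)
  have q2: "q = 2 * p * r / (a * b)" using eq a b by (simp add: field_simps)
  have "p * p \<le> p * (a * \<rho> * r / b)"
    using h(1) unfolding q2 using a b by (simp add: power2_eq_square field_simps)
  then have p1: "p * b \<le> a * \<rho> * r" using pr b by (simp add: field_simps)
  have "r * r \<le> r * (b * \<rho>' * p / a)"
    using h(2) unfolding q2 using a b by (simp add: power2_eq_square field_simps)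
  then have "r * a \<le> b * \<rho>' * p" using pr a by (simp add: field_simps)
  then have "\<rho> * (r * a) \<le> \<rho> * (b * \<rho>' * p)" using pos by (intro mult_left_mono) auto
  also have "\<rho> * (b * \<rho>' * p) = (\<rho> * \<rho>') * (b * p)" by simp
  finally have "\<rho> * (r * a) \<le> b * p" unfolding one by simp
  with p1 have p2: "p * b = a * \<rho> * r" by (simp add: mult_ac)
  have sum: "r + p = a * b" using xeq(2) a b by (simp add: field_simps)
  have D: "b + a * \<rho> > 0" using a b pos by (simp add: add_pos_pos)
  have "r * (b + a * \<rho>) = b * (r + p)" using p2 by (simp add: algebra_simps)
  then have "r * (b + a * \<rho>) = b * (a * b)" unfolding sum .
  then have 1: "r / (a * b) = b / (b + a * \<rho>)" using D a b by (simp add: field_simps)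
  have "p * (b + a * \<rho>) = a * \<rho> * (r + p)" using p2 by (simp add: algebra_simps)
  then have "p * (b + a * \<rho>) = a * \<rho> * (a * b)" unfolding sum .
  then have 2: "p / (a * b) = a * \<rho> / (b + a * \<rho>)" using D a b by (simp add: field_simps)
  show ?thesis using one xeq(1) unfolding 1 2 edge_point_def by simp
qed

lemma horoballs_tangent_at:
  assumes "\<rho> > 0" "\<rho> * \<rho>' = 1"
  shows "tangent_at (horoball v (a\<^sup>2 * \<rho> / 2)) (horoball w (b\<^sup>2 * \<rho>' / 2)) (edge_point \<rho>)"
proof -
  have pos: "\<rho>' > 0" using zero_less_mult_pos[of \<rho> \<rho>'] assms by simp
  have "edge_point \<rho> \<in> horoball v (a\<^sup>2 * \<rho> / 2)" "edge_point \<rho> \<in> horoball w (b\<^sup>2 * \<rho>' / 2)"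
    unfolding horoball_iff
    using edge_point_inner(4)[OF assms(1)] edge_point_horoball(1,3)[OF assms(1)] assms(2)
    by (auto simp: H3_iff mult.commute)
  moreover have "x = edge_point \<rho>"
    if "x \<in> horoball v (a\<^sup>2 * \<rho> / 2)" "x \<in> horoball w (b\<^sup>2 * \<rho>' / 2)" for x
    using horoballs_meet[OF that assms(1) pos] assms(2) by (metis order_refl)
  ultimately show ?thesis
    unfolding tangent_at_def by blast
qed

lemma horoballs_overlap:
  assumes pos: "\<rho> > 0" "\<rho>' > 0" and gt: "\<rho> * \<rho>' > 1"
  shows "interior (horoball v (a\<^sup>2 * \<rho> / 2)) \<inter> interior (horoball w (b\<^sup>2 * \<rho>' / 2)) \<noteq> {}"
proof -
  have "1 / \<rho>' < \<rho>" using pos gt by (simp add: field_simps)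
  then obtain \<tau> where t: "1 / \<rho>' < \<tau>" "\<tau> < \<rho>" using dense by blast
  have t0: "\<tau> > 0" using t(1) pos by (meson divide_pos_pos less_trans zero_less_one)
  have "1 < \<rho>' * \<tau>" using t(1) pos by (simp add: field_simps)
  then have "edge_point \<tau> \<in> interior (horoball v (a\<^sup>2 * \<rho> / 2))" "edge_point \<tau> \<in> interior (horoball w (b\<^sup>2 * \<rho>' / 2))"
    using edge_point_horoball(2,4)[OF t0] t a b pos by (auto intro!: strict_horoball_interior)
  then show ?thesis by blast
qed

lemma horoballs_interior_disjoint:
  assumes pos: "\<rho> > 0" "\<rho>' > 0" and le: "\<rho> * \<rho>' \<le> 1"
  shows "interior (horoball v (a\<^sup>2 * \<rho> / 2)) \<inter> interior (horoball w (b\<^sup>2 * \<rho>' / 2)) = {}"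
proof -
  have "horoball v (a\<^sup>2 * \<rho> / 2) \<inter> horoball w (b\<^sup>2 * \<rho>' / 2) \<subseteq> {edge_point \<rho>}"
    using horoballs_meet[OF _ _ pos le] by blast
  then have "interior (horoball v (a\<^sup>2 * \<rho> / 2) \<inter> horoball w (b\<^sup>2 * \<rho>' / 2)) \<subseteq> interior {edge_point \<rho>}"
    by (rule interior_mono)
  then show ?thesis by (simp add: interior_singleton)
qed

text \<open>The Lorentz reflection in \<open>(1, v) / a - (1, w) / b\<close>, acting on the projective model.\<close>

definition height :: "point \<Rightarrow> real" where
  "height x = (1 - x \<bullet> v) / a - (1 - x \<bullet> w) / b"

text \<open>The first coordinate of the reflected vector, by which \<open>swap\<close> divides. The
  mirror vector has Lorentz square 2, so the reflection adds \<open>height x\<close> times it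
  without a further factor.\<close>

definition weight :: "point \<Rightarrow> real" where
  "weight x = 1 + height x * (1 / a - 1 / b)"

definition mirror_normal :: point where
  "mirror_normal = (1 / a) *\<^sub>R v - (1 / b) *\<^sub>R w"

definition swap :: "point \<Rightarrow> point" where
  "swap x = (1 / weight x) *\<^sub>R (x + height x *\<^sub>R mirror_normal)"

lemma inner_mirror_normal: "x \<bullet> mirror_normal = 1 / a - 1 / b - height x"
  by (simp add: mirror_normal_def height_def inner_diff_right diff_divide_distrib)

lemma mirror_normal_norm: "mirror_normal \<bullet> mirror_normal = (1 / a - 1 / b)\<^sup>2 + 2"
  using a b unfolding mirror_normal_def
  by (simp add: inner_diff_left inner_diff_right inner_vw power2_eq_square field_simps)

lemma reflected_inner:
  "weight x * weight y - (x + height x *\<^sub>R mirror_normal) \<bullet> (y + height y *\<^sub>R mirror_normal) = 1 - x \<bullet> y"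
proof -
  have "(x + height x *\<^sub>R mirror_normal) \<bullet> (y + height y *\<^sub>R mirror_normal) =
     x \<bullet> y + height y * (x \<bullet> mirror_normal) + height x * (y \<bullet> mirror_normal) + height x * height y * (mirror_normal \<bullet> mirror_normal)"
    by (simp add: inner_add_left inner_add_right inner_commute algebra_simps)
  then show ?thesis
    unfolding mirror_normal_norm inner_mirror_normal[of x] inner_mirror_normal[of y] weight_def by algebra
qed

lemma swap_inner:
  assumes "weight x \<noteq> 0" "weight y \<noteq> 0"
  shows "1 - swap x \<bullet> swap y = (1 - x \<bullet> y) / (weight x * weight y)"
proof -
  have "swap x \<bullet> swap y = ((x + height x *\<^sub>R mirror_normal) \<bullet> (y + height y *\<^sub>R mirror_normal)) / (weight x * weight y)"
    by (simp add: swap_def)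
  also have "\<dots> = (weight x * weight y - (1 - x \<bullet> y)) / (weight x * weight y)"
    using reflected_inner[of x y] by simp
  finally show ?thesis using assms by (simp add: field_simps)
qed

lemma height_swap: "weight x \<noteq> 0 \<Longrightarrow> height (swap x) = - height x / weight x"
proof -
  assume k: "weight x \<noteq> 0"
  define n0 where "n0 = 1 / a - 1 / b"
  have "height (swap x) = n0 - swap x \<bullet> mirror_normal"
    by (simp add: inner_mirror_normal n0_def)
  also have "swap x \<bullet> mirror_normal = (x \<bullet> mirror_normal + height x * (mirror_normal \<bullet> mirror_normal)) / weight x"
    by (simp add: swap_def inner_add_left)
  also have "\<dots> = (n0 * weight x + height x) / weight x"
    unfolding mirror_normal_norm inner_mirror_normal[of x] weight_def n0_def[symmetric] by (simp add: algebra_simps power2_eq_square)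
  finally show ?thesis using k by (simp add: field_simps)
qed

lemma weight_swap: "weight x \<noteq> 0 \<Longrightarrow> weight (swap x) = 1 / weight x"
proof -
  assume k: "weight x \<noteq> 0"
  define n0 where "n0 = 1 / a - 1 / b"
  have wx: "weight y = 1 + height y * n0" for y by (simp add: weight_def n0_def)
  have "weight (swap x) = (weight x - height x * n0) / weight x"
    unfolding wx[of "swap x"] height_swap[OF k] using k by (simp add: field_simps)
  also have "weight x - height x * n0 = 1" by (simp add: wx)
  finally show ?thesis .
qed

lemma swap_swap: "weight x \<noteq> 0 \<Longrightarrow> swap (swap x) = x"
proof -
  assume k: "weight x \<noteq> 0"
  have "swap (swap x) = weight x *\<^sub>R (swap x - (height x / weight x) *\<^sub>R mirror_normal)"
    unfolding swap_def[of "swap x"] weight_swap[OF k] height_swap[OF k] by simp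
  also have "\<dots> = x" using k by (simp add: swap_def scaleR_diff_right)
  finally show ?thesis .
qed

lemma swap_v: "weight v = a / b" "swap v = w"
proof -
  have h: "height v = - a" using a b by (simp add: height_def inner_vw)
  show k: "weight v = a / b" using a b by (simp add: weight_def h field_simps)
  have "v + height v *\<^sub>R mirror_normal = (a / b) *\<^sub>R w"
    using a b by (simp add: h mirror_normal_def scaleR_diff_right)
  then show "swap v = w" using a b by (simp add: swap_def k)
qed

lemma swap_w: "weight w = b / a" "swap w = v"
proof -
  have h: "height w = b" using a b by (simp add: height_def inner_vw)
  show k: "weight w = b / a" using a b by (simp add: weight_def h field_simps)
  have "w + height w *\<^sub>R mirror_normal = (b / a) *\<^sub>R v"
    using a b by (simp add: h mirror_normal_def scaleR_diff_right)
  then show "swap w = v" using a b by (simp add: swap_def k)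
qed

lemma swap_fixed:
  assumes "(1 - u \<bullet> v) / a = (1 - u \<bullet> w) / b"
  shows "weight u = 1" "swap u = u"
proof -
  have "height u = 0" using assms by (simp add: height_def)
  then show "weight u = 1" "swap u = u" by (simp_all add: weight_def swap_def)
qed

text \<open>The reflection preserves the future cone. The vector \<open>(weight x, z)\<close> is
  timelike, and since v and w are exchanged up to a positive factor, its product with
  \<open>(1, v)\<close> has the sign of the product of \<open>(1, x)\<close> with
  \<open>(1, w)\<close>; a vector in the past cone would give the opposite sign.\<close>

lemma weight_pos:
  assumes "x \<in> H3"
  shows "weight x > 0"
proof (rule ccontr)
  assume neg: "\<not> weight x > 0"
  define z where "z = x + height x *\<^sub>R mirror_normal"
  have xx: "x \<bullet> x < 1" using assms by (simp add: H3_iff)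
  then have "norm x < 1" by (simp add: norm_eq_sqrt_inner)
  then have xw: "x \<bullet> w < 1" using norm_cauchy_schwarz[of x w] w by auto
  have "weight x - z \<bullet> v = a / b * (1 - x \<bullet> w)"
  proof -
    have hv: "height v = - a" using a b by (simp add: height_def inner_vw)
    have "weight x - z \<bullet> v = weight x - x \<bullet> v - height x * (v \<bullet> mirror_normal)"
      by (simp add: z_def inner_add_left inner_commute[of v mirror_normal])
    also have "\<dots> = 1 - x \<bullet> v - height x * a"
      unfolding inner_mirror_normal hv weight_def by (simp add: algebra_simps)
    also have "\<dots> = a / b * (1 - x \<bullet> w)" using a b by (simp add: height_def algebra_simps diff_divide_distrib)
    finally show ?thesis .
  qed
  moreover have "a / b * (1 - x \<bullet> w) > 0" using a b xw by simp
  ultimately have 1: "z \<bullet> v < weight x" by linarith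
  have "weight x * weight x - z \<bullet> z > 0"
    using reflected_inner[of x x] xx by (simp add: z_def)
  then have "(norm z)\<^sup>2 < (weight x)\<^sup>2" by (simp add: power2_norm_eq_inner power2_eq_square[of "weight x"])
  then have "norm z < \<bar>weight x\<bar>" by (metis abs_ge_zero power2_abs power_less_imp_less_base)
  moreover have "\<bar>z \<bullet> v\<bar> \<le> norm z" using Cauchy_Schwarz_ineq2[of z v] v by simp
  ultimately show False using 1 neg by linarith
qed

lemma weight_nonzero: "x \<in> H3 \<Longrightarrow> weight x \<noteq> 0"
  using weight_pos[of x] by auto

lemma swap_H3:
  assumes "x \<in> H3" shows "swap x \<in> H3"
proof -
  have "(1 - x \<bullet> x) / (weight x * weight x) > 0"
    using weight_pos[OF assms] assms by (intro divide_pos_pos mult_pos_pos) (auto simp: H3_iff)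
  then show ?thesis
    using swap_inner[of x x] weight_nonzero[OF assms] by (simp add: H3_iff)
qed

lemma hisometry_swap: "hisometry swap"
  unfolding hisometry_def
proof (intro conjI ballI)
  show "bij_betw swap H3 H3"
    using swap_H3 swap_swap weight_nonzero by (intro bij_betwI[of _ _ _ swap]) auto
  fix x y assume xy: "x \<in> H3" "y \<in> H3"
  then have k: "weight x > 0" "weight y > 0" by (auto intro: weight_pos)
  have q: "1 - (norm (swap z))\<^sup>2 = (1 - (norm z)\<^sup>2) / (weight z)\<^sup>2" if "z \<in> H3" for z
    using swap_inner[of z z] weight_pos[OF that] by (simp add: power2_norm_eq_inner power2_eq_square[of "weight z"])
  have "sqrt ((1 - (norm (swap x))\<^sup>2) * (1 - (norm (swap y))\<^sup>2)) = sqrt ((1 - (norm x)\<^sup>2) * (1 - (norm y)\<^sup>2)) / (weight x * weight y)"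
    unfolding q[OF xy(1)] q[OF xy(2)] using k by (simp add: real_sqrt_mult real_sqrt_divide)
  then have "(1 - swap x \<bullet> swap y) / sqrt ((1 - (norm (swap x))\<^sup>2) * (1 - (norm (swap y))\<^sup>2)) =
    (1 - x \<bullet> y) / sqrt ((1 - (norm x)\<^sup>2) * (1 - (norm y)\<^sup>2))"
    using swap_inner[of x y] k by simp
  then show "hdist (swap x) (swap y) = hdist x y" by (simp add: hdist_def)
qed

text \<open>A projective map sends a convex combination to one whose coefficients are multiplied by
  the weights at the end points. As \<open>weight\<close> is affine, its positivity passes to the
  hull, and it is carried along in the induction over the hull.\<close>

lemma swap_convex_hull:
  assumes "\<And>x. x \<in> S \<Longrightarrow> weight x > 0"
  shows "swap ` (convex hull S) \<subseteq> convex hull (swap ` S)"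
proof -
  have "convex hull S \<subseteq> {x. weight x > 0 \<and> swap x \<in> convex hull (swap ` S)}"
  proof (rule hull_minimal)
    show "S \<subseteq> {x. weight x > 0 \<and> swap x \<in> convex hull (swap ` S)}"
      using assms by (auto intro: hull_inc)
    show "convex {x. weight x > 0 \<and> swap x \<in> convex hull (swap ` S)}"
    proof (rule convexI, clarify)
      fix x y :: point and s t :: real
      assume x: "weight x > 0" "swap x \<in> convex hull (swap ` S)"
        and y: "weight y > 0" "swap y \<in> convex hull (swap ` S)"
        and st: "0 \<le> s" "0 \<le> t" "s + t = 1"
      define z where "z = s *\<^sub>R x + t *\<^sub>R y"
      have t: "t = 1 - s" using st by simp
      define n0 where "n0 = 1 / a - 1 / b"
      have height: "height x = n0 - x \<bullet> mirror_normal" for x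
        by (simp add: inner_mirror_normal n0_def)
      have h: "height z = s * height x + t * height y"
        unfolding height z_def t by (simp add: inner_add_left algebra_simps)
      have k: "weight z = s * weight x + t * weight y"
        unfolding weight_def h t n0_def[symmetric] by (simp add: algebra_simps)
      have kz: "weight z > 0"
        unfolding k using x y st by (cases "s = 0") (auto intro: add_pos_nonneg)
      have "swap z = (s * weight x / weight z) *\<^sub>R swap x + (t * weight y / weight z) *\<^sub>R swap y"
      proof -
        have "z + height z *\<^sub>R mirror_normal =
            s *\<^sub>R (x + height x *\<^sub>R mirror_normal) + t *\<^sub>R (y + height y *\<^sub>R mirror_normal)"
          unfolding h unfolding z_def by (simp add: algebra_simps)
        then show ?thesis
          using x(1) y(1) by (simp add: swap_def scaleR_add_right)
      qed
      moreover have "s * weight x / weight z + t * weight y / weight z = 1"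
        using kz k by (simp add: add_divide_distrib[symmetric])
      moreover have "0 \<le> s * weight x / weight z" "0 \<le> t * weight y / weight z"
        using x(1) y(1) st kz by simp_all
      ultimately have "swap z \<in> convex hull (swap ` S)"
        using convexD[OF convex_convex_hull x(2) y(2)] by metis
      with kz show "weight (s *\<^sub>R x + t *\<^sub>R y) > 0 \<and> swap (s *\<^sub>R x + t *\<^sub>R y) \<in> convex hull (swap ` S)"
        by (simp add: z_def)
    qed
  qed
  then show ?thesis by auto
qed

text \<open>Elements of \<open>S\<close> may be ideal points, which \<open>weight_pos\<close> does
  not cover. The reverse inclusion is the forward one for the image of \<open>S\<close>, as
  \<open>swap\<close> is an involution.\<close>

lemma swap_hhull:
  assumes pos: "\<And>x. x \<in> S \<Longrightarrow> weight x > 0"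
  shows "swap ` hhull S = hhull (swap ` S)"
proof -
  have sub: "swap ` hhull S \<subseteq> hhull (swap ` S)" if "\<And>x. x \<in> S \<Longrightarrow> weight x > 0" for S
    using swap_convex_hull[OF that] swap_H3 by (auto simp: hhull_def)
  have "swap ` hhull (swap ` S) \<subseteq> hhull (swap ` swap ` S)"
    using pos by (intro sub) (auto simp: weight_swap less_imp_neq[THEN not_sym])
  also have "swap ` swap ` S = S"
    using pos by (force simp: image_image swap_swap less_imp_neq[THEN not_sym])
  finally have "swap ` swap ` hhull (swap ` S) \<subseteq> swap ` hhull S" by blast
  moreover have "swap ` swap ` hhull (swap ` S) = hhull (swap ` S)"
    by (force simp: image_image swap_swap weight_pos less_imp_neq[THEN not_sym] hhull_def)
  ultimately show ?thesis using sub[OF pos] by blast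
qed

text \<open>Products with \<open>(1, v) / a\<close> become products with \<open>(1, w) / b\<close>;
  the factor \<open>weight x\<close> occurs squared on both sides of the horoball inequality and
  cancels.\<close>

lemma swap_horoball: "swap ` horoball v (a\<^sup>2 * s) = horoball w (b\<^sup>2 * s)"
proof -
  have 1: "swap x \<in> horoball w (b\<^sup>2 * s)" if x: "x \<in> horoball v (a\<^sup>2 * s)" for x
  proof -
    have H: "x \<in> H3" using x by (simp add: horoball_def)
    have k: "weight x > 0" by (rule weight_pos[OF H])
    have p: "1 - swap x \<bullet> w = (b / a) * ((1 - x \<bullet> v) / weight x)"
      using swap_inner[of x v] k a b by (simp add: swap_v field_simps)
    have q: "1 - swap x \<bullet> swap x = (1 - x \<bullet> x) / (weight x)\<^sup>2"
      using swap_inner[of x x] k by (simp add: power2_eq_square)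
    have "(1 - x \<bullet> v)\<^sup>2 \<le> a\<^sup>2 * s * (1 - x \<bullet> x)" using x by (simp add: horoball_iff)
    then have "(b / (a * weight x))\<^sup>2 * (1 - x \<bullet> v)\<^sup>2 \<le> (b / (a * weight x))\<^sup>2 * (a\<^sup>2 * s * (1 - x \<bullet> x))"
      by (intro mult_left_mono) auto
    also have "\<dots> = b\<^sup>2 * s * ((1 - x \<bullet> x) / (weight x)\<^sup>2)"
      using a k by (simp add: power_divide power_mult_distrib)
    also have "(b / (a * weight x))\<^sup>2 * (1 - x \<bullet> v)\<^sup>2 = (1 - swap x \<bullet> w)\<^sup>2"
      unfolding p by (simp add: power_divide power_mult_distrib)
    finally show ?thesis using swap_H3[OF H] q by (simp add: horoball_iff H3_iff)
  qed
  have 2: "swap x \<in> horoball v (a\<^sup>2 * s)" if x: "x \<in> horoball w (b\<^sup>2 * s)" for x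
  proof -
    have H: "x \<in> H3" using x by (simp add: horoball_def)
    have k: "weight x > 0" by (rule weight_pos[OF H])
    have p: "1 - swap x \<bullet> v = (a / b) * ((1 - x \<bullet> w) / weight x)"
      using swap_inner[of x w] k a b by (simp add: swap_w field_simps)
    have q: "1 - swap x \<bullet> swap x = (1 - x \<bullet> x) / (weight x)\<^sup>2"
      using swap_inner[of x x] k by (simp add: power2_eq_square)
    have "(1 - x \<bullet> w)\<^sup>2 \<le> b\<^sup>2 * s * (1 - x \<bullet> x)" using x by (simp add: horoball_iff)
    then have "(a / (b * weight x))\<^sup>2 * (1 - x \<bullet> w)\<^sup>2 \<le> (a / (b * weight x))\<^sup>2 * (b\<^sup>2 * s * (1 - x \<bullet> x))"
      by (intro mult_left_mono) auto
    also have "\<dots> = a\<^sup>2 * s * ((1 - x \<bullet> x) / (weight x)\<^sup>2)"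
      using b k by (simp add: power_divide power_mult_distrib)
    also have "(a / (b * weight x))\<^sup>2 * (1 - x \<bullet> w)\<^sup>2 = (1 - swap x \<bullet> v)\<^sup>2"
      unfolding p by (simp add: power_divide power_mult_distrib)
    finally show ?thesis using swap_H3[OF H] q by (simp add: horoball_iff H3_iff)
  qed
  show ?thesis
  proof (intro equalityI subsetI)
    fix x assume x: "x \<in> horoball w (b\<^sup>2 * s)"
    then have "x \<in> H3" by (simp add: horoball_def)
    then have "x = swap (swap x)" using weight_pos swap_swap by force
    then show "x \<in> swap ` horoball v (a\<^sup>2 * s)" using 2[OF x] by blast
  qed (use 1 in auto)
qed

end

section \<open>Horoballs in a regular ideal tetrahedron\<close>

context normalized_tetrahedron
begin

lemma finite_V: "finite V"
  using card_V by (metis card.infinite zero_neq_numeral)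

lemma pair: "v \<in> V \<Longrightarrow> w \<in> V \<Longrightarrow> v \<noteq> w \<Longrightarrow> null_pair v w (l v) (l w)"
  using norm_V l_pos gram by unfold_locales auto

lemma inner_V: "v \<in> V \<Longrightarrow> v \<bullet> v = 1" "v \<in> V \<Longrightarrow> w \<in> V \<Longrightarrow> v \<noteq> w \<Longrightarrow> v \<bullet> w = 1 - l v * l w"
  using norm_V[of v] gram[of v w] by (simp_all add: dot_square_norm)

lemma enum_V:
  assumes "v \<in> V"
  obtains b c d where "V = {v, b, c, d}" "distinct [v, b, c, d]"
proof -
  have "card (V - {v}) = 3" using assms card_V by simp
  then obtain b c d where "V - {v} = {b, c, d}" "b \<noteq> c" "b \<noteq> d" "c \<noteq> d"
    unfolding card_3_iff by auto
  then show thesis using assms by (intro that[of b c d]) auto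
qed

text \<open>The scale is chosen such that \<open>hb v \<rho>\<close> and \<open>hb w \<sigma>\<close> are tangent iff \<open>\<rho> * \<sigma> = 1\<close>, and
  \<open>hb v \<rho>\<close> is tangent to the opposite face iff \<open>\<rho> = 3\<close>.\<close>

definition hb :: "point \<Rightarrow> real \<Rightarrow> point set" where
  "hb v \<rho> = horoball v ((l v)\<^sup>2 * \<rho> / 2)"

text \<open>In the coefficients \<open>\<alpha> * l a\<close>, \<open>\<beta> * l b\<close>, ... of
  the rescaled null vectors the Lorentz form is twice the second elementary symmetric polynomial,
  whatever the cell. The terms with \<open>a\<close> are grouped because \<open>a\<close> becomes
  the apex of the cone coordinates.\<close>

lemma barycentric:
  assumes V: "V = {a, b, c, d}" "distinct [a, b, c, d]"
    and s: "\<alpha> + \<beta> + \<gamma> + \<delta> = 1"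
    and x: "x = \<alpha> *\<^sub>R a + \<beta> *\<^sub>R b + \<gamma> *\<^sub>R c + \<delta> *\<^sub>R d"
  shows "1 - x \<bullet> a = l a * (\<beta> * l b + \<gamma> * l c + \<delta> * l d)"
    and "1 - x \<bullet> x = 2 * (\<alpha> * l a * (\<beta> * l b + \<gamma> * l c + \<delta> * l d)
      + (\<beta> * l b * (\<gamma> * l c) + \<beta> * l b * (\<delta> * l d) + \<gamma> * l c * (\<delta> * l d)))"
proof -
  have i: "a \<bullet> a = 1" "b \<bullet> b = 1" "c \<bullet> c = 1" "d \<bullet> d = 1"
    "b \<bullet> a = 1 - l b * l a" "c \<bullet> a = 1 - l c * l a" "d \<bullet> a = 1 - l d * l a"
    "a \<bullet> b = 1 - l b * l a" "a \<bullet> c = 1 - l c * l a" "a \<bullet> d = 1 - l d * l a"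
    "b \<bullet> c = 1 - l b * l c" "b \<bullet> d = 1 - l b * l d" "c \<bullet> d = 1 - l c * l d"
    "c \<bullet> b = 1 - l b * l c" "d \<bullet> b = 1 - l b * l d" "d \<bullet> c = 1 - l c * l d"
    using V inner_V by (auto simp: mult.commute)
  have \<alpha>: "\<alpha> = 1 - \<beta> - \<gamma> - \<delta>" using s by simp
  have xa: "1 - x \<bullet> a = l a * (\<beta> * l b + \<gamma> * l c + \<delta> * l d)"
    and xb: "1 - x \<bullet> b = l b * (\<alpha> * l a + \<gamma> * l c + \<delta> * l d)"
    and xc: "1 - x \<bullet> c = l c * (\<alpha> * l a + \<beta> * l b + \<delta> * l d)"
    and xd: "1 - x \<bullet> d = l d * (\<alpha> * l a + \<beta> * l b + \<gamma> * l c)"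
    unfolding x \<alpha> by (simp_all add: inner_add_left i algebra_simps)
  show "1 - x \<bullet> a = l a * (\<beta> * l b + \<gamma> * l c + \<delta> * l d)" by (fact xa)
  have "1 - x \<bullet> x = (\<alpha> + \<beta> + \<gamma> + \<delta>) - (\<alpha> * (x \<bullet> a) + \<beta> * (x \<bullet> b) + \<gamma> * (x \<bullet> c) + \<delta> * (x \<bullet> d))"
    by (subst (2) x) (simp add: inner_add_right s)
  also have "\<dots> = \<alpha> * (1 - x \<bullet> a) + \<beta> * (1 - x \<bullet> b) + \<gamma> * (1 - x \<bullet> c) + \<delta> * (1 - x \<bullet> d)"
    by (simp add: algebra_simps)
  finally show "1 - x \<bullet> x = 2 * (\<alpha> * l a * (\<beta> * l b + \<gamma> * l c + \<delta> * l d)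
      + (\<beta> * l b * (\<gamma> * l c) + \<beta> * l b * (\<delta> * l d) + \<gamma> * l c * (\<delta> * l d)))"
    unfolding xa xb xc xd by (simp add: algebra_simps)
qed

text \<open>The sum of the rescaled null vectors of the face, scaled back to first coordinate
  1.\<close>

definition face_center :: "point \<Rightarrow> point" where
  "face_center v = (\<Sum>u\<in>V - {v}. (1 / (l u * (\<Sum>u\<in>V - {v}. 1 / l u))) *\<^sub>R u)"

text \<open>On the face the horoball inequality reads (y1 + y2 + y3)^2 \<le> \<rho> * (y1 y2 + y1 y3
  + y2 y3) in rescaled coordinates. The left side is at least three times the bracket on the right,
  with equality only for y1 = y2 = y3, which is the centre of the face.\<close>

lemma face_horoball:
  assumes v: "v \<in> V" and \<rho>: "\<rho> > 0"
  shows "face_center v \<in> opposite_face V v"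
    and "face_center v \<in> hb v 3"
    and "\<rho> > 3 \<Longrightarrow> face_center v \<in> interior (hb v \<rho>)"
    and "\<rho> \<le> 3 \<Longrightarrow> x \<in> hb v \<rho> \<Longrightarrow> x \<in> opposite_face V v \<Longrightarrow> \<rho> = 3 \<and> x = face_center v"
proof -
  obtain b c d where V: "V = {v, b, c, d}" "distinct [v, b, c, d]"
    using enum_V[OF v] .
  then have mem: "b \<in> V" "c \<in> V" "d \<in> V" by auto
  note lpos = l_pos[OF v] l_pos[OF mem(1)] l_pos[OF mem(2)] l_pos[OF mem(3)]
  have Vv: "V - {v} = {b, c, d}" using V by auto
  define \<Lambda> where "\<Lambda> = 1 / l b + 1 / l c + 1 / l d"
  have L: "\<Lambda> > 0" unfolding \<Lambda>_def using lpos by (simp add: add_pos_pos)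
  have fc: "face_center v = (1 / (l b * \<Lambda>)) *\<^sub>R b + (1 / (l c * \<Lambda>)) *\<^sub>R c + (1 / (l d * \<Lambda>)) *\<^sub>R d"
    using V(2) by (simp add: face_center_def Vv \<Lambda>_def add.assoc)
  have one: "1 / (l b * \<Lambda>) + 1 / (l c * \<Lambda>) + 1 / (l d * \<Lambda>) = 1"
  proof -
    have "1 / (l b * \<Lambda>) + 1 / (l c * \<Lambda>) + 1 / (l d * \<Lambda>) = (1 / l b + 1 / l c + 1 / l d) / \<Lambda>"
      by (simp add: add_divide_distrib)
    also have "\<dots> = 1" using L by (simp add: \<Lambda>_def[symmetric])
    finally show ?thesis .
  qed
  have face: "x \<in> opposite_face V v \<longleftrightarrow> x \<in> H3 \<and>
     (\<exists>\<beta> \<gamma> \<delta>. 0 \<le> \<beta> \<and> 0 \<le> \<gamma> \<and> 0 \<le> \<delta> \<and> \<beta> + \<gamma> + \<delta> = 1 \<and> x = \<beta> *\<^sub>R b + \<gamma> *\<^sub>R c + \<delta> *\<^sub>R d)" for x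
    unfolding opposite_face_def hhull_def Vv convex_hull_3 by blast
  have bary: "1 - x \<bullet> v = l v * (\<beta> * l b + \<gamma> * l c + \<delta> * l d)"
     "1 - x \<bullet> x = 2 * (\<beta> * l b * (\<gamma> * l c) + \<beta> * l b * (\<delta> * l d) + \<gamma> * l c * (\<delta> * l d))"
    if "\<beta> + \<gamma> + \<delta> = 1" "x = \<beta> *\<^sub>R b + \<gamma> *\<^sub>R c + \<delta> *\<^sub>R d" for x \<beta> \<gamma> \<delta>
    using barycentric[OF V, of 0 \<beta> \<gamma> \<delta> x] that by simp_all
  have fcv: "1 - face_center v \<bullet> v = 3 * l v / \<Lambda>"
    using bary(1)[OF one fc] lpos L by simp
  have fcq: "1 - face_center v \<bullet> face_center v = 6 / \<Lambda>\<^sup>2"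
    using bary(2)[OF one fc] lpos L by (simp add: power2_eq_square)
  have H: "face_center v \<in> H3"
  proof -
    have "6 / \<Lambda>\<^sup>2 > 0" using L by simp
    then show ?thesis using fcq unfolding H3_iff by linarith
  qed
  then show "face_center v \<in> opposite_face V v"
    unfolding face using one fc lpos L by (intro conjI exI[of _ "1 / (l b * \<Lambda>)"] exI[of _ "1 / (l c * \<Lambda>)"] exI[of _ "1 / (l d * \<Lambda>)"]) auto
  have lhs: "(1 - face_center v \<bullet> v)\<^sup>2 = 3 * ((l v)\<^sup>2 / \<Lambda>\<^sup>2) * 3"
    unfolding fcv by (simp add: power_divide power_mult_distrib)
  have rhs: "(l v)\<^sup>2 * \<rho> / 2 * (1 - face_center v \<bullet> face_center v) = 3 * ((l v)\<^sup>2 / \<Lambda>\<^sup>2) * \<rho>" for \<rho>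
    unfolding fcq by simp
  show "face_center v \<in> hb v 3"
    unfolding hb_def horoball_iff lhs rhs using H by (simp add: H3_iff)
  show "face_center v \<in> interior (hb v \<rho>)" if "\<rho> > 3"
    unfolding hb_def
  proof (rule strict_horoball_interior)
    show "(1 - face_center v \<bullet> v)\<^sup>2 < (l v)\<^sup>2 * \<rho> / 2 * (1 - face_center v \<bullet> face_center v)"
      unfolding lhs rhs using lpos L that by (intro mult_strict_left_mono) auto
  qed (use lpos \<rho> in auto)
  assume \<rho>3: "\<rho> \<le> 3" and x: "x \<in> hb v \<rho>" "x \<in> opposite_face V v"
  then obtain \<beta> \<gamma> \<delta> where bcd: "\<beta> + \<gamma> + \<delta> = 1" "x = \<beta> *\<^sub>R b + \<gamma> *\<^sub>R c + \<delta> *\<^sub>R d"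
    unfolding face by blast
  define y1 where "y1 = \<beta> * l b"
  define y2 where "y2 = \<gamma> * l c"
  define y3 where "y3 = \<delta> * l d"
  define Q where "Q = y1 * y2 + y1 * y3 + y2 * y3"
  have xv: "1 - x \<bullet> v = l v * (y1 + y2 + y3)" and xx: "1 - x \<bullet> x = 2 * Q"
    using bary[OF bcd] by (simp_all add: y1_def y2_def y3_def Q_def)
  have Q: "Q > 0"
    using x(1) xx unfolding hb_def horoball_iff by linarith
  have "(l v * (y1 + y2 + y3))\<^sup>2 \<le> (l v)\<^sup>2 * \<rho> / 2 * (2 * Q)"
    using x(1) unfolding hb_def horoball_iff xv xx by blast
  then have "(l v)\<^sup>2 * (y1 + y2 + y3)\<^sup>2 \<le> (l v)\<^sup>2 * (\<rho> * Q)"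
    by (simp add: power_mult_distrib mult_ac)
  then have le: "(y1 + y2 + y3)\<^sup>2 \<le> \<rho> * Q" using lpos by simp
  have id: "2 * ((y1 + y2 + y3)\<^sup>2 - 3 * Q) = (y1 - y2)\<^sup>2 + (y1 - y3)\<^sup>2 + (y2 - y3)\<^sup>2"
    unfolding Q_def by (simp add: power2_eq_square algebra_simps)
  have "\<rho> * Q \<le> 3 * Q" using \<rho>3 Q by simp
  then have "2 * ((y1 + y2 + y3)\<^sup>2 - 3 * Q) \<le> 0" using le by simp
  then have z: "(y1 - y2)\<^sup>2 + (y1 - y3)\<^sup>2 + (y2 - y3)\<^sup>2 \<le> 0" unfolding id .
  then have "(y1 - y2)\<^sup>2 = 0" "(y1 - y3)\<^sup>2 = 0"
    using zero_le_power2[of "y1 - y2"] zero_le_power2[of "y1 - y3"] zero_le_power2[of "y2 - y3"] by linarith+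
  then have y: "y2 = y1" "y3 = y1" by auto
  have "3 * Q \<le> \<rho> * Q" using le unfolding y Q_def by (simp add: power2_eq_square)
  then have "\<rho> = 3" using Q \<rho>3 by simp
  moreover have bcd': "\<beta> = y1 / l b" "\<gamma> = y1 / l c" "\<delta> = y1 / l d"
    using lpos y unfolding y1_def y2_def y3_def by (simp_all add: field_simps)
  have "y1 * \<Lambda> = 1" using bcd(1) unfolding bcd' \<Lambda>_def by (simp add: algebra_simps)
  then have "y1 = 1 / \<Lambda>" using L by (simp add: field_simps)
  then have "x = face_center v"
    unfolding bcd(2) bcd' fc by (simp add: mult.commute)
  ultimately show "\<rho> = 3 \<and> x = face_center v" by simp
qed

lemma admissible_iff:
  "admissible V B \<longleftrightarrow> (\<exists>\<rho>. (\<forall>v\<in>V. 0 < \<rho> v \<and> \<rho> v \<le> 3 \<and> B v = hb v (\<rho> v)) \<and>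
     (\<forall>v\<in>V. \<forall>w\<in>V. v \<noteq> w \<longrightarrow> \<rho> v * \<rho> w \<le> 1))"
proof
  assume adm: "admissible V B"
  then obtain s where s: "\<forall>v\<in>V. s v > 0 \<and> B v = horoball v (s v)"
    unfolding admissible_def by metis
  define \<rho> where "\<rho> v = 2 * s v / (l v)\<^sup>2" for v
  have \<rho>: "0 < \<rho> v" "B v = hb v (\<rho> v)" if "v \<in> V" for v
    using that s l_pos[OF that] by (auto simp: \<rho>_def hb_def)
  have "\<rho> v \<le> 3" if v: "v \<in> V" for v
  proof (rule ccontr)
    assume "\<not> \<rho> v \<le> 3"
    then have "face_center v \<in> interior (B v) \<inter> opposite_face V v"
      using face_horoball(1,3)[OF v \<rho>(1)[OF v]] \<rho>(2)[OF v] by auto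
    then show False using adm v unfolding admissible_def by blast
  qed
  moreover have "\<rho> v * \<rho> w \<le> 1" if v: "v \<in> V" "w \<in> V" "v \<noteq> w" for v w
  proof (rule ccontr)
    assume "\<not> \<rho> v * \<rho> w \<le> 1"
    then have "interior (B v) \<inter> interior (B w) \<noteq> {}"
      using null_pair.horoballs_overlap[OF pair[OF v] \<rho>(1)[OF v(1)] \<rho>(1)[OF v(2)]]
      unfolding \<rho>(2)[OF v(1)] \<rho>(2)[OF v(2)] hb_def by simp
    then show False using adm v unfolding admissible_def by blast
  qed
  ultimately show "\<exists>\<rho>. (\<forall>v\<in>V. 0 < \<rho> v \<and> \<rho> v \<le> 3 \<and> B v = hb v (\<rho> v)) \<and>
     (\<forall>v\<in>V. \<forall>w\<in>V. v \<noteq> w \<longrightarrow> \<rho> v * \<rho> w \<le> 1)"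
    using \<rho> by blast
next
  assume "\<exists>\<rho>. (\<forall>v\<in>V. 0 < \<rho> v \<and> \<rho> v \<le> 3 \<and> B v = hb v (\<rho> v)) \<and>
     (\<forall>v\<in>V. \<forall>w\<in>V. v \<noteq> w \<longrightarrow> \<rho> v * \<rho> w \<le> 1)"
  then obtain \<rho> where \<rho>: "\<And>v. v \<in> V \<Longrightarrow> 0 < \<rho> v" "\<And>v. v \<in> V \<Longrightarrow> \<rho> v \<le> 3" "\<And>v. v \<in> V \<Longrightarrow> B v = hb v (\<rho> v)"
    and p: "\<And>v w. v \<in> V \<Longrightarrow> w \<in> V \<Longrightarrow> v \<noteq> w \<Longrightarrow> \<rho> v * \<rho> w \<le> 1" by blast
  show "admissible V B"
    unfolding admissible_def
  proof (intro conjI ballI impI)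
    fix v assume v: "v \<in> V"
    show "\<exists>s>0. B v = horoball v s"
      using \<rho>[OF v] l_pos[OF v] by (intro exI[of _ "(l v)\<^sup>2 * \<rho> v / 2"]) (simp add: hb_def)
    show "interior (B v) \<inter> opposite_face V v = {}"
    proof (rule ccontr)
      assume "interior (B v) \<inter> opposite_face V v \<noteq> {}"
      then obtain x where x: "x \<in> interior (hb v (\<rho> v))" "x \<in> opposite_face V v"
        using \<rho>(3)[OF v] by auto
      then have eq: "\<rho> v = 3" "x = face_center v"
        using face_horoball(4)[OF v \<rho>(1)[OF v] \<rho>(2)[OF v]] interior_subset by blast+
      from x(1) have "(1 - x \<bullet> v)\<^sup>2 < (l v)\<^sup>2 * 3 / 2 * (1 - x \<bullet> x)"
        unfolding hb_def eq(1) using l_pos[OF v] by (intro interior_horoball_strict norm_V v) auto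
      \<comment> \<open>At parameter 3 the horoball itself contains a point of the face. An interior
        point satisfies the inequality strictly, so it already lies in a slightly smaller horoball,
        which cannot reach the face.\<close>
      then obtain \<rho>' where r: "\<rho>' < 3" "(1 - x \<bullet> v)\<^sup>2 \<le> (l v)\<^sup>2 * \<rho>' / 2 * (1 - x \<bullet> x)" "\<rho>' > 0"
      proof -
        have xx: "1 - x \<bullet> x > 0" using x(2) by (simp add: opposite_face_def hhull_def H3_iff)
        define D where "D = (l v)\<^sup>2 / 2 * (1 - x \<bullet> x)"
        have D: "D > 0" using xx l_pos[OF v] by (simp add: D_def)
        assume "(1 - x \<bullet> v)\<^sup>2 < (l v)\<^sup>2 * 3 / 2 * (1 - x \<bullet> x)"
          and *: "\<And>\<rho>'. \<rho>' < 3 \<Longrightarrow> (1 - x \<bullet> v)\<^sup>2 \<le> (l v)\<^sup>2 * \<rho>' / 2 * (1 - x \<bullet> x) \<Longrightarrow> 0 < \<rho>' \<Longrightarrow> thesis"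
        then have "(1 - x \<bullet> v)\<^sup>2 < D * 3" by (simp add: D_def)
        then have "(1 - x \<bullet> v)\<^sup>2 / D < 3" using D by (simp add: field_simps)
        then obtain t where t: "max 0 ((1 - x \<bullet> v)\<^sup>2 / D) < t" "t < 3"
          using dense[of "max 0 ((1 - x \<bullet> v)\<^sup>2 / D)" 3] by auto
        then have "(1 - x \<bullet> v)\<^sup>2 \<le> D * t" using D by (simp add: field_simps)
        then have "(1 - x \<bullet> v)\<^sup>2 \<le> (l v)\<^sup>2 * t / 2 * (1 - x \<bullet> x)" by (simp add: D_def mult_ac)
        then show thesis using *[of t] t by simp
      qed
      moreover have "x \<in> hb v \<rho>'"
        unfolding hb_def horoball_iff using r x(2) by (simp add: opposite_face_def hhull_def H3_iff)
      ultimately show False using face_horoball(4)[OF v, of \<rho>' x] x(2) by auto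
    qed
    fix w assume w: "w \<in> V" "v \<noteq> w"
    show "interior (B v) \<inter> interior (B w) = {}"
      using null_pair.horoballs_interior_disjoint[OF pair[OF v w] \<rho>(1)[OF v] \<rho>(1)[OF w(1)] p[OF v w]]
      unfolding \<rho>(3)[OF v] \<rho>(3)[OF w(1)] hb_def .
  qed
qed

section \<open>Symmetries, centre and edge midpoints of the cell\<close>

lemma hisometry_id: "hisometry (\<lambda>x. x)"
  by (simp add: hisometry_def bij_betw_def)

abbreviation "swp v w \<equiv> null_pair.swap v w (l v) (l w)"

text \<open>Transpositions suffice, since both sameness of type and equal distance from the faces
  compare two vertices at a time. Every third vertex lies on the mirror because its products with
  the two rescaled null vectors agree.\<close>

lemma swap_vertices:
  assumes mem: "v \<in> V" "w \<in> V" "v \<noteq> w"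
  shows "hisometry (swp v w)"
    and "U \<subseteq> V \<Longrightarrow> swp v w ` hhull U = hhull (swp v w ` U)"
    and "swp v w v = w" "swp v w w = v" "\<And>u. u \<in> V \<Longrightarrow> u \<noteq> v \<Longrightarrow> u \<noteq> w \<Longrightarrow> swp v w u = u"
    and "swp v w ` hb v \<rho> = hb w \<rho>"
proof -
  interpret null_pair v w "l v" "l w" by (rule pair[OF mem])
  show "hisometry swap" by (rule hisometry_swap)
  show "swap v = w" "swap w = v" by (rule swap_v swap_w)+
  have *: "weight u = 1" "swap u = u" if "u \<in> V" "u \<noteq> v" "u \<noteq> w" for u
    using swap_fixed[of u] gram[OF that(1) mem(1)] gram[OF that(1) mem(2)] that a b by auto
  show "\<And>u. u \<in> V \<Longrightarrow> u \<noteq> v \<Longrightarrow> u \<noteq> w \<Longrightarrow> swap u = u" by (rule *(2))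
  have "weight u > 0" if "u \<in> V" for u
    using *(1)[OF that] swap_v(1) swap_w(1) a b by (cases "u = v"; cases "u = w") auto
  then show "swap ` hhull U = hhull (swap ` U)" if "U \<subseteq> V"
    using that by (intro swap_hhull) auto
  show "swap ` hb v \<rho> = hb w \<rho>"
    using swap_horoball[of "\<rho> / 2"] by (simp add: hb_def)
qed

lemma swap_image:
  assumes mem: "v \<in> V" "w \<in> V" "v \<noteq> w"
  shows "swp v w ` V = V" "swp v w ` (V - {v}) = V - {w}"
proof -
  note sw = swap_vertices(3-5)[OF mem]
  have "swp v w u \<in> V" if "u \<in> V" for u
    using sw that mem by (cases "u = v"; cases "u = w") auto
  then have sub: "swp v w ` V \<subseteq> V" by auto
  have "swp v w (swp v w u) = u" if "u \<in> V" for u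
  proof -
    consider "u = v" | "u = w" | "u \<noteq> v" "u \<noteq> w" by blast
    then show ?thesis using sw(1,2) sw(3)[OF that] by cases simp_all
  qed
  then have inj: "inj_on (swp v w) V"
    by (rule inj_on_inverseI)
  show im: "swp v w ` V = V"
    by (rule endo_inj_surj[OF finite_V sub inj])
  show "swp v w ` (V - {v}) = V - {w}"
    using inj_on_image_set_diff[OF inj, of V "{v}"] mem sw im by simp
qed

lemma same_type_hb:
  assumes "v \<in> V" "w \<in> V"
  shows "same_type V (hb v \<rho>) (hb w \<rho>)"
proof (cases "v = w")
  case True
  then show ?thesis
    unfolding same_type_def cell_symmetry_def using hisometry_id by (intro exI[of _ "\<lambda>x. x"]) simp
next
  case False
  show ?thesis
    unfolding same_type_def cell_symmetry_def
    using swap_vertices(1,6)[OF assms False] swap_vertices(2)[OF assms False, of V] swap_image(1)[OF assms False]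
    by (intro exI[of _ "swp v w"]) simp
qed

definition centre :: point where
  "centre = (\<Sum>u\<in>V. (1 / (l u * (\<Sum>u\<in>V. 1 / l u))) *\<^sub>R u)"

lemma centre_props:
  assumes v: "v \<in> V"
  shows "centre \<in> hhull V" "1 - centre \<bullet> v = 3 * l v / (\<Sum>u\<in>V. 1 / l u)"
proof -
  obtain b c d where V: "V = {v, b, c, d}" "distinct [v, b, c, d]"
    using enum_V[OF v] .
  then have mem: "b \<in> V" "c \<in> V" "d \<in> V" by auto
  note lpos = l_pos[OF v] l_pos[OF mem(1)] l_pos[OF mem(2)] l_pos[OF mem(3)]
  define \<Lambda> where "\<Lambda> = (\<Sum>u\<in>V. 1 / l u)"
  have \<Lambda>_eq: "\<Lambda> = 1 / l v + 1 / l b + 1 / l c + 1 / l d"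
    unfolding \<Lambda>_def V(1) using V(2) by (simp add: add.assoc)
  have L: "\<Lambda> > 0" unfolding \<Lambda>_eq using lpos by (simp add: add_pos_pos)
  have c_eq: "centre = (1 / (l v * \<Lambda>)) *\<^sub>R v + (1 / (l b * \<Lambda>)) *\<^sub>R b + (1 / (l c * \<Lambda>)) *\<^sub>R c + (1 / (l d * \<Lambda>)) *\<^sub>R d"
    unfolding centre_def \<Lambda>_def[symmetric] unfolding V(1) using V(2) by (simp add: add.assoc)
  have one: "1 / (l v * \<Lambda>) + 1 / (l b * \<Lambda>) + 1 / (l c * \<Lambda>) + 1 / (l d * \<Lambda>) = 1"
  proof -
    have "1 / (l v * \<Lambda>) + 1 / (l b * \<Lambda>) + 1 / (l c * \<Lambda>) + 1 / (l d * \<Lambda>) = (1 / l v + 1 / l b + 1 / l c + 1 / l d) / \<Lambda>"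
      by (simp add: add_divide_distrib)
    also have "\<dots> = 1" using L by (simp add: \<Lambda>_eq[symmetric])
    finally show ?thesis .
  qed
  note bary = barycentric[OF V one c_eq]
  show "1 - centre \<bullet> v = 3 * l v / (\<Sum>u\<in>V. 1 / l u)"
    unfolding \<Lambda>_def[symmetric] bary(1) using lpos L by simp
  have "1 - centre \<bullet> centre = 12 / \<Lambda>\<^sup>2"
    unfolding bary(2) using lpos L by (simp add: power2_eq_square)
  moreover have "12 / \<Lambda>\<^sup>2 > 0" using L by simp
  ultimately have "centre \<in> H3" unfolding H3_iff by linarith
  moreover have "centre \<in> convex hull V"
  proof -
    have "(\<Sum>u\<in>V. 1 / (l u * \<Lambda>)) = 1"
      using one unfolding V(1) using V(2) by (simp add: add.assoc)
    moreover have "0 \<le> 1 / (l u * \<Lambda>)" if "u \<in> V" for u using l_pos[OF that] L by simp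
    ultimately show ?thesis
      unfolding centre_def \<Lambda>_def[symmetric] using finite_V
      by (intro convex_sum convex_convex_hull) (auto intro: hull_inc)
  qed
  ultimately show "centre \<in> hhull V" by (simp add: hhull_def)
qed

text \<open>The infima are never evaluated: the reflection exchanging two vertices fixes
  \<open>centre\<close> and carries one opposite face isometrically to the other.\<close>

lemma is_center_centre: "is_center V centre"
  unfolding is_center_def
proof (intro conjI ballI)
  obtain v where "v \<in> V" using card_V by fastforce
  then show "centre \<in> hhull V" by (rule centre_props)
  fix v w assume mem: "v \<in> V" "w \<in> V"
  show "(INF y\<in>opposite_face V v. hdist centre y) = (INF y\<in>opposite_face V w. hdist centre y)"
  proof (cases "v = w")
    case False
    interpret null_pair v w "l v" "l w" by (rule pair[OF mem False])
    have "(1 - centre \<bullet> v) / l v = (1 - centre \<bullet> w) / l w"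
      using centre_props(2)[OF mem(1)] centre_props(2)[OF mem(2)] a b by simp
    then have fx: "swap centre = centre" by (rule swap_fixed)
    have "opposite_face V w = swap ` opposite_face V v"
      unfolding opposite_face_def using swap_vertices(2)[OF mem False, of "V - {v}"] swap_image(2)[OF mem False] by auto
    then have "(INF y\<in>opposite_face V w. hdist centre y) = (INF y\<in>opposite_face V v. hdist centre (swap y))"
      by (simp add: image_image)
    also have "\<dots> = (INF y\<in>opposite_face V v. hdist centre y)"
    proof (rule INF_cong)
      fix y assume "y \<in> opposite_face V v"
      then have "y \<in> H3" "centre \<in> H3"
        using centre_props(1)[OF mem(1)] by (auto simp: opposite_face_def hhull_def)
      then have "hdist (swap centre) (swap y) = hdist centre y"
        using hisometry_swap unfolding hisometry_def by blast
      then show "hdist centre (swap y) = hdist centre y" by (simp add: fx)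
    qed simp
    finally show ?thesis by simp
  qed simp
qed

text \<open>Parameter 1 gives the sum of the two rescaled null vectors, which the reflection
  exchanging \<open>v\<close> and \<open>w\<close> fixes. \<open>centre\<close> serves as the
  witness for the centre, and the orthogonality is checked in the metric.\<close>

lemma edge_midpoint:
  assumes mem: "v \<in> V" "w \<in> V" "v \<noteq> w"
  shows "is_edge_midpoint V v w (null_pair.edge_point v w (l v) (l w) 1)"
proof -
  interpret null_pair v w "l v" "l w" by (rule pair[OF mem])
  define m where "m = edge_point 1"
  define a' where "a' = l v"
  define b' where "b' = l w"
  define K where "K = 3 / (\<Sum>u\<in>V. 1 / l u)"
  have pos: "a' > 0" "b' > 0" using a b by (simp_all add: a'_def b'_def)
  have m: "m = (b' / (b' + a')) *\<^sub>R v + (a' / (b' + a')) *\<^sub>R w"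
    by (simp add: m_def edge_point_def a'_def b'_def)
  have cv: "centre \<bullet> v = 1 - K * a'" "centre \<bullet> w = 1 - K * b'"
    using centre_props(2)[OF mem(1)] centre_props(2)[OF mem(2)] by (simp_all add: K_def a'_def b'_def)
  have mi: "m \<bullet> v = 1 - a' * (a' * b') / (b' + a')" "m \<bullet> w = 1 - b' * (a' * b') / (b' + a')"
    "m \<bullet> m = 1 - 2 * (a' * b')\<^sup>2 / (b' + a')\<^sup>2"
    using edge_point_inner[of 1] by (simp_all add: m_def a'_def b'_def algebra_simps)
  have mc: "m \<bullet> centre = 1 - 2 * K * (a' * b') / (b' + a')"
  proof -
    have "m \<bullet> centre = (b' / (b' + a')) * (centre \<bullet> v) + (a' / (b' + a')) * (centre \<bullet> w)"
      unfolding inner_commute[of m] by (simp add: m inner_add_right)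
    also have "\<dots> = (b' / (b' + a') + a' / (b' + a')) - 2 * K * (a' * b') / (b' + a')"
      unfolding cv by (simp add: algebra_simps diff_divide_distrib)
    also have "b' / (b' + a') + a' / (b' + a') = 1"
      using pos by (simp add: add_divide_distrib[symmetric])
    finally show ?thesis .
  qed
  have "is_perp_foot centre v w m"
    unfolding is_perp_foot_def
  proof
    show "m \<in> open_segment v w"
      unfolding in_segment m using mem(3)
    proof (intro conjI exI[of _ "a' / (b' + a')"])
      have "1 - a' / (b' + a') = b' / (b' + a')" using pos by (simp add: field_simps)
      then show "(b' / (b' + a')) *\<^sub>R v + (a' / (b' + a')) *\<^sub>R w =
          (1 - a' / (b' + a')) *\<^sub>R v + (a' / (b' + a')) *\<^sub>R w" by simp
    qed (use pos in auto)
    define q where "q = 1 - m \<bullet> m"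
    define t where "t = a' * b' / (b' + a')"
    have t: "t > 0" using pos by (simp add: t_def)
    have q: "q = 2 * t\<^sup>2" using mi by (simp add: q_def t_def power_divide)
    then have q0: "q > 0" using t by simp
    have "m \<bullet> v = 1 - a' * t" "m \<bullet> w = 1 - b' * t"
      using mi by (simp_all add: t_def)
    then have e: "m \<bullet> (w - v) = (a' - b') * t"
      unfolding inner_diff_right by (simp add: algebra_simps)
    have ce: "centre \<bullet> (w - v) = K * (a' - b')"
      unfolding inner_diff_right cv by (simp add: algebra_simps)
    have mcm: "m \<bullet> (centre - m) = q - 2 * K * t"
      unfolding inner_diff_right mc q_def t_def by simp
    have cme: "(centre - m) \<bullet> (w - v) = K * (a' - b') - (a' - b') * t"
      unfolding inner_diff_left ce e by simp
    have "(centre - m) \<bullet> (w - v) * q + (m \<bullet> (centre - m)) * (m \<bullet> (w - v)) =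
        K * (a' - b') * (q - 2 * t\<^sup>2)"
      unfolding e mcm cme by (simp add: algebra_simps power2_eq_square)
    also have "\<dots> = 0" using q by simp
    finally have z: "(centre - m) \<bullet> (w - v) * q + (m \<bullet> (centre - m)) * (m \<bullet> (w - v)) = 0" .
    have "hmetric m (centre - m) (w - v) = ((centre - m) \<bullet> (w - v) * q + (m \<bullet> (centre - m)) * (m \<bullet> (w - v))) / q\<^sup>2"
      unfolding hmetric_def power2_norm_eq_inner q_def[symmetric] using q0 by (simp add: add_divide_distrib power2_eq_square)
    then show "hmetric m (centre - m) (w - v) = 0" using z by simp
  qed
  then show ?thesis
    unfolding is_edge_midpoint_def m_def using is_center_centre by blast
qed

end

section \<open>Volumes\<close>

context normalized_tetrahedron
begin

text \<open>The constraint comes from a linear dependence of the four vertices in three-dimensional space.\<close>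

lemma sum_inverse_l:
  assumes V: "V = {a, b, c, d}" "distinct [a, b, c, d]"
  shows "(1 / l a + 1 / l b + 1 / l c + 1 / l d)\<^sup>2 - 3 * ((1 / l a)\<^sup>2 + (1 / l b)\<^sup>2 + (1 / l c)\<^sup>2 + (1 / l d)\<^sup>2) = 3"
proof -
  have "dependent V"
    using independent_bound[of V] card_V by (auto simp: dependent_raw_def)
  then obtain u where u: "(\<Sum>v\<in>V. u v *\<^sub>R v) = 0" "\<exists>v\<in>V. u v \<noteq> 0"
    using dependent_finite[OF finite_V] by blast
  define m where "m = (\<Sum>v\<in>V. u v)"
  define Y where "Y = (\<Sum>v\<in>V. u v * l v)"
  \<comment> \<open>Inner products of the dependence with the vertices give one linear equation for
    each \<open>u w\<close>; a nonzero solution exists only under the claimed quadratic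
    relation.\<close>
  have eq: "m = l w * (Y - u w * l w)" if w: "w \<in> V" for w
  proof -
    have "0 = (\<Sum>v\<in>V. u v *\<^sub>R v) \<bullet> w" by (simp add: u)
    also have "\<dots> = (\<Sum>v\<in>V. u v * (v \<bullet> w))" by (simp add: inner_sum_left)
    also have "\<dots> = u w + (\<Sum>v\<in>V - {w}. u v * (v \<bullet> w))"
      using finite_V w by (simp add: sum.remove inner_V(1))
    also have "(\<Sum>v\<in>V - {w}. u v * (v \<bullet> w)) = (\<Sum>v\<in>V - {w}. u v - l w * (u v * l v))"
      using w by (intro sum.cong) (auto simp: inner_V algebra_simps)
    also have "\<dots> = (m - u w) - l w * (Y - u w * l w)"
      unfolding m_def Y_def using finite_V w by (simp add: sum_subtractf sum_distrib_left[symmetric] sum.remove)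
    finally show ?thesis by simp
  qed
  have mem: "a \<in> V" "b \<in> V" "c \<in> V" "d \<in> V" using V by auto
  have Y: "Y = u a * l a + u b * l b + u c * l c + u d * l d"
    unfolding Y_def V(1) using V(2) by (simp add: add.assoc)
  have m: "m = u a + u b + u c + u d"
    unfolding m_def V(1) using V(2) by (simp add: add.assoc)
  have y: "u w * l w = Y - m / l w" if "w \<in> V" for w
    using eq[OF that] l_pos[OF that] by (simp add: field_simps)
  define \<Lambda> where "\<Lambda> = 1 / l a + 1 / l b + 1 / l c + 1 / l d"
  have "Y = (Y - m / l a) + (Y - m / l b) + (Y - m / l c) + (Y - m / l d)"
    using Y y[OF mem(1)] y[OF mem(2)] y[OF mem(3)] y[OF mem(4)] by linarith
  also have "\<dots> = 4 * Y - m * \<Lambda>"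
    by (simp add: \<Lambda>_def algebra_simps)
  finally have "Y = 4 * Y - m * \<Lambda>" .
  then have Y3: "3 * Y = m * \<Lambda>" by simp
  have m0: "m \<noteq> 0"
  proof
    assume "m = 0"
    then have "u w * l w = 0" if "w \<in> V" for w
      using y[OF that] Y3 by simp
    then have "u w = 0" if "w \<in> V" for w using that l_pos[OF that] by fastforce
    with u(2) show False by blast
  qed
  have uw: "u w = Y * (1 / l w) - m * (1 / l w)\<^sup>2" if "w \<in> V" for w
    using y[OF that] l_pos[OF that] by (simp add: field_simps power2_eq_square)
  have "m = Y * \<Lambda> - m * ((1 / l a)\<^sup>2 + (1 / l b)\<^sup>2 + (1 / l c)\<^sup>2 + (1 / l d)\<^sup>2)"
    by (subst m) (simp only: uw[OF mem(1)] uw[OF mem(2)] uw[OF mem(3)] uw[OF mem(4)] \<Lambda>_def, simp add: algebra_simps)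
  then have "m * 3 = 3 * Y * \<Lambda> - 3 * m * ((1 / l a)\<^sup>2 + (1 / l b)\<^sup>2 + (1 / l c)\<^sup>2 + (1 / l d)\<^sup>2)"
    by linarith
  also have "\<dots> = m * (\<Lambda>\<^sup>2 - 3 * ((1 / l a)\<^sup>2 + (1 / l b)\<^sup>2 + (1 / l c)\<^sup>2 + (1 / l d)\<^sup>2))"
    unfolding Y3 by (simp add: algebra_simps power2_eq_square)
  finally show ?thesis using m0 unfolding \<Lambda>_def by simp
qed

end

section \<open>Cone coordinates at a marked vertex\<close>

locale marked_tetrahedron = normalized_tetrahedron +
  fixes a b c d :: point
  assumes V_eq: "V = {a, b, c, d}" and dist: "distinct [a, b, c, d]"
begin

lemma mem: "a \<in> V" "b \<in> V" "c \<in> V" "d \<in> V"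
  using V_eq by auto

lemmas lpos = l_pos[OF mem(1)] l_pos[OF mem(2)] l_pos[OF mem(3)] l_pos[OF mem(4)]

text \<open>Dividing the edge vectors by the scales makes the arguments the coefficients of rescaled
  null vectors, the coordinates in which the form in \<open>barycentric\<close> is independent of
  the cell.\<close>

definition \<phi> :: "real \<Rightarrow> real \<Rightarrow> real \<Rightarrow> point" where
  "\<phi> x y z = (x / l b) *\<^sub>R (b - a) + (y / l c) *\<^sub>R (c - a) + (z / l d) *\<^sub>R (d - a)"

definition \<Phi> :: "point \<Rightarrow> point" where
  "\<Phi> y = \<phi> (y $ 1) (y $ 2) (y $ 3)"

lemma linear_\<Phi>: "linear \<Phi>"
  by (rule linearI) (simp_all add: \<Phi>_def \<phi>_def algebra_simps add_divide_distrib)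

text \<open>Inner products give access only to the Gram determinant, the square of the determinant,
  hence the absolute value. It is a quadratic polynomial in the ratios p, q, r, which
  \<open>sum_inverse_l\<close> evaluates to \<open>3 * (l a)\<^sup>2\<close>.\<close>

lemma det_\<Phi>: "\<bar>det (matrix \<Phi>)\<bar> = sqrt 3 * l a"
proof -
  define w1 where "w1 = (1 / l b) *\<^sub>R (b - a)"
  define w2 where "w2 = (1 / l c) *\<^sub>R (c - a)"
  define w3 where "w3 = (1 / l d) *\<^sub>R (d - a)"
  define W :: "3 \<Rightarrow> point" where "W j = (if j = 1 then w1 else if j = 2 then w2 else w3)" for j
  have neq: "(1::3) \<noteq> 2" "(1::3) \<noteq> 3" "(2::3) \<noteq> 3" "(2::3) \<noteq> 1" "(3::3) \<noteq> 1" "(3::3) \<noteq> 2"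
    by simp_all
  have W: "\<Phi> (axis j 1) = W j" for j
    using exhaust_3[of j] neq by (auto simp: \<Phi>_def \<phi>_def W_def w1_def w2_def w3_def axis_def)
  have MM: "(transpose (matrix \<Phi>) ** matrix \<Phi>) $ i $ j = W i \<bullet> W j" for i j
    by (simp add: matrix_matrix_mult_def transpose_def matrix_def W inner_vec_def)
  define p where "p = l a / l b"
  define q where "q = l a / l c"
  define r where "r = l a / l d"
  have ii: "a \<bullet> a = 1" "b \<bullet> b = 1" "c \<bullet> c = 1" "d \<bullet> d = 1"
    "b \<bullet> a = 1 - l b * l a" "c \<bullet> a = 1 - l c * l a" "d \<bullet> a = 1 - l d * l a"
    "a \<bullet> b = 1 - l b * l a" "a \<bullet> c = 1 - l c * l a" "a \<bullet> d = 1 - l d * l a"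
    "b \<bullet> c = 1 - l b * l c" "b \<bullet> d = 1 - l b * l d" "c \<bullet> d = 1 - l c * l d"
    "c \<bullet> b = 1 - l b * l c" "d \<bullet> b = 1 - l b * l d" "d \<bullet> c = 1 - l c * l d"
    using dist mem inner_V by (auto simp: mult.commute)
  have g: "w1 \<bullet> w1 = 2 * p" "w2 \<bullet> w2 = 2 * q" "w3 \<bullet> w3 = 2 * r"
     "w1 \<bullet> w2 = p + q - 1" "w1 \<bullet> w3 = p + r - 1" "w2 \<bullet> w3 = q + r - 1"
     "w2 \<bullet> w1 = p + q - 1" "w3 \<bullet> w1 = p + r - 1" "w3 \<bullet> w2 = q + r - 1"
    unfolding w1_def w2_def w3_def p_def q_def r_def using lpos
    by (simp_all add: inner_diff_left inner_diff_right ii) (simp_all add: field_simps)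
  have "(det (matrix \<Phi>))\<^sup>2 = det (transpose (matrix \<Phi>) ** matrix \<Phi>)"
    by (simp add: det_mul power2_eq_square)
  also have "\<dots> = (1 + p + q + r)\<^sup>2 - 3 * (1 + p\<^sup>2 + q\<^sup>2 + r\<^sup>2)"
    unfolding det_3 MM by (simp add: W_def neq g) (simp add: algebra_simps power2_eq_square)
  also have "\<dots> = (l a)\<^sup>2 * ((1 / l a + 1 / l b + 1 / l c + 1 / l d)\<^sup>2 - 3 * ((1 / l a)\<^sup>2 + (1 / l b)\<^sup>2 + (1 / l c)\<^sup>2 + (1 / l d)\<^sup>2))"
  proof -
    have e1: "1 + p + q + r = l a * (1 / l a + 1 / l b + 1 / l c + 1 / l d)"
      using lpos by (simp add: p_def q_def r_def algebra_simps)
    have e2: "1 + p\<^sup>2 + q\<^sup>2 + r\<^sup>2 = (l a)\<^sup>2 * ((1 / l a)\<^sup>2 + (1 / l b)\<^sup>2 + (1 / l c)\<^sup>2 + (1 / l d)\<^sup>2)"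
      using lpos by (simp add: p_def q_def r_def algebra_simps power_divide)
    show ?thesis unfolding e1 e2 power_mult_distrib right_diff_distrib by simp
  qed
  also have "\<dots> = (sqrt 3 * l a)\<^sup>2"
    unfolding sum_inverse_l[OF V_eq dist] by (simp add: power_mult_distrib)
  finally have "\<bar>det (matrix \<Phi>)\<bar> = \<bar>sqrt 3 * l a\<bar>"
    by (metis power2_eq_iff abs_minus_cancel)
  then show ?thesis using lpos by simp
qed

lemma det_\<Phi>_nonzero: "det (matrix \<Phi>) \<noteq> 0"
  using det_\<Phi> lpos by auto

lemma \<phi>_inj: "\<phi> x y z = \<phi> x' y' z' \<Longrightarrow> x = x' \<and> y = y' \<and> z = z'"
proof -
  assume "\<phi> x y z = \<phi> x' y' z'"
  then have "\<Phi> (vector [x, y, z]) = \<Phi> (vector [x', y', z'])"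
    by (simp add: \<Phi>_def)
  moreover have "inj \<Phi>"
    using det_\<Phi>_nonzero linear_\<Phi> by (simp add: det_nz_iff_inj)
  ultimately have "(vector [x, y, z] :: point) = vector [x', y', z']"
    by (simp add: inj_eq)
  then show ?thesis
    by (metis vector_3)
qed

lemma nn_integral_tetrahedron:
  fixes G :: "point \<Rightarrow> ennreal"
  assumes G[measurable]: "G \<in> borel_measurable borel"
  shows "(\<integral>\<^sup>+x. G x \<partial>lborel) = ennreal (sqrt 3 * l a) *
    (\<integral>\<^sup>+t. \<integral>\<^sup>+z. \<integral>\<^sup>+\<rho>. ennreal (\<rho>\<^sup>2) * G (a + \<phi> (\<rho> * t) (\<rho> * (1 - t)) (\<rho> * z)) \<partial>lborel \<partial>lborel \<partial>lborel)"
proof -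
  have "continuous_on UNIV \<Phi>"
    using linear_\<Phi> linear_continuous_on linear_linear by blast
  then have [measurable]: "\<Phi> \<in> borel_measurable borel"
    by (rule borel_measurable_continuous_onI)
  have "(\<integral>\<^sup>+x. G x \<partial>lborel) = (\<integral>\<^sup>+x. G x \<partial>distr lborel borel ((+) a))"
    by (simp add: lborel_distr_plus)
  also have "\<dots> = (\<integral>\<^sup>+x. G (a + x) \<partial>lborel)"
    by (simp add: nn_integral_distr)
  also have "\<dots> = ennreal (sqrt 3 * l a) * (\<integral>\<^sup>+y. G (a + \<Phi> y) \<partial>lborel)"
    by (subst nn_integral_linear_det[OF linear_\<Phi> det_\<Phi>_nonzero]) (simp_all add: det_\<Phi>)
  also have "(\<integral>\<^sup>+y. G (a + \<Phi> y) \<partial>lborel) = (\<integral>\<^sup>+x. \<integral>\<^sup>+y. \<integral>\<^sup>+z. G (a + \<phi> x y z) \<partial>lborel \<partial>lborel \<partial>lborel)"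
    by (subst nn_integral_vec3, measurable) (simp add: \<Phi>_def)
  also have "\<dots> = (\<integral>\<^sup>+t. \<integral>\<^sup>+z. \<integral>\<^sup>+\<rho>. ennreal (\<rho>\<^sup>2) * G (a + \<phi> (\<rho> * t) (\<rho> * (1 - t)) (\<rho> * z)) \<partial>lborel \<partial>lborel \<partial>lborel)"
  proof (rule nn_integral_cone_coordinates)
    have "continuous_on UNIV (\<lambda>p. a + \<phi> (fst p) (fst (snd p)) (snd (snd p)))"
      unfolding \<phi>_def using lpos by (intro continuous_intros) auto
    then have "(\<lambda>p. a + \<phi> (fst p) (fst (snd p)) (snd (snd p))) \<in> borel_measurable borel"
      by (rule borel_measurable_continuous_onI)
    from measurable_compose[OF this G] show "(\<lambda>(x, y, z). G (a + \<phi> x y z)) \<in> borel_measurable borel"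
      by (simp add: case_prod_beta')
  qed
  finally show ?thesis .
qed

lemma point_inner:
  assumes x: "x = a + \<phi> y1 y2 y3"
  defines "\<alpha> \<equiv> 1 - (y1 / l b + y2 / l c + y3 / l d)"
  shows "x = \<alpha> *\<^sub>R a + (y1 / l b) *\<^sub>R b + (y2 / l c) *\<^sub>R c + (y3 / l d) *\<^sub>R d"
    and "1 - x \<bullet> a = l a * (y1 + y2 + y3)"
    and "1 - x \<bullet> x = 2 * (l a * \<alpha> * (y1 + y2 + y3) + (y1 * y2 + y1 * y3 + y2 * y3))"
proof -
  show x': "x = \<alpha> *\<^sub>R a + (y1 / l b) *\<^sub>R b + (y2 / l c) *\<^sub>R c + (y3 / l d) *\<^sub>R d"
    unfolding x \<alpha>_def \<phi>_def by (simp add: algebra_simps)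
  have s: "\<alpha> + y1 / l b + y2 / l c + y3 / l d = 1" by (simp add: \<alpha>_def)
  show "1 - x \<bullet> a = l a * (y1 + y2 + y3)"
    "1 - x \<bullet> x = 2 * (l a * \<alpha> * (y1 + y2 + y3) + (y1 * y2 + y1 * y3 + y2 * y3))"
    using barycentric[OF V_eq dist s x'] lpos by (simp_all add: mult_ac)
qed

lemma convex_hull_iff:
  "a + \<phi> y1 y2 y3 \<in> convex hull V \<longleftrightarrow> 0 \<le> y1 \<and> 0 \<le> y2 \<and> 0 \<le> y3 \<and> y1 / l b + y2 / l c + y3 / l d \<le> 1"
proof
  assume "0 \<le> y1 \<and> 0 \<le> y2 \<and> 0 \<le> y3 \<and> y1 / l b + y2 / l c + y3 / l d \<le> 1"
  moreover define \<alpha> where "\<alpha> = 1 - (y1 / l b + y2 / l c + y3 / l d)"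
  ultimately have nn: "0 \<le> \<alpha>" "0 \<le> y1 / l b" "0 \<le> y2 / l c" "0 \<le> y3 / l d"
    using lpos by auto
  define u where "u x = (if x = a then \<alpha> else if x = b then y1 / l b else if x = c then y2 / l c else y3 / l d)" for x
  have "sum u V = 1" "(\<Sum>x\<in>V. u x *\<^sub>R x) = a + \<phi> y1 y2 y3"
    using dist point_inner(1)[OF refl, of y1 y2 y3] unfolding V_eq
    by (auto simp: u_def add.assoc \<alpha>_def)
  moreover have "\<forall>x\<in>V. 0 \<le> u x"
    using nn by (simp add: u_def)
  ultimately show "a + \<phi> y1 y2 y3 \<in> convex hull V"
    unfolding convex_hull_finite[OF finite_V] by blast
next
  assume "a + \<phi> y1 y2 y3 \<in> convex hull V"
  then obtain u where u: "\<forall>x\<in>V. 0 \<le> u x" "sum u V = 1" "(\<Sum>x\<in>V. u x *\<^sub>R x) = a + \<phi> y1 y2 y3"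
    unfolding convex_hull_finite[OF finite_V] by auto
  have s: "u a + u b + u c + u d = 1"
    using u(2) dist unfolding V_eq by (simp add: add.assoc)
  have "a + \<phi> y1 y2 y3 = u a *\<^sub>R a + u b *\<^sub>R b + u c *\<^sub>R c + u d *\<^sub>R d"
    using u(3) dist unfolding V_eq by (simp add: add.assoc)
  also have "\<dots> = a + \<phi> (u b * l b) (u c * l c) (u d * l d)"
  proof -
    have ua: "u a = 1 - u b - u c - u d" using s by simp
    show ?thesis unfolding ua \<phi>_def using lpos by (simp add: algebra_simps)
  qed
  finally have "y1 = u b * l b \<and> y2 = u c * l c \<and> y3 = u d * l d"
    by (intro \<phi>_inj) simp
  then show "0 \<le> y1 \<and> 0 \<le> y2 \<and> 0 \<le> y3 \<and> y1 / l b + y2 / l c + y3 / l d \<le> 1"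
    using u(1) mem lpos s by (auto simp: algebra_simps)
qed

text \<open>A set that in the cone coordinates from \<open>a\<close> is given by \<open>\<rho> \<le> M t z\<close>; there
  \<open>1 - (norm x)\<^sup>2 = 2 * \<rho> * (A + B * \<rho>)\<close>, so the density times the Jacobian \<open>\<rho>\<^sup>2\<close> is
  \<open>1 / (4 * (A + B * \<rho>)\<^sup>2)\<close>.\<close>

lemma emeasure_cone:
  fixes M :: "real \<Rightarrow> real \<Rightarrow> real"
  assumes A[measurable]: "A \<in> sets borel" and sub: "A \<subseteq> hhull V"
    and M: "\<And>t z. 0 < t \<Longrightarrow> t < 1 \<Longrightarrow> 0 \<le> z \<Longrightarrow> 0 \<le> M t z \<and> M t z * (t / l b + (1 - t) / l c + z / l d) \<le> 1"
    and iff: "\<And>t z \<rho>. 0 < t \<Longrightarrow> t < 1 \<Longrightarrow> 0 \<le> z \<Longrightarrow> 0 < \<rho> \<Longrightarrow> \<rho> * (t / l b + (1 - t) / l c + z / l d) \<le> 1 \<Longrightarrow>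
      a + \<phi> (\<rho> * t) (\<rho> * (1 - t)) (\<rho> * z) \<in> A \<longleftrightarrow> \<rho> \<le> M t z"
    and val: "\<And>t z. 0 < t \<Longrightarrow> t < 1 \<Longrightarrow> 0 \<le> z \<Longrightarrow>
      M t z / (l a * (1 + z) * (l a * (1 + z) * (1 - M t z * (t / l b + (1 - t) / l c + z / l d)) + M t z * (t * (1 - t) + z))) = f t z / l a"
  shows "emeasure hmeasure A = ennreal (sqrt 3 * l a) *
     (\<integral>\<^sup>+t. (\<integral>\<^sup>+z. ennreal (f t z / (4 * l a)) * indicator {0..} z \<partial>lborel) * indicator {0<..<1} t \<partial>lborel)"
proof -
  define D where "D = (\<lambda>x::point. ennreal (1 / (1 - (norm x)\<^sup>2)\<^sup>2))"
  have D[measurable]: "D \<in> borel_measurable borel"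
    unfolding D_def by measurable
  have Dx: "ennreal (1 / (1 - (norm x)\<^sup>2)\<^sup>2) = D x" for x
    by (simp add: D_def)
  have H3[measurable]: "H3 \<in> sets borel" by (simp add: H3_def)
  have "emeasure hmeasure A = (\<integral>\<^sup>+x. indicator H3 x * D x * indicator A x \<partial>lborel)"
    unfolding hmeasure_def Dx by (rule emeasure_density) (simp_all add: A)
  also have "\<dots> = (\<integral>\<^sup>+x. D x * indicator A x \<partial>lborel)"
    using sub by (intro nn_integral_cong) (auto simp: hhull_def split: split_indicator)
  also have "\<dots> = ennreal (sqrt 3 * l a) *
    (\<integral>\<^sup>+t. \<integral>\<^sup>+z. \<integral>\<^sup>+\<rho>. ennreal (\<rho>\<^sup>2) * (D (a + \<phi> (\<rho> * t) (\<rho> * (1 - t)) (\<rho> * z)) *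
        indicator A (a + \<phi> (\<rho> * t) (\<rho> * (1 - t)) (\<rho> * z))) \<partial>lborel \<partial>lborel \<partial>lborel)"
    by (rule nn_integral_tetrahedron) simp
  also have "(\<integral>\<^sup>+t. \<integral>\<^sup>+z. \<integral>\<^sup>+\<rho>. ennreal (\<rho>\<^sup>2) * (D (a + \<phi> (\<rho> * t) (\<rho> * (1 - t)) (\<rho> * z)) *
        indicator A (a + \<phi> (\<rho> * t) (\<rho> * (1 - t)) (\<rho> * z))) \<partial>lborel \<partial>lborel \<partial>lborel) =
     (\<integral>\<^sup>+t. (\<integral>\<^sup>+z. ennreal (f t z / (4 * l a)) * indicator {0..} z \<partial>lborel) * indicator {0<..<1} t \<partial>lborel)"
  proof (rule nn_integral_cong_AE)
    have "(\<integral>\<^sup>+z. \<integral>\<^sup>+\<rho>. ennreal (\<rho>\<^sup>2) * (D (a + \<phi> (\<rho> * t) (\<rho> * (1 - t)) (\<rho> * z)) *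
        indicator A (a + \<phi> (\<rho> * t) (\<rho> * (1 - t)) (\<rho> * z))) \<partial>lborel \<partial>lborel) =
      (\<integral>\<^sup>+z. ennreal (f t z / (4 * l a)) * indicator {0..} z \<partial>lborel) * indicator {0<..<1} t"
      if t: "t \<noteq> 0" "t \<noteq> 1" for t
    proof -
      have "(\<integral>\<^sup>+\<rho>. ennreal (\<rho>\<^sup>2) * (D (a + \<phi> (\<rho> * t) (\<rho> * (1 - t)) (\<rho> * z)) *
        indicator A (a + \<phi> (\<rho> * t) (\<rho> * (1 - t)) (\<rho> * z))) \<partial>lborel) =
        ennreal (f t z / (4 * l a)) * indicator {0..} z * indicator {0<..<1} t" for z
      proof -
        let ?x = "\<lambda>\<rho>. a + \<phi> (\<rho> * t) (\<rho> * (1 - t)) (\<rho> * z)"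
        define S where "S = t / l b + (1 - t) / l c + z / l d"
        have hull: "?x \<rho> \<in> A \<Longrightarrow> 0 \<le> \<rho> * t \<and> 0 \<le> \<rho> * (1 - t) \<and> 0 \<le> \<rho> * z \<and> \<rho> * S \<le> 1" for \<rho>
        proof -
          assume "?x \<rho> \<in> A"
          then have "?x \<rho> \<in> convex hull V" using sub by (auto simp: hhull_def)
          moreover have "\<rho> * t / l b + \<rho> * (1 - t) / l c + \<rho> * z / l d = \<rho> * S"
            by (simp add: S_def algebra_simps)
          ultimately show ?thesis unfolding convex_hull_iff by simp
        qed
        show ?thesis
        proof (cases "t \<in> {0<..<1} \<and> 0 \<le> z")
          case False
          \<comment> \<open>Outside the range of t and z the nonnegativity of all coordinates leaves
            only \<rho> = 0, where the Jacobian vanishes.\<close>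
          have "\<rho> = 0" if "?x \<rho> \<in> A" for \<rho>
          proof (rule ccontr)
            assume "\<rho> \<noteq> 0"
            from hull[OF that] have *: "0 \<le> \<rho> * t" "0 \<le> \<rho> * (1 - t)" "0 \<le> \<rho> * z" by auto
            have "0 \<le> \<rho>" using add_mono[OF *(1,2)] by (simp add: algebra_simps)
            with \<open>\<rho> \<noteq> 0\<close> have "\<rho> > 0" by simp
            with * have "0 \<le> t" "0 \<le> 1 - t" "0 \<le> z" by (simp_all add: zero_le_mult_iff)
            with t False show False by auto
          qed
          then have zero: "ennreal (\<rho>\<^sup>2) * (D (?x \<rho>) * indicator A (?x \<rho>)) = 0" for \<rho>
            by (cases "?x \<rho> \<in> A") auto
          show ?thesis unfolding zero using False by (auto split: split_indicator)
        next
          case True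
          then have tz: "0 < t" "t < 1" "0 \<le> z" by auto
          define L where "L = l a * (1 + z)"
          define Q where "Q = t * (1 - t) + z"
          define B where "B = Q - L * S"
          have L: "L > 0" using lpos tz by (simp add: L_def)
          have Q: "Q > 0" using tz by (simp add: Q_def add_pos_nonneg)
          have S: "S > 0" unfolding S_def using tz lpos by (intro add_pos_nonneg add_pos_pos) auto
          \<comment> \<open>\<open>B\<close> may be negative; this form is a sum of nonnegative
            terms as long as the opposite face is not passed.\<close>
          have LB: "L + B * \<rho> = L * (1 - \<rho> * S) + \<rho> * Q" for \<rho>
            by (simp add: B_def algebra_simps)
          have LBpos: "L + B * \<rho> > 0" if "0 \<le> \<rho>" "\<rho> * S \<le> 1" for \<rho>
          proof (cases "\<rho> = 0")
            case False
            then have "\<rho> * Q > 0" using that Q by simp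
            moreover have "L * (1 - \<rho> * S) \<ge> 0" using L that by simp
            ultimately show ?thesis unfolding LB by linarith
          qed (use L in simp)
          have MS: "0 \<le> M t z" "M t z * S \<le> 1"
            using M[OF tz] by (simp_all add: S_def)
          \<comment> \<open>At \<rho> = 0 the equation fails: the left side is 0 and the right side
            is positive. The two integrands agree only almost everywhere.\<close>
          have D_eq: "ennreal (\<rho>\<^sup>2) * (D (?x \<rho>) * indicator A (?x \<rho>)) =
              ennreal (1 / (L + B * \<rho>)\<^sup>2 / 4) * indicator {0..M t z} \<rho>" if "\<rho> \<noteq> 0" for \<rho>
          proof (cases "0 < \<rho> \<and> \<rho> * S \<le> 1")
            case True
            then have \<rho>: "0 < \<rho>" "\<rho> * S \<le> 1" by auto
            have "1 - ?x \<rho> \<bullet> ?x \<rho> = 2 * \<rho> * (L + B * \<rho>)"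
            proof -
              have "\<rho> * t / l b + \<rho> * (1 - t) / l c + \<rho> * z / l d = \<rho> * S"
                by (simp add: S_def algebra_simps)
              then show ?thesis
                unfolding point_inner(3)[OF refl] LB by (simp add: L_def Q_def algebra_simps)
            qed
            then have "D (?x \<rho>) = ennreal (1 / (2 * \<rho> * (L + B * \<rho>))\<^sup>2)"
              by (simp add: D_def power2_norm_eq_inner)
            moreover have "\<rho>\<^sup>2 * (1 / (2 * \<rho> * (L + B * \<rho>))\<^sup>2) = 1 / (L + B * \<rho>)\<^sup>2 / 4"
              using \<rho> LBpos[of \<rho>] by (simp add: power_mult_distrib)
            ultimately have "ennreal (\<rho>\<^sup>2) * D (?x \<rho>) = ennreal (1 / (L + B * \<rho>)\<^sup>2 / 4)"
              by (simp add: ennreal_mult[symmetric])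
            moreover have "?x \<rho> \<in> A \<longleftrightarrow> \<rho> \<in> {0..M t z}"
              using iff[OF tz \<rho>(1)] \<rho> by (auto simp: S_def)
            ultimately show ?thesis by (simp add: mult.assoc[symmetric] indicator_def)
          next
            case False
            have "?x \<rho> \<notin> A"
            proof
              assume "?x \<rho> \<in> A"
              from hull[OF this] have "0 \<le> \<rho>" "\<rho> * S \<le> 1" using tz by (auto simp: zero_le_mult_iff)
              with False that show False by auto
            qed
            moreover have "\<rho> \<notin> {0..M t z}"
            proof
              assume "\<rho> \<in> {0..M t z}"
              then have "\<rho> > 0" "\<rho> * S \<le> M t z * S" using that S by auto
              with False MS show False by auto
            qed
            ultimately show ?thesis by simp
          qed
          have "(\<integral>\<^sup>+\<rho>. ennreal (\<rho>\<^sup>2) * (D (?x \<rho>) * indicator A (?x \<rho>)) \<partial>lborel) =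
              (\<integral>\<^sup>+\<rho>. ennreal (1 / 4) * (ennreal (1 / (L + B * \<rho>)\<^sup>2) * indicator {0..M t z} \<rho>) \<partial>lborel)"
          proof (rule nn_integral_cong_AE)
            show "AE \<rho> in lborel. ennreal (\<rho>\<^sup>2) * (D (?x \<rho>) * indicator A (?x \<rho>)) =
                ennreal (1 / 4) * (ennreal (1 / (L + B * \<rho>)\<^sup>2) * indicator {0..M t z} \<rho>)"
              using AE_lborel_singleton[of 0]
            proof eventually_elim
              case (elim \<rho>)
              show ?case unfolding D_eq[OF elim]
                by (simp add: mult.assoc[symmetric] ennreal_mult[symmetric] mult.commute[of 4])
            qed
          qed
          also have "\<dots> = ennreal (1 / 4) * (\<integral>\<^sup>+\<rho>. ennreal (1 / (L + B * \<rho>)\<^sup>2) * indicator {0..M t z} \<rho> \<partial>lborel)"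
            by (rule nn_integral_cmult) measurable
          also have "\<dots> = ennreal (1 / 4) * ennreal (M t z / (L * (L + B * M t z)))"
            using nn_integral_inverse_square_affine[OF L MS(1) LBpos[OF MS]] by simp
          also have "M t z / (L * (L + B * M t z)) = f t z / l a"
            using val[OF tz] unfolding LB unfolding L_def Q_def S_def .
          also have "ennreal (1 / 4) * ennreal (f t z / l a) = ennreal (f t z / (4 * l a))"
            by (simp add: ennreal_mult'[symmetric])
          finally show ?thesis using tz by simp
        qed
      qed
      then show ?thesis by (auto split: split_indicator)
    qed
    note inner = this
    show "AE t in lborel. (\<integral>\<^sup>+z. \<integral>\<^sup>+\<rho>. ennreal (\<rho>\<^sup>2) * (D (a + \<phi> (\<rho> * t) (\<rho> * (1 - t)) (\<rho> * z)) *
        indicator A (a + \<phi> (\<rho> * t) (\<rho> * (1 - t)) (\<rho> * z))) \<partial>lborel \<partial>lborel) =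
      (\<integral>\<^sup>+z. ennreal (f t z / (4 * l a)) * indicator {0..} z \<partial>lborel) * indicator {0<..<1} t"
      using AE_lborel_singleton[of 0] AE_lborel_singleton[of 1]
    proof eventually_elim
      case (elim t)
      then show ?case by (rule inner)
    qed
  qed
  finally show ?thesis .
qed

lemma cone_point:
  assumes t: "0 < t" "t < 1" "0 \<le> z" and \<rho>: "0 < \<rho>" "\<rho> * (t / l b + (1 - t) / l c + z / l d) \<le> 1"
  defines "x \<equiv> a + \<phi> (\<rho> * t) (\<rho> * (1 - t)) (\<rho> * z)"
  shows "1 - x \<bullet> a = l a * \<rho> * (1 + z)"
    and "1 - x \<bullet> x = 2 * \<rho> * (l a * (1 + z) * (1 - \<rho> * (t / l b + (1 - t) / l c + z / l d)) + \<rho> * (t * (1 - t) + z))"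
    and "x \<in> hhull V"
proof -
  define S where "S = t / l b + (1 - t) / l c + z / l d"
  have S: "\<rho> * t / l b + \<rho> * (1 - t) / l c + \<rho> * z / l d = \<rho> * S"
    by (simp add: S_def algebra_simps)
  show "1 - x \<bullet> a = l a * \<rho> * (1 + z)"
    unfolding x_def point_inner(2)[OF refl] by (simp add: algebra_simps)
  have q: "1 - x \<bullet> x = 2 * \<rho> * (l a * (1 + z) * (1 - \<rho> * S) + \<rho> * (t * (1 - t) + z))"
    unfolding x_def point_inner(3)[OF refl] S by (simp add: algebra_simps)
  then show "1 - x \<bullet> x = 2 * \<rho> * (l a * (1 + z) * (1 - \<rho> * (t / l b + (1 - t) / l c + z / l d)) + \<rho> * (t * (1 - t) + z))"
    by (simp add: S_def)
  have "l a * (1 + z) * (1 - \<rho> * S) \<ge> 0"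
    using lpos t \<rho> by (intro mult_nonneg_nonneg) (auto simp: S_def)
  moreover have "\<rho> * (t * (1 - t) + z) > 0"
    using t \<rho> by (intro mult_pos_pos add_pos_nonneg) auto
  ultimately have "1 - x \<bullet> x > 0"
    unfolding q using \<rho> by (intro mult_pos_pos) auto
  then have "x \<in> H3" unfolding H3_iff by linarith
  moreover have "x \<in> convex hull V"
    unfolding x_def convex_hull_iff S using t \<rho> by (simp add: S_def)
  ultimately show "x \<in> hhull V" by (simp add: hhull_def)
qed

lemma hhull_borel[measurable]: "hhull V \<in> sets borel"
proof -
  have "compact (convex hull V)" using finite_V by (rule finite_imp_compact_convex_hull)
  then have "convex hull V \<in> sets borel" by (intro borel_closed compact_imp_closed)
  then show ?thesis by (auto simp: hhull_def H3_def)
qed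

text \<open>Each ray runs up to the opposite face, where 1 - M * S = 0 and the dependence on
  \<open>l b\<close>, \<open>l c\<close>, \<open>l d\<close> drops out. The integral over z is - ln
  c / (1 - c) with c = t (1 - t); the logarithm splits, and the substitution of 1 - t for t shows
  that both halves contribute the same series.\<close>

lemma emeasure_hull: "emeasure hmeasure (hhull V) = ennreal (sqrt 3 / 2 * suminf gieseking_term)"
proof -
  let ?J = "suminf gieseking_term"
  let ?f = "\<lambda>t z. 1 / ((1 + z) * (t * (1 - t) + z))"
  have "emeasure hmeasure (hhull V) = ennreal (sqrt 3 * l a) *
     (\<integral>\<^sup>+t. (\<integral>\<^sup>+z. ennreal (?f t z / (4 * l a)) * indicator {0..} z \<partial>lborel) * indicator {0<..<1} t \<partial>lborel)"
  proof (rule emeasure_cone[where M="\<lambda>t z. 1 / (t / l b + (1 - t) / l c + z / l d)" and f="?f"])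
    fix t z :: real assume t: "0 < t" "t < 1" "0 \<le> z"
    define S where "S = t / l b + (1 - t) / l c + z / l d"
    have S: "S > 0" unfolding S_def using t lpos by (intro add_pos_nonneg add_pos_pos) auto
    then show "0 \<le> 1 / (t / l b + (1 - t) / l c + z / l d) \<and>
        1 / (t / l b + (1 - t) / l c + z / l d) * (t / l b + (1 - t) / l c + z / l d) \<le> 1"
      unfolding S_def[symmetric] by simp
    define Q where "Q = t * (1 - t) + z"
    have "Q > 0" using t by (simp add: Q_def add_pos_nonneg)
    then show "1 / (t / l b + (1 - t) / l c + z / l d) / (l a * (1 + z) * (l a * (1 + z) *
          (1 - 1 / (t / l b + (1 - t) / l c + z / l d) * (t / l b + (1 - t) / l c + z / l d)) +
          1 / (t / l b + (1 - t) / l c + z / l d) * (t * (1 - t) + z))) = ?f t z / l a"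
      unfolding S_def[symmetric] Q_def[symmetric] using S by simp
    fix \<rho> assume \<rho>: "0 < \<rho>" "\<rho> * (t / l b + (1 - t) / l c + z / l d) \<le> 1"
    then have "\<rho> * S \<le> 1" by (simp only: S_def)
    then have "\<rho> \<le> 1 / S" using S by (simp add: field_simps)
    then show "a + \<phi> (\<rho> * t) (\<rho> * (1 - t)) (\<rho> * z) \<in> hhull V \<longleftrightarrow> \<rho> \<le> 1 / (t / l b + (1 - t) / l c + z / l d)"
      using cone_point(3)[OF t \<rho>] by (simp add: S_def)
  qed simp_all
  also have "(\<integral>\<^sup>+t. (\<integral>\<^sup>+z. ennreal (?f t z / (4 * l a)) * indicator {0..} z \<partial>lborel) * indicator {0<..<1} t \<partial>lborel)
     = (\<integral>\<^sup>+t. ennreal (1 / (4 * l a)) * (ennreal (- ln t / (1 - t + t\<^sup>2)) * indicator {0<..<1} t +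
          ennreal (- ln (1 - t) / (1 - t + t\<^sup>2)) * indicator {0<..<1} t) \<partial>lborel)"
  proof (rule nn_integral_cong)
    fix t :: real
    show "(\<integral>\<^sup>+z. ennreal (?f t z / (4 * l a)) * indicator {0..} z \<partial>lborel) * indicator {0<..<1} t =
       ennreal (1 / (4 * l a)) * (ennreal (- ln t / (1 - t + t\<^sup>2)) * indicator {0<..<1} t +
          ennreal (- ln (1 - t) / (1 - t + t\<^sup>2)) * indicator {0<..<1} t)"
    proof (cases "t \<in> {0<..<1}")
      case True
      then have t: "0 < t" "t < 1" by auto
      have c: "0 < t * (1 - t)" "t * (1 - t) < 1"
        using t mult_strict_mono[of t 1 "1 - t" 1] by auto
      have pos: "1 - t + t\<^sup>2 > 0"
        using c by (simp add: power2_eq_square algebra_simps)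
      have "(\<integral>\<^sup>+z. ennreal (?f t z / (4 * l a)) * indicator {0..} z \<partial>lborel) =
         (\<integral>\<^sup>+z. ennreal (1 / (4 * l a)) * (ennreal (?f t z) * indicator {0..} z) \<partial>lborel)"
      proof (rule nn_integral_cong)
        fix z
        have "ennreal (?f t z / (4 * l a)) = ennreal (1 / (4 * l a)) * ennreal (?f t z)"
          using lpos by (subst ennreal_mult'[symmetric]) (simp_all add: mult_ac)
        then show "ennreal (?f t z / (4 * l a)) * indicator {0..} z = ennreal (1 / (4 * l a)) * (ennreal (?f t z) * indicator {0..} z)"
          by (simp only: mult.assoc)
      qed
      also have "\<dots> = ennreal (1 / (4 * l a)) * ennreal (- ln (t * (1 - t)) / (1 - t * (1 - t)))"
        by (subst nn_integral_cmult) (simp_all add: nn_integral_inverse_product[OF c])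
      also have "- ln (t * (1 - t)) / (1 - t * (1 - t)) = - ln t / (1 - t + t\<^sup>2) + - ln (1 - t) / (1 - t + t\<^sup>2)"
      proof -
        have e1: "ln (t * (1 - t)) = ln t + ln (1 - t)" using t by (simp add: ln_mult)
        have e2: "1 - t * (1 - t) = 1 - t + t\<^sup>2" by (simp add: power2_eq_square algebra_simps)
        show ?thesis unfolding e1 e2 by (simp add: diff_divide_distrib)
      qed
      also have "ennreal (- ln t / (1 - t + t\<^sup>2) + - ln (1 - t) / (1 - t + t\<^sup>2)) =
          ennreal (- ln t / (1 - t + t\<^sup>2)) + ennreal (- ln (1 - t) / (1 - t + t\<^sup>2))"
        using t pos by (intro ennreal_plus divide_nonneg_pos) auto
      finally show ?thesis using True by simp
    qed simp
  qed
  also have "\<dots> = ennreal (1 / (4 * l a)) * (ennreal ?J + ennreal ?J)"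
  proof -
    have "(\<integral>\<^sup>+t. ennreal (- ln (1 - t) / (1 - t + t\<^sup>2)) * indicator {0<..<1} t \<partial>lborel) =
        (\<integral>\<^sup>+t. ennreal (- ln (1 - (1 + - 1 * t)) / (1 - (1 + - 1 * t) + (1 + - 1 * t)\<^sup>2)) * indicator {0<..<1} (1 + - 1 * t) \<partial>lborel)"
      by (subst nn_integral_real_affine[where c="-1" and t=1]) simp_all
    also have "\<dots> = (\<integral>\<^sup>+t. ennreal (- ln t / (1 - t + t\<^sup>2)) * indicator {0<..<1} t \<partial>lborel)"
    proof (rule nn_integral_cong)
      fix t :: real
      have e: "1 - (1 + - 1 * t) + (1 + - 1 * t)\<^sup>2 = 1 - t + t\<^sup>2" by (simp add: power2_eq_square algebra_simps)
      show "ennreal (- ln (1 - (1 + - 1 * t)) / (1 - (1 + - 1 * t) + (1 + - 1 * t)\<^sup>2)) * indicator {0<..<1} (1 + - 1 * t)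
         = ennreal (- ln t / (1 - t + t\<^sup>2)) * indicator {0<..<1} t"
        unfolding e by (auto split: split_indicator)
    qed
    also have "\<dots> = ennreal ?J" by (rule nn_integral_gieseking)
    finally have J': "(\<integral>\<^sup>+t. ennreal (- ln (1 - t) / (1 - t + t\<^sup>2)) * indicator {0<..<1} t \<partial>lborel) = ennreal ?J" .
    have "(\<integral>\<^sup>+t. ennreal (1 / (4 * l a)) * (ennreal (- ln t / (1 - t + t\<^sup>2)) * indicator {0<..<1} t +
          ennreal (- ln (1 - t) / (1 - t + t\<^sup>2)) * indicator {0<..<1} t) \<partial>lborel) =
        ennreal (1 / (4 * l a)) * (\<integral>\<^sup>+t. ennreal (- ln t / (1 - t + t\<^sup>2)) * indicator {0<..<1} t +
          ennreal (- ln (1 - t) / (1 - t + t\<^sup>2)) * indicator {0<..<1} t \<partial>lborel)"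
      by (rule nn_integral_cmult) measurable
    also have "(\<integral>\<^sup>+t. ennreal (- ln t / (1 - t + t\<^sup>2)) * indicator {0<..<1} t +
          ennreal (- ln (1 - t) / (1 - t + t\<^sup>2)) * indicator {0<..<1} t \<partial>lborel) =
        (\<integral>\<^sup>+t. ennreal (- ln t / (1 - t + t\<^sup>2)) * indicator {0<..<1} t \<partial>lborel) +
        (\<integral>\<^sup>+t. ennreal (- ln (1 - t) / (1 - t + t\<^sup>2)) * indicator {0<..<1} t \<partial>lborel)"
      by (rule nn_integral_add) measurable
    finally show ?thesis
      unfolding J' nn_integral_gieseking .
  qed
  also have "ennreal (sqrt 3 * l a) * (ennreal (1 / (4 * l a)) * (ennreal ?J + ennreal ?J)) = ennreal (sqrt 3 / 2 * ?J)"
    using lpos gieseking_bounds(2) by (simp add: ennreal_mult[symmetric] ennreal_plus[symmetric] del: ennreal_plus)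
  finally show ?thesis .
qed

lemma hb_borel[measurable]: "hb v \<sigma> \<in> sets borel"
proof -
  have "closed {x. (1 - x \<bullet> v)\<^sup>2 \<le> (l v)\<^sup>2 * \<sigma> / 2 * (1 - (norm x)\<^sup>2)}"
    by (intro closed_Collect_le continuous_intros)
  then have "H3 \<inter> {x. (1 - x \<bullet> v)\<^sup>2 \<le> (l v)\<^sup>2 * \<sigma> / 2 * (1 - (norm x)\<^sup>2)} \<in> sets borel"
    by (simp add: H3_def)
  moreover have "hb v \<sigma> = H3 \<inter> {x. (1 - x \<bullet> v)\<^sup>2 \<le> (l v)\<^sup>2 * \<sigma> / 2 * (1 - (norm x)\<^sup>2)}"
    by (auto simp: hb_def horoball_def)
  ultimately show ?thesis by simp
qed

text \<open>A ray from the centre meets the horoball in an initial segment, and \<open>E\<close>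
  arises from solving the equation of the horosphere for \<rho>. The integral along the ray is then
  free of t and of the scales at the other vertices, and linear in \<sigma>.\<close>

lemma emeasure_sector:
  assumes \<sigma>: "0 < \<sigma>" "\<sigma> \<le> 3"
  shows "emeasure hmeasure (hb a \<sigma> \<inter> hhull V) = ennreal (sqrt 3 / 8 * \<sigma>)"
proof -
  let ?f = "\<lambda>(t::real) (z::real). \<sigma> / (1 + z) ^ 3"
  let ?S = "\<lambda>t z. t / l b + (1 - t) / l c + z / l d"
  define E where "E = (\<lambda>t z. (1 + z)\<^sup>2 - \<sigma> * (t * (1 - t) + z) + \<sigma> * (l a * (1 + z)) * ?S t z)"
  have "emeasure hmeasure (hb a \<sigma> \<inter> hhull V) = ennreal (sqrt 3 * l a) *
     (\<integral>\<^sup>+t. (\<integral>\<^sup>+z. ennreal (?f t z / (4 * l a)) * indicator {0..} z \<partial>lborel) * indicator {0<..<1} t \<partial>lborel)"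
  proof (rule emeasure_cone[where M="\<lambda>t z. \<sigma> * (l a * (1 + z)) / E t z" and f="?f"])
    fix t z :: real assume t: "0 < t" "t < 1" "0 \<le> z"
    define S where "S = ?S t z"
    define Q where "Q = t * (1 - t) + z"
    define A where "A = l a * (1 + z)"
    define e where "e = E t z"
    have S: "S > 0" unfolding S_def using t lpos by (intro add_pos_nonneg add_pos_pos) auto
    have A: "A > 0" using lpos t by (simp add: A_def)
    have Q: "Q > 0" using t by (simp add: Q_def add_pos_nonneg)
    \<comment> \<open>The inequality behind tangency to the face, now for the coordinates t, 1 - t,
      z; together with \<sigma> \<le> 3 it makes the ray leave the horoball no later than it reaches
      the opposite face.\<close>
    have "3 * Q \<le> (1 + z)\<^sup>2"
    proof -
      have *: "2 * ((1 + z)\<^sup>2 - 3 * Q) = (t - (1 - t))\<^sup>2 + (t - z)\<^sup>2 + (1 - t - z)\<^sup>2"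
        by (simp add: Q_def power2_eq_square algebra_simps)
      have "0 \<le> 2 * ((1 + z)\<^sup>2 - 3 * Q)" unfolding * by simp
      then show ?thesis by simp
    qed
    moreover have "\<sigma> * Q \<le> 3 * Q" using \<sigma> Q by (intro mult_right_mono) auto
    ultimately have \<sigma>Q: "\<sigma> * Q \<le> (1 + z)\<^sup>2" by linarith
    have e: "e = (1 + z)\<^sup>2 - \<sigma> * Q + \<sigma> * A * S" by (simp add: e_def E_def Q_def A_def S_def)
    have e0: "e > 0" unfolding e using \<sigma>Q \<sigma> A S by (intro add_nonneg_pos mult_pos_pos) auto
    have "\<sigma> * A * S \<le> e" unfolding e using \<sigma>Q by simp
    then have "\<sigma> * A / e * S \<le> 1" using e0 by (simp add: field_simps)
    then show "0 \<le> \<sigma> * (l a * (1 + z)) / E t z \<and> \<sigma> * (l a * (1 + z)) / E t z * ?S t z \<le> 1"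
      unfolding A_def[symmetric] e_def[symmetric] S_def[symmetric] using \<sigma> A e0 by simp
    have "A * (1 - \<sigma> * A / e * S) + \<sigma> * A / e * Q = A * (e - \<sigma> * A * S + \<sigma> * Q) / e"
      using e0 by (simp add: field_simps)
    also have "e - \<sigma> * A * S + \<sigma> * Q = (1 + z)\<^sup>2" by (simp add: e)
    finally have *: "A * (1 - \<sigma> * A / e * S) + \<sigma> * A / e * Q = A * (1 + z)\<^sup>2 / e" .
    show "\<sigma> * (l a * (1 + z)) / E t z / (l a * (1 + z) * (l a * (1 + z) * (1 - \<sigma> * (l a * (1 + z)) / E t z * ?S t z) +
        \<sigma> * (l a * (1 + z)) / E t z * (t * (1 - t) + z))) = ?f t z / l a"
      unfolding A_def[symmetric] e_def[symmetric] S_def[symmetric] Q_def[symmetric] *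
      using e0 A by (simp add: A_def power2_eq_square power3_eq_cube)
    fix \<rho> assume \<rho>: "0 < \<rho>" "\<rho> * ?S t z \<le> 1"
    let ?x = "a + \<phi> (\<rho> * t) (\<rho> * (1 - t)) (\<rho> * z)"
    note x = cone_point[OF t \<rho>]
    have "?x \<in> H3" using x(3) by (simp add: hhull_def)
    then have "?x \<in> hb a \<sigma> \<longleftrightarrow> (l a * \<rho> * (1 + z))\<^sup>2 \<le> (l a)\<^sup>2 * \<sigma> / 2 * (2 * \<rho> * (A * (1 - \<rho> * S) + \<rho> * Q))"
      unfolding hb_def horoball_iff x(1,2) A_def S_def Q_def by (simp add: H3_iff)
    also have "\<dots> \<longleftrightarrow> (l a)\<^sup>2 * \<rho> * (\<rho> * (1 + z)\<^sup>2) \<le> (l a)\<^sup>2 * \<rho> * (\<sigma> * (A * (1 - \<rho> * S) + \<rho> * Q))"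
    proof -
      have "(l a * \<rho> * (1 + z))\<^sup>2 = (l a)\<^sup>2 * \<rho> * (\<rho> * (1 + z)\<^sup>2)"
        by (simp add: power2_eq_square)
      moreover have "(l a)\<^sup>2 * \<sigma> / 2 * (2 * \<rho> * X) = (l a)\<^sup>2 * \<rho> * (\<sigma> * X)" for X
        by simp
      ultimately show ?thesis by (simp only:)
    qed
    also have "\<dots> \<longleftrightarrow> \<rho> * (1 + z)\<^sup>2 \<le> \<sigma> * (A * (1 - \<rho> * S) + \<rho> * Q)"
      using lpos \<rho> by (intro mult_le_cancel_left_pos) auto
    also have "\<dots> \<longleftrightarrow> \<rho> * e \<le> \<sigma> * A"
      unfolding e by (simp add: algebra_simps)
    also have "\<dots> \<longleftrightarrow> \<rho> \<le> \<sigma> * A / e" using e0 by (simp add: field_simps)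
    finally show "?x \<in> hb a \<sigma> \<inter> hhull V \<longleftrightarrow> \<rho> \<le> \<sigma> * (l a * (1 + z)) / E t z"
      using x(3) by (simp add: A_def e_def)
  qed simp_all
  also have "(\<integral>\<^sup>+z. ennreal (\<sigma> / (1 + z) ^ 3 / (4 * l a)) * indicator {0..} z \<partial>lborel) = ennreal (\<sigma> / (8 * l a))"
  proof -
    have "(\<integral>\<^sup>+z. ennreal (\<sigma> / (1 + z) ^ 3 / (4 * l a)) * indicator {0..} z \<partial>lborel) =
        (\<integral>\<^sup>+z. ennreal (\<sigma> / (4 * l a)) * (ennreal (1 / (1 + z) ^ 3) * indicator {0..} z) \<partial>lborel)"
    proof (rule nn_integral_cong)
      fix z
      have "ennreal (\<sigma> / (1 + z) ^ 3 / (4 * l a)) = ennreal (\<sigma> / (4 * l a)) * ennreal (1 / (1 + z) ^ 3)"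
        using lpos \<sigma> by (subst ennreal_mult'[symmetric]) (simp_all add: mult.commute)
      then show "ennreal (\<sigma> / (1 + z) ^ 3 / (4 * l a)) * indicator {0..} z =
          ennreal (\<sigma> / (4 * l a)) * (ennreal (1 / (1 + z) ^ 3) * indicator {0..} z)"
        by (simp only: mult.assoc)
    qed
    also have "\<dots> = ennreal (\<sigma> / (4 * l a)) * ennreal (1 / 2)"
      by (subst nn_integral_cmult) (simp_all add: nn_integral_inverse_cube)
    also have "\<dots> = ennreal (\<sigma> / (8 * l a))"
      using lpos \<sigma> by (subst ennreal_mult[symmetric]) simp_all
    finally show ?thesis .
  qed
  also have "(\<integral>\<^sup>+t. ennreal (\<sigma> / (8 * l a)) * indicator {0<..<1::real} t \<partial>lborel) = ennreal (\<sigma> / (8 * l a))"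
    by (simp add: nn_integral_cmult_indicator)
  also have "ennreal (sqrt 3 * l a) * ennreal (\<sigma> / (8 * l a)) = ennreal (sqrt 3 / 8 * \<sigma>)"
    using lpos \<sigma> by (simp add: ennreal_mult[symmetric])
  finally show ?thesis .
qed

end

context normalized_tetrahedron
begin

lemma marked:
  assumes "v \<in> V"
  obtains b c d where "marked_tetrahedron V l v b c d"
proof -
  obtain b c d where "V = {v, b, c, d}" "distinct [v, b, c, d]"
    using enum_V[OF assms] .
  then have "marked_tetrahedron V l v b c d"
    by unfold_locales auto
  then show thesis by (rule that)
qed

lemma hvol_hull: "hvol (hhull V) = sqrt 3 / 2 * suminf gieseking_term"
proof -
  obtain v where "v \<in> V" using card_V by fastforce
  then obtain b c d where "marked_tetrahedron V l v b c d" by (rule marked)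
  from marked_tetrahedron.emeasure_hull[OF this] show ?thesis
    using gieseking_bounds(2) by (simp add: hvol_def measure_def)
qed

lemma hvol_sector:
  assumes "v \<in> V" "0 < \<sigma>" "\<sigma> \<le> 3"
  shows "hvol (hb v \<sigma> \<inter> hhull V) = sqrt 3 / 8 * \<sigma>"
proof -
  obtain b c d where "marked_tetrahedron V l v b c d" using assms(1) by (rule marked)
  from marked_tetrahedron.emeasure_sector[OF this assms(2,3)] show ?thesis
    using assms by (simp add: hvol_def measure_def)
qed

end

section \<open>Optimal arrangements\<close>

text \<open>If \<open>r v > 1\<close>, the other terms are at most \<open>1 / r v\<close>, and \<open>x + 3 / x \<le> 4\<close> on \<open>{1..3}\<close> with
  equality at both ends: this is why there are two optimal arrangements.\<close>

lemma sum_le_4: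
  fixes r :: "'a \<Rightarrow> real"
  assumes card: "card V = 4" and pos: "\<And>v. v \<in> V \<Longrightarrow> 0 < r v \<and> r v \<le> 3"
    and prod: "\<And>v w. v \<in> V \<Longrightarrow> w \<in> V \<Longrightarrow> v \<noteq> w \<Longrightarrow> r v * r w \<le> 1"
  shows "(\<Sum>v\<in>V. r v) \<le> 4"
proof (cases "\<exists>v\<in>V. r v > 1")
  case False
  then have "(\<Sum>v\<in>V. r v) \<le> of_nat (card V) * 1"
    by (intro sum_bounded_above) (auto simp: not_less)
  then show ?thesis using card by simp
next
  case True
  then obtain v where v: "v \<in> V" "r v > 1" by blast
  have fin: "finite V" using card by (metis card.infinite zero_neq_numeral)
  have "(\<Sum>w\<in>V - {v}. r w) \<le> of_nat (card (V - {v})) * (1 / r v)"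
  proof (rule sum_bounded_above)
    fix w assume "w \<in> V - {v}"
    then have "w \<in> V" "v \<noteq> w" by auto
    then have "r v * r w \<le> 1" by (rule prod[OF v(1)])
    then show "r w \<le> 1 / r v" using v by (simp add: field_simps)
  qed
  also have "card (V - {v}) = 3" using card v fin by simp
  finally have "(\<Sum>w\<in>V. r w) \<le> r v + 3 / r v"
    using fin v by (simp add: sum.remove)
  also have "\<dots> \<le> 4"
  proof -
    have "(r v - 1) * (r v - 3) \<le> 0" using v pos[OF v(1)] by (intro mult_nonneg_nonpos) auto
    then show ?thesis using v by (simp add: field_simps)
  qed
  finally show ?thesis .
qed

context normalized_tetrahedron
begin

lemma arr_density_hb:
  assumes "\<And>v. v \<in> V \<Longrightarrow> 0 < r v \<and> r v \<le> 3 \<and> B v = hb v (r v)"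
  shows "arr_density V B = (\<Sum>v\<in>V. r v) / (4 * suminf gieseking_term)"
proof -
  have "(\<Sum>v\<in>V. hvol (B v \<inter> hhull V)) = (\<Sum>v\<in>V. sqrt 3 / 8 * r v)"
    using assms by (intro sum.cong) (auto simp: hvol_sector)
  also have "\<dots> = sqrt 3 / 8 * (\<Sum>v\<in>V. r v)"
    by (rule sum_distrib_left[symmetric])
  finally have total: "(\<Sum>v\<in>V. hvol (B v \<inter> hhull V)) = sqrt 3 / 8 * (\<Sum>v\<in>V. r v)" .
  show ?thesis
    unfolding arr_density_def total hvol_hull by simp
qed

lemma admissible_arr_density_le:
  assumes "admissible V B"
  shows "arr_density V B \<le> 1 / suminf gieseking_term"
proof -
  obtain r where r: "\<And>v. v \<in> V \<Longrightarrow> 0 < r v \<and> r v \<le> 3 \<and> B v = hb v (r v)"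
    "\<And>v w. v \<in> V \<Longrightarrow> w \<in> V \<Longrightarrow> v \<noteq> w \<Longrightarrow> r v * r w \<le> 1"
    using assms unfolding admissible_iff by blast
  have "(\<Sum>v\<in>V. r v) \<le> 4"
    using r by (intro sum_le_4[OF card_V]) auto
  moreover have "arr_density V B = (\<Sum>v\<in>V. r v) / (4 * suminf gieseking_term)"
    by (rule arr_density_hb) (rule r(1))
  ultimately show ?thesis
    using gieseking_bounds(2) by (simp add: field_simps)
qed

text \<open>Besides tangency, plain intersection is characterised: a common point survives under the
  image of an arbitrary map, which is what comparing arrangements up to equivalence
  requires.\<close>

lemma horoballs_meet_iff:
  assumes vw: "v \<in> V" "w \<in> V" "v \<noteq> w" and pos: "0 < \<rho>" "0 < \<rho>'" and le: "\<rho> * \<rho>' \<le> 1"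
  shows "hb v \<rho> \<inter> hb w \<rho>' \<noteq> {} \<longleftrightarrow> \<rho> * \<rho>' = 1"
proof
  assume "hb v \<rho> \<inter> hb w \<rho>' \<noteq> {}"
  then obtain x where "x \<in> hb v \<rho>" "x \<in> hb w \<rho>'" by blast
  then show "\<rho> * \<rho>' = 1"
    using null_pair.horoballs_meet[OF pair[OF vw] _ _ pos le] by (simp add: hb_def)
next
  assume "\<rho> * \<rho>' = 1"
  from null_pair.horoballs_tangent_at[OF pair[OF vw] pos(1) this] show "hb v \<rho> \<inter> hb w \<rho>' \<noteq> {}"
    by (simp add: tangent_at_def hb_def)
qed

lemma tangent_iff:
  assumes vw: "v \<in> V" "w \<in> V" "v \<noteq> w" and pos: "0 < \<rho>" "0 < \<rho>'" and le: "\<rho> * \<rho>' \<le> 1"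
  shows "tangent (hb v \<rho>) (hb w \<rho>') \<longleftrightarrow> \<rho> * \<rho>' = 1"
proof
  assume "tangent (hb v \<rho>) (hb w \<rho>')"
  then have "hb v \<rho> \<inter> hb w \<rho>' \<noteq> {}" by (auto simp: tangent_def tangent_at_def)
  then show "\<rho> * \<rho>' = 1" using horoballs_meet_iff[OF vw pos le] by blast
next
  assume "\<rho> * \<rho>' = 1"
  from null_pair.horoballs_tangent_at[OF pair[OF vw] pos(1) this] show "tangent (hb v \<rho>) (hb w \<rho>')"
    unfolding tangent_def hb_def by blast
qed

lemma tangent_face_iff:
  assumes v: "v \<in> V" and \<rho>: "0 < \<rho>" "\<rho> \<le> 3"
  shows "tangent (hb v \<rho>) (opposite_face V v) \<longleftrightarrow> \<rho> = 3"
proof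
  assume "tangent (hb v \<rho>) (opposite_face V v)"
  then show "\<rho> = 3" using face_horoball(4)[OF v \<rho>] by (auto simp: tangent_def tangent_at_def)
next
  assume "\<rho> = 3"
  then have "hb v \<rho> \<inter> opposite_face V v = {face_center v}"
    using face_horoball(1,2)[OF v \<rho>(1)] face_horoball(4)[OF v \<rho>] by blast
  then show "tangent (hb v \<rho>) (opposite_face V v)" by (auto simp: tangent_def tangent_at_def)
qed

section \<open>The two arrangements as parameter values\<close>

lemma arrangement_1_iff:
  "arrangement_336_1 V B \<longleftrightarrow> (\<forall>v\<in>V. B v = hb v 1)"
proof
  assume arr: "arrangement_336_1 V B"
  then obtain r where r: "\<And>v. v \<in> V \<Longrightarrow> 0 < r v" "\<And>v. v \<in> V \<Longrightarrow> B v = hb v (r v)"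
    "\<And>v w. v \<in> V \<Longrightarrow> w \<in> V \<Longrightarrow> v \<noteq> w \<Longrightarrow> r v * r w \<le> 1"
    unfolding arrangement_336_1_def admissible_iff by blast
  have one: "r v * r w = 1" if "v \<in> V" "w \<in> V" "v \<noteq> w" for v w
  proof -
    have "B v \<inter> B w \<noteq> {}"
      using arr that unfolding arrangement_336_1_def tangent_at_def by blast
    then show ?thesis
      using horoballs_meet_iff[OF that r(1)[OF that(1)] r(1)[OF that(2)] r(3)[OF that]] r(2) that by simp
  qed
  show "\<forall>v\<in>V. B v = hb v 1"
  proof
    fix v assume v: "v \<in> V"
    then obtain b c d where V: "V = {v, b, c, d}" "distinct [v, b, c, d]" using enum_V by blast
    then have m: "b \<in> V" "c \<in> V" "v \<noteq> b" "v \<noteq> c" "b \<noteq> c" by auto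
    \<comment> \<open>One tangency only makes two parameters inverse to each other; a triangle of
      tangencies forces them to be 1.\<close>
    have "r v * r b = r v * r c" using one v m by simp
    then have "r b = r c" using r(1)[OF v] by simp
    then have "r v * r v = 1" using one[OF m(1,2,5)] one[OF v m(1,3)] r(1)[OF v] r(1)[OF m(1)]
      by (metis mult.commute mult_cancel_right less_irrefl)
    then have "r v = 1" using r(1)[OF v] by (simp add: square_eq_1_iff)
    then show "B v = hb v 1" using r(2)[OF v] by simp
  qed
next
  assume B: "\<forall>v\<in>V. B v = hb v 1"
  have adm: "admissible V B"
    unfolding admissible_iff using B by (intro exI[of _ "\<lambda>_. 1"]) simp
  show "arrangement_336_1 V B"
    unfolding arrangement_336_1_def
  proof (intro conjI ballI impI adm)
    fix v w assume vw: "v \<in> V" "w \<in> V"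
    show "same_type V (B v) (B w)" using B vw same_type_hb by simp
    assume ne: "v \<noteq> w"
    show "\<exists>m. is_edge_midpoint V v w m \<and> tangent_at (B v) (B w) m"
      using edge_midpoint[OF vw ne] null_pair.horoballs_tangent_at[OF pair[OF vw ne], of 1 1] B vw
      by (auto simp: hb_def)
  qed
qed

text \<open>Tangency to the face forces the parameter 3 and tangency to the large horoball then
  forces 1 / 3; the product 1 / 9 < 1 keeps the small horoballs apart.\<close>

lemma arrangement_2_iff:
  "arrangement_336_2 V B \<longleftrightarrow> (\<exists>v\<in>V. B v = hb v 3 \<and> (\<forall>w\<in>V - {v}. B w = hb w (1 / 3)))"
proof
  assume arr: "arrangement_336_2 V B"
  then obtain r where r: "\<And>v. v \<in> V \<Longrightarrow> 0 < r v" "\<And>v. v \<in> V \<Longrightarrow> r v \<le> 3" "\<And>v. v \<in> V \<Longrightarrow> B v = hb v (r v)"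
    "\<And>v w. v \<in> V \<Longrightarrow> w \<in> V \<Longrightarrow> v \<noteq> w \<Longrightarrow> r v * r w \<le> 1"
  proof -
    have "admissible V B" using arr by (simp add: arrangement_336_2_def)
    then show thesis using that unfolding admissible_iff by blast
  qed
  have "\<exists>v\<in>V. tangent (B v) (opposite_face V v) \<and> (\<forall>w\<in>V - {v}. tangent (B v) (B w))"
    using arr unfolding arrangement_336_2_def by (elim conjE bexE) (intro bexI conjI)
  then obtain v where v: "v \<in> V" "tangent (B v) (opposite_face V v)" "\<And>w. w \<in> V - {v} \<Longrightarrow> tangent (B v) (B w)"
    by blast
  have r3: "r v = 3" using tangent_face_iff[OF v(1) r(1,2)[OF v(1)]] v(2) r(3)[OF v(1)] by simp
  have "B w = hb w (1 / 3)" if w: "w \<in> V - {v}" for w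
  proof -
    have w': "w \<in> V" "v \<noteq> w" using w by auto
    have "r v * r w = 1"
      using tangent_iff[OF v(1) w' r(1)[OF v(1)] r(1)[OF w'(1)] r(4)[OF v(1) w']] v(3)[OF w] r(3) v(1) w'(1) by simp
    then have rw: "r w = 1 / 3" using r3 by simp
    show ?thesis using r(3)[OF w'(1)] unfolding rw .
  qed
  then show "\<exists>v\<in>V. B v = hb v 3 \<and> (\<forall>w\<in>V - {v}. B w = hb w (1 / 3))"
    using v(1) r3 r(3)[OF v(1)] by auto
next
  assume "\<exists>v\<in>V. B v = hb v 3 \<and> (\<forall>w\<in>V - {v}. B w = hb w (1 / 3))"
  then obtain v where v: "v \<in> V" and B: "B v = hb v 3" "\<And>w. w \<in> V - {v} \<Longrightarrow> B w = hb w (1 / 3)" by blast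
  have adm: "admissible V B"
    unfolding admissible_iff using B by (intro exI[of _ "\<lambda>w. if w = v then 3 else 1 / 3"]) auto
  show "arrangement_336_2 V B"
    unfolding arrangement_336_2_def
  proof (intro conjI adm bexI[OF _ v] ballI impI)
    show "tangent (B v) (opposite_face V v)" using tangent_face_iff[OF v, of 3] B by simp
    fix w assume w: "w \<in> V - {v}"
    then show "tangent (B v) (B w)" using tangent_iff[OF v, of w 3 "1/3"] B by auto
    fix w' assume w': "w' \<in> V - {v}"
    show "same_type V (B w) (B w')" using B w w' same_type_hb by simp
    assume "w \<noteq> w'"
    then show "\<not> tangent (B w) (B w')" using tangent_iff[of w w' "1/3" "1/3"] B w w' by auto
  qed
qed

lemma arrangement_density:
  assumes "arrangement_336_1 V B \<or> arrangement_336_2 V B"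
  shows "arr_density V B = 1 / suminf gieseking_term"
proof -
  have "\<exists>r. (\<forall>v\<in>V. 0 < r v \<and> r v \<le> 3 \<and> B v = hb v (r v)) \<and> (\<Sum>v\<in>V. r v) = 4"
  proof (cases "arrangement_336_1 V B")
    case True
    then show ?thesis
      unfolding arrangement_1_iff using card_V by (intro exI[of _ "\<lambda>_. 1"]) simp
  next
    case False
    then obtain v where v: "v \<in> V" "B v = hb v 3" "\<And>w. w \<in> V - {v} \<Longrightarrow> B w = hb w (1 / 3)"
      using assms unfolding arrangement_2_iff by blast
    let ?r = "\<lambda>w. if w = v then 3 else 1 / 3 :: real"
    have "(\<Sum>w\<in>V. ?r w) = 3 + (\<Sum>w\<in>V - {v}. ?r w)"
      using finite_V v(1) by (simp add: sum.remove)
    also have "(\<Sum>w\<in>V - {v}. ?r w) = (\<Sum>w\<in>V - {v}. 1 / 3)"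
      by (intro sum.cong) auto
    also have "3 + \<dots> = 4" using card_V finite_V v(1) by simp
    finally show ?thesis using v by (intro exI[of _ ?r]) auto
  qed
  then obtain r where r: "\<And>v. v \<in> V \<Longrightarrow> 0 < r v \<and> r v \<le> 3 \<and> B v = hb v (r v)" "(\<Sum>v\<in>V. r v) = 4"
    by blast
  have "arr_density V B = (\<Sum>v\<in>V. r v) / (4 * suminf gieseking_term)"
    by (rule arr_density_hb) (rule r(1))
  then show ?thesis by (simp add: r(2))
qed

lemma arrangement_optimally_dense:
  assumes "arrangement_336_1 V B \<or> arrangement_336_2 V B"
  shows "optimally_dense V B"
proof -
  have "admissible V B"
    using assms by (auto simp: arrangement_336_1_def arrangement_336_2_def)
  then show ?thesis
    using admissible_arr_density_le arrangement_density[OF assms] by (simp add: optimally_dense_def)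
qed

text \<open>The horoballs of the first arrangement meet pairwise, two small ones of the second do not.\<close>

lemma arrangements_not_equivalent:
  assumes "arrangement_336_1 V B1" "arrangement_336_2 V B2"
  shows "\<not> equivalent_arr V B1 B2"
proof
  assume "equivalent_arr V B1 B2"
  then obtain f where f: "(\<lambda>v. f ` B1 v) ` V = B2 ` V"
    unfolding equivalent_arr_def by blast
  obtain v where v: "v \<in> V" "\<And>w. w \<in> V - {v} \<Longrightarrow> B2 w = hb w (1 / 3)"
    using assms(2) unfolding arrangement_2_iff by blast
  obtain b c d where V: "V = {v, b, c, d}" "distinct [v, b, c, d]" using enum_V[OF v(1)] .
  then have m: "b \<in> V" "c \<in> V" "b \<noteq> c" "b \<in> V - {v}" "c \<in> V - {v}" by auto
  have "B2 b \<in> (\<lambda>v. f ` B1 v) ` V" "B2 c \<in> (\<lambda>v. f ` B1 v) ` V"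
    unfolding f using m by auto
  then obtain x y where xy: "x \<in> V" "y \<in> V" "B2 b = f ` B1 x" "B2 c = f ` B1 y" by blast
  have B1: "\<And>v. v \<in> V \<Longrightarrow> B1 v = hb v 1" using assms(1) unfolding arrangement_1_iff by blast
  have meet: "hb x 1 \<inter> hb y 1 \<noteq> {}" if "x \<in> V" "y \<in> V" "x \<noteq> y" for x y
    using horoballs_meet_iff[OF that, of 1 1] by simp
  have "B1 x \<inter> B1 y \<noteq> {}"
  proof (cases "x = y")
    case True
    \<comment> \<open>Here both small horoballs would be images of the same horoball. It is nonempty
      because it meets the one at another vertex, and this already gives a common point of the
      images.\<close>
    obtain z where "z \<in> V" "x \<noteq> z" using m by metis
    then show ?thesis using meet[OF xy(1)] B1 xy True by auto
  next
    case False
    then show ?thesis using meet xy B1 by simp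
  qed
  then have "hb b (1 / 3) \<inter> hb c (1 / 3) \<noteq> {}"
    using xy(3,4) v(2)[OF m(4)] v(2)[OF m(5)] by auto
  then show False using horoballs_meet_iff[OF m(1,2,3), of "1/3" "1/3"] by simp
qed

end

lemma gieseking_density: "\<bar>1 / suminf gieseking_term - 0.85327609\<bar> \<le> 5 / 10 ^ 9"
proof -
  define J where "J = suminf gieseking_term"
  have J: "1.1719536103 \<le> J" "J \<le> 1.1719536238"
    using gieseking_bounds by (simp_all add: J_def)
  have "1 / J \<le> 1 / 1.1719536103" "1 / 1.1719536238 \<le> 1 / J"
    using J by (intro divide_left_mono; simp)+
  moreover have "1 / 1.1719536103 \<le> (0.853276095 :: real)" "(0.853276085 :: real) \<le> 1 / 1.1719536238"
    by simp_all
  ultimately have "1 / J \<le> 0.853276095" "0.853276085 \<le> 1 / J"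
    by (meson order_trans)+
  then have "1 / J - 0.85327609 \<le> 5 / 10 ^ 9" "- (1 / J - 0.85327609) \<le> 5 / 10 ^ 9"
    by simp_all
  then show ?thesis unfolding J_def by (rule abs_leI)
qed

theorem theorem4p7:
  fixes T :: "point set set" and V :: "point set"
  assumes "coxeter_tiling_336 T" and "V \<in> T"
  shows "(\<exists>B. arrangement_336_1 V B) \<and>
         (\<exists>B. arrangement_336_2 V B) \<and>
         (\<forall>B1 B2. arrangement_336_1 V B1 \<and> arrangement_336_2 V B2 \<longrightarrow>
            optimally_dense V B1 \<and> optimally_dense V B2 \<and>
            \<not> equivalent_arr V B1 B2 \<and>
            arr_density V B1 = arr_density V B2 \<and>
            \<bar>arr_density V B1 - 0.85327609\<bar> \<le> 5 / 10 ^ 9 \<and>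
            \<bar>arr_density V B2 - 0.85327609\<bar> \<le> 5 / 10 ^ 9)"
proof -
  have "cell_336 V" using assms by (auto simp: coxeter_tiling_336_def)
  then obtain l where "normalized_tetrahedron V l" using cell_336_normalized by blast
  then interpret normalized_tetrahedron V l .
  obtain v where v: "v \<in> V" using card_V by fastforce
  have "arrangement_336_1 V (\<lambda>v. hb v 1)" unfolding arrangement_1_iff by simp
  moreover have "arrangement_336_2 V (\<lambda>w. if w = v then hb w 3 else hb w (1 / 3))"
    unfolding arrangement_2_iff using v by auto
  ultimately show ?thesis
    using arrangement_optimally_dense arrangements_not_equivalent arrangement_density gieseking_density
    by auto
qed

end
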